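(* Let $\mathbb F$ be a field of characteristic $0$ and let $\mathcal L=(\mathfrak g\otimes A)\oplus(\mathfrak s\otimes B)\oplus(V\otimes C)\oplus\langle\mathfrak b,\mathfrak b\rangle$ be a Lie algebra over $\mathbb F$ graded by the root system $\mathrm{BC}_r$ for $r\ge3$ with coordinate algebra $\mathfrak b=\mathfrak a\oplus C$, where $\mathfrak a=A\oplus B$. Then $\operatorname{Cent}(\mathcal L)\cong\mathfrak Z_{\mathfrak a}$, where $\mathfrak Z_{\mathfrak a}$ is the set of elements $\mathfrak z\in Z(\mathfrak a)\cap A$ satisfying: (a) $\langle\mathfrak z\beta,\beta'\rangle=\langle\beta,\mathfrak z\beta'\rangle$ for all $\beta,\beta'\in\mathfrak b$; (b) $\sum_t\langle\beta_t,\beta_t'\rangle=0$ implies $\sum_t\langle\mathfrak z\beta_t,\beta'_t\rangle=0$ for all (finitely many) $\beta_t,\beta_t'\in\mathfrak b$. More specifically, if $\mathfrak z\in Z(\mathfrak a)\cap A$ satisfies (a) and (b), and if $\Psi\in\operatorname{End}_{\mathbb F}(\mathcal L)$ is given by $$\Psi(x\otimes a)=x\otimes\mathfrak za,\quad\Psi(s\otimes b)=s\otimes\mathfrak zb,\quad\Psi(v\otimes c)=v\otimes\mathfrak z.c,\quad\Psi(\langle\beta,\beta'\rangle)=\langle\mathfrak z\beta,\beta'\rangle=\langle\beta,\mathfrak z\beta'\rangle$$ for all $x\in\mathfrak g$, $a\in A$, $s\in\mathfrak s$, $b\in B$, $v\in V$, $c\in C$, $\beta,\beta'\in\mathfrak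 b$, then $\Psi\in\operatorname{Cent}(\mathcal L)$; and every element of $\operatorname{Cent}(\mathcal L)$ has this form.
   Context: $\operatorname{Cent}(\mathcal L)=\{\chi\in\operatorname{End}_{\mathbb F}(\mathcal L)\mid\chi([x,y])=[x,\chi(y)]=[\chi(x),y]\}$. The centre $Z(\mathfrak a)$ of a (not necessarily associative) algebra consists of the $z$ with $za=az$ and $(a,b,z)=(a,z,b)=(z,a,b)=0$ for all $a,b$, where $(a,b,c)=(ab)c-a(bc)$. $\mathrm{BC}_r$-graded Lie algebra ($r\geq 3$), with $\Delta=\mathrm{BC}_r$: a Lie algebra $\mathcal L$ over $\mathbb F$ containing a finite-dimensional split simple Lie algebra $\mathfrak g$ (the grading subalgebra) with split Cartan subalgebra $\mathfrak h$ and root system $\Delta_{\mathfrak g}$ of type $B_r$, $C_r$ or $D_r$ (contained in $\Delta\subset\mathfrak h^*$), such that $\mathcal L=\bigoplus_{\alpha\in\Delta\cup\{0\}}\mathcal L_\alpha$, $\mathcal L_\alpha=\{x\mid[h,x]=\alpha(h)x\ \forall h\in\mathfrak h\}$, and $\mathcal L_0=\sum_{\alpha\in\Delta}[\mathcal L_\alpha,\mathcal L_{-\alpha}]$. Known structure (taken as given): let $V$ be the natural $\mathfrak g$-module, $n=\dim V$, with its $\mathfrak g$-invariant nondegenerate form $(\cdot,\cdot)$ (symmetric for $B_r,D_r$; skew for $C_r$), so $\mathfrak g=\{x\in\operatorname{End}V\mid(xu,v)=-(u,xv)\}$, and let $\mathfrak s=\{s\in\operatorname{End}V\mid(su,v)=(u,sv),\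 \mathrm{tr}\,s=0\}$; both $\mathfrak s$ and $V$ are irreducible $\mathfrak g$-modules. Then $\mathcal L=(\mathfrak g\otimes A)\oplus(\mathfrak s\otimes B)\oplus(V\otimes C)\oplus D$ with $D$ the sum of the trivial $\mathfrak g$-submodules, where: $\mathfrak a=A\oplus B$ is a unital algebra with involution $\eta$, with symmetric elements $A$ and skew-symmetric elements $B$; $\mathfrak a$ is associative, except that for $\mathfrak g$ of type $C_3$ it is alternative with $A$ contained in the nucleus; $C$ is a left $\mathfrak a$-module with a form $\chi:C\times C\to\mathfrak a$ which is hermitian for $B_r,D_r$ and skew-hermitian for $C_r$ (with respect to $\eta$; $\chi$ is $\mathfrak a$-linear in the first variable); $\mathfrak b=\mathfrak a\oplus C$ is an algebra with product $(\alpha+c)\cdot(\alpha'+c')=\alpha\alpha'+\chi(c,c')+\alpha.c'+\alpha'^{\eta}.c$. There is a bilinear map $\langle\cdot,\cdot\rangle:\mathfrak b\times\mathfrak b\to D$ with $D=\langle\mathfrak b,\mathfrak b\rangle=\langle\mathfrak a,\mathfrak a\rangle+\langle C,C\rangle$, where $\langle A,B\rangle=\langle B,A\rangle=\langle\mathfrak a,C\rangle=\langle C,\mathfrak a\rangle=0$; $D$ acts on $\mathfrak b$ by (inner) derivations preserving $A,B,C$. For $\mathfrak z\in\mathfrak a$ central and symmetric, $\mathfrak z(\alpha+c)=\mathfrak z\alpha+\mathfrak z.c$. Brackets, with $w\circ z=wz+zw-\frac2n\mathrm{tr}(wz)I$ for matrices, $x,y\in\mathfrak g$, $s,t\in\mathfrak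 s$, $u,v\in V$, $a,a'\in A$, $b,b'\in B$, $c,c'\in C$, $d\in D$: $[x\otimes a,y\otimes a']=[x,y]\otimes\frac12(aa'+a'a)+(x\circ y)\otimes\frac12(aa'-a'a)+\mathrm{tr}(xy)\langle a,a'\rangle$; $[x\otimes a,s\otimes b]=(x\circ s)\otimes\frac12(ab-ba)+[x,s]\otimes\frac12(ab+ba)$; $[s\otimes b,t\otimes b']=[s,t]\otimes\frac12(bb'+b'b)+(s\circ t)\otimes\frac12(bb'-b'b)+\mathrm{tr}(st)\langle b,b'\rangle$; $[x\otimes a,u\otimes c]=xu\otimes a.c$; $[s\otimes b,u\otimes c]=su\otimes b.c$; $[u\otimes c,v\otimes c']=\gamma_{u,v}\otimes\chi(c,c')_A+\sigma_{u,v}\otimes\chi(c,c')_B+(u,v)\langle c,c'\rangle$, where $\chi(c,c')_A,\chi(c,c')_B$ are the $A$- and $B$-components of $\chi(c,c')$ and $\gamma:V\times V\to\mathfrak g$, $\sigma:V\times V\to\mathfrak s$ are suitably normalized nonzero $\mathfrak g$-equivariant bilinear maps (unique up to scalar); $[d,x\otimes a]=x\otimes da$, $[d,s\otimes b]=s\otimes db$, $[d,u\otimes c]=u\otimes dc$. *)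

theory Defs
  imports "HOL-Analysis.Determinants"
begin

section \<open>Linear algebra over an arbitrary field\<close>

definition mat_scale :: "'f::field \<Rightarrow> 'f^'n^'m \<Rightarrow> 'f^'n^'m" where
  "mat_scale k x = (\<chi> i. k *s (x $ i))"

lemma vector_space_mat_scale: "vector_space mat_scale"
  by unfold_locales
    (simp_all add: mat_scale_def vec_eq_iff vector_scalar_mult_def algebra_simps)

definition prod_scale :: "('f \<Rightarrow> 'a \<Rightarrow> 'a) \<Rightarrow> ('f \<Rightarrow> 'c \<Rightarrow> 'c) \<Rightarrow> 'f \<Rightarrow> 'a \<times> 'c \<Rightarrow> 'a \<times> 'c" where
  "prod_scale sA sC k p = (sA k (fst p), sC k (snd p))"

definition linear_on ::
  "('f::field \<Rightarrow> 'x::ab_group_add \<Rightarrow> 'x) \<Rightarrow> ('f \<Rightarrow> 'z::ab_group_add \<Rightarrow> 'z) \<Rightarrow> 'x set \<Rightarrow> ('x \<Rightarrow> 'z) \<Rightarrow> bool" where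
  "linear_on sX sZ X p \<longleftrightarrow>
     (\<forall>x\<in>X. \<forall>x'\<in>X. p (x + x') = p x + p x') \<and> (\<forall>k. \<forall>x\<in>X. p (sX k x) = sZ k (p x))"

definition bilinear_on ::
  "('f::field \<Rightarrow> 'x::ab_group_add \<Rightarrow> 'x) \<Rightarrow> ('f \<Rightarrow> 'y::ab_group_add \<Rightarrow> 'y) \<Rightarrow> ('f \<Rightarrow> 'z::ab_group_add \<Rightarrow> 'z)
     \<Rightarrow> 'x set \<Rightarrow> 'y set \<Rightarrow> ('x \<Rightarrow> 'y \<Rightarrow> 'z) \<Rightarrow> bool" where
  "bilinear_on sX sY sZ X Y p \<longleftrightarrow>
     (\<forall>x\<in>X. linear_on sY sZ Y (p x)) \<and> (\<forall>y\<in>Y. linear_on sX sZ X (\<lambda>x. p x y))"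

text \<open>A bilinear map \<open>t\<close> on \<open>X \<times> Y\<close> realises the tensor product of the subspaces \<open>X\<close> and \<open>Y\<close>
  inside the target space when the induced linear map out of the tensor product is injective,
  i.e. when the products of basis elements are distinct and linearly independent.  The tensor
  product is then the span of the values of \<open>t\<close>.\<close>

definition tensor_map ::
  "('f::field \<Rightarrow> 'x::ab_group_add \<Rightarrow> 'x) \<Rightarrow> ('f \<Rightarrow> 'y::ab_group_add \<Rightarrow> 'y) \<Rightarrow> ('f \<Rightarrow> 'z::ab_group_add \<Rightarrow> 'z)
     \<Rightarrow> 'x set \<Rightarrow> 'y set \<Rightarrow> ('x \<Rightarrow> 'y \<Rightarrow> 'z) \<Rightarrow> bool" where
  "tensor_map sX sY sZ X Y t \<longleftrightarrow> bilinear_on sX sY sZ X Y t \<and>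
     (\<forall>P Q. P \<subseteq> X \<and> \<not> module.dependent sX P \<and> Q \<subseteq> Y \<and> \<not> module.dependent sY Q \<longrightarrow>
        inj_on (\<lambda>(x, y). t x y) (P \<times> Q) \<and> \<not> module.dependent sZ ((\<lambda>(x, y). t x y) ` (P \<times> Q)))"

definition tensor_space ::
  "('f::field \<Rightarrow> 'z::ab_group_add \<Rightarrow> 'z) \<Rightarrow> 'x set \<Rightarrow> 'y set \<Rightarrow> ('x \<Rightarrow> 'y \<Rightarrow> 'z) \<Rightarrow> 'z set" where
  "tensor_space sZ X Y t = module.span sZ {t x y | x y. x \<in> X \<and> y \<in> Y}"

text \<open>The whole space is the internal direct sum of the \<open>U i\<close>, \<open>i \<in> I\<close>, for finite \<open>I\<close>.\<close>

definition internal_direct_sum :: "'i set \<Rightarrow> ('i \<Rightarrow> 'z::ab_group_add set) \<Rightarrow> bool" where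
  "internal_direct_sum I U \<longleftrightarrow>
     (\<forall>z. \<exists>!p. (\<forall>i\<in>I. p i \<in> U i) \<and> (\<forall>i. i \<notin> I \<longrightarrow> p i = 0) \<and> z = (\<Sum>i\<in>I. p i))"

section \<open>Algebras, centre, centroid\<close>

definition associator :: "('a::ab_group_add \<Rightarrow> 'a \<Rightarrow> 'a) \<Rightarrow> 'a \<Rightarrow> 'a \<Rightarrow> 'a \<Rightarrow> 'a" where
  "associator mul a b c = mul (mul a b) c - mul a (mul b c)"

definition algebra_center :: "('a::ab_group_add \<Rightarrow> 'a \<Rightarrow> 'a) \<Rightarrow> 'a set" where
  "algebra_center mul = {z. \<forall>a b. mul z a = mul a z \<and>
     associator mul a b z = 0 \<and> associator mul a z b = 0 \<and> associator mul z a b = 0}"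

definition algebra_nucleus :: "('a::ab_group_add \<Rightarrow> 'a \<Rightarrow> 'a) \<Rightarrow> 'a set" where
  "algebra_nucleus mul = {z. \<forall>a b.
     associator mul a b z = 0 \<and> associator mul a z b = 0 \<and> associator mul z a b = 0}"

definition alternative_algebra :: "('a::ab_group_add \<Rightarrow> 'a \<Rightarrow> 'a) \<Rightarrow> bool" where
  "alternative_algebra mul \<longleftrightarrow> (\<forall>a b. associator mul a a b = 0 \<and> associator mul b a a = 0)"

definition associative_algebra :: "('a::ab_group_add \<Rightarrow> 'a \<Rightarrow> 'a) \<Rightarrow> bool" where
  "associative_algebra mul \<longleftrightarrow> (\<forall>a b c. associator mul a b c = 0)"

definition centroid :: "('f::field \<Rightarrow> 'l::ab_group_add \<Rightarrow> 'l) \<Rightarrow> ('l \<Rightarrow> 'l \<Rightarrow> 'l) \<Rightarrow> ('l \<Rightarrow> 'l) set" where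
  "centroid sL br = {\<phi>. Vector_Spaces.linear sL sL \<phi> \<and>
     (\<forall>x y. \<phi> (br x y) = br x (\<phi> y) \<and> \<phi> (br x y) = br (\<phi> x) y)}"

text \<open>\<open>\<Phi>\<close> is an isomorphism from the algebra with carrier \<open>S\<close>, addition, scalar multiplication
  and multiplication \<open>add\<close>, \<open>sc\<close>, \<open>mul\<close>, onto a second such algebra.\<close>

definition algebra_iso ::
  "'x set \<Rightarrow> ('x \<Rightarrow> 'x \<Rightarrow> 'x) \<Rightarrow> ('f \<Rightarrow> 'x \<Rightarrow> 'x) \<Rightarrow> ('x \<Rightarrow> 'x \<Rightarrow> 'x) \<Rightarrow>
   'y set \<Rightarrow> ('y \<Rightarrow> 'y \<Rightarrow> 'y) \<Rightarrow> ('f \<Rightarrow> 'y \<Rightarrow> 'y) \<Rightarrow> ('y \<Rightarrow> 'y \<Rightarrow> 'y) \<Rightarrow> ('x \<Rightarrow> 'y) \<Rightarrow> bool" where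
  "algebra_iso S add sc mul S' add' sc' mul' \<Phi> \<longleftrightarrow> bij_betw \<Phi> S S' \<and>
     (\<forall>x\<in>S. \<forall>y\<in>S. add x y \<in> S \<and> \<Phi> (add x y) = add' (\<Phi> x) (\<Phi> y)) \<and>
     (\<forall>k. \<forall>x\<in>S. sc k x \<in> S \<and> \<Phi> (sc k x) = sc' k (\<Phi> x)) \<and>
     (\<forall>x\<in>S. \<forall>y\<in>S. mul x y \<in> S \<and> \<Phi> (mul x y) = mul' (\<Phi> x) (\<Phi> y))"

section \<open>The split classical Lie algebras of types B, C, D\<close>

datatype classical_type = Type_B | Type_C | Type_D

definition form_algebra :: "('f::field^'n \<Rightarrow> 'f^'n \<Rightarrow> 'f) \<Rightarrow> ('f^'n^'n) set" where
  "form_algebra form = {x. \<forall>u v. form (x *v u) v = - form u (x *v v)}"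

definition form_symmetric :: "('f::field^'n \<Rightarrow> 'f^'n \<Rightarrow> 'f) \<Rightarrow> ('f^'n^'n) set" where
  "form_symmetric form = {s. (\<forall>u v. form (s *v u) v = form u (s *v v)) \<and> trace s = 0}"

definition comm :: "'f::field^'n^'n \<Rightarrow> 'f^'n^'n \<Rightarrow> 'f^'n^'n" where
  "comm w z = w ** z - z ** w"

definition circ :: "'f::field^'n^'n \<Rightarrow> 'f^'n^'n \<Rightarrow> 'f^'n^'n" where
  "circ w z = w ** z + z ** w - mat (2 / of_nat CARD('n) * trace (w ** z))"

text \<open>Endomorphisms of \<open>V\<close>, the space of column vectors, are identified with matrices.
  The vectors \<open>e i\<close>, \<open>f i\<close> for \<open>i < r\<close> are \<open>r\<close> hyperbolic pairs; they exist exactly when the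
  form has maximal Witt index, i.e. when its Lie algebra is split.\<close>

locale split_classical =
  fixes X :: classical_type and r :: nat
    and form :: "'f::field_char_0^'n \<Rightarrow> 'f^'n \<Rightarrow> 'f"
    and e f :: "nat \<Rightarrow> 'f^'n"
  assumes dim: "CARD('n) = (if X = Type_B then 2 * r + 1 else 2 * r)"
    and form_bilinear: "bilinear_on (*s) (*s) (*) UNIV UNIV form"
    and form_sign: "form u v = (if X = Type_C then - form v u else form v u)"
    and form_nondegenerate: "(\<forall>v. form u v = 0) \<Longrightarrow> u = 0"
    and hyperbolic: "\<lbrakk>i < r; j < r\<rbrakk> \<Longrightarrow>
      form (e i) (e j) = 0 \<and> form (f i) (f j) = 0 \<and> form (e i) (f j) = (if i = j then 1 else 0)"

text \<open>The split Cartan subalgebra attached to the hyperbolic pairs.  In type B its elements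
  automatically annihilate the line orthogonal to all \<open>e i\<close>, \<open>f i\<close>.\<close>

definition cartan :: "nat \<Rightarrow> ('f::field^'n \<Rightarrow> 'f^'n \<Rightarrow> 'f) \<Rightarrow> (nat \<Rightarrow> 'f^'n) \<Rightarrow> (nat \<Rightarrow> 'f^'n) \<Rightarrow> ('f^'n^'n) set" where
  "cartan r form e f = {x \<in> form_algebra form.
     \<forall>i<r. (\<exists>k. x *v e i = k *s e i) \<and> (\<exists>k. x *v f i = k *s f i)}"

text \<open>For \<open>x\<close> in the Cartan subalgebra, \<open>eps\<close> is the eigenvalue of \<open>x\<close> on \<open>e i\<close>.\<close>

definition eps :: "('f::field^'n \<Rightarrow> 'f^'n \<Rightarrow> 'f) \<Rightarrow> (nat \<Rightarrow> 'f^'n) \<Rightarrow> (nat \<Rightarrow> 'f^'n) \<Rightarrow> nat \<Rightarrow> 'f^'n^'n \<Rightarrow> 'f" where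
  "eps form e f i x = form (x *v e i) (f i)"

text \<open>The root system \<open>BC\<^sub>r\<close>.  The roots are linear functionals on the Cartan subalgebra, given
  here by formulas that make sense for all matrices; distinct formulas have distinct restrictions
  to the Cartan subalgebra.\<close>

definition BC_roots :: "nat \<Rightarrow> ('f::field^'n \<Rightarrow> 'f^'n \<Rightarrow> 'f) \<Rightarrow> (nat \<Rightarrow> 'f^'n) \<Rightarrow> (nat \<Rightarrow> 'f^'n) \<Rightarrow> ('f^'n^'n \<Rightarrow> 'f) set" where
  "BC_roots r form e f =
     {(\<lambda>x. k * eps form e f i x) | k i. k \<in> {1, - 1, 2, - 2} \<and> i < r} \<union>
     {(\<lambda>x. k * eps form e f i x + k' * eps form e f j x) | k k' i j.
        k \<in> {1, - 1} \<and> k' \<in> {1, - 1} \<and> i < j \<and> j < r}"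

lemma finite_BC_roots: "finite (BC_roots r form e f)"
proof -
  let ?K = "{1, - 1, 2, - 2} :: 'a set"
  let ?p = "\<lambda>(k, i) x. k * eps form e f i x"
  let ?q = "\<lambda>(k, k', i, j) x. k * eps form e f i x + k' * eps form e f j x"
  have sub: "\<alpha> \<in> ?p ` (?K \<times> {..<r}) \<union> ?q ` (?K \<times> ?K \<times> {..<r} \<times> {..<r})"
    if "\<alpha> \<in> BC_roots r form e f" for \<alpha>
    using that unfolding BC_roots_def
  proof (elim UnE CollectE exE conjE)
    fix k i assume "\<alpha> = (\<lambda>x. k * eps form e f i x)" "k \<in> ?K" "i < r"
    then show ?thesis by (intro UnI1 image_eqI[of _ _ "(k, i)"]) auto
  next
    fix k k' i j assume "\<alpha> = (\<lambda>x. k * eps form e f i x + k' * eps form e f j x)"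
      "k \<in> {1, - 1}" "k' \<in> {1, - 1}" "i < j" "j < r"
    then show ?thesis by (intro UnI2 image_eqI[of _ _ "(k, k', i, j)"]) auto
  qed
  show ?thesis
    by (rule finite_subset[OF subsetI[OF sub]]) auto
qed

section \<open>Lie algebras graded by \<open>BC\<^sub>r\<close>\<close>

locale lie_algebra_over = vector_space sL
  for sL :: "'f::field \<Rightarrow> 'l::ab_group_add \<Rightarrow> 'l" +
  fixes br :: "'l \<Rightarrow> 'l \<Rightarrow> 'l"
  assumes br_bilinear: "bilinear_on sL sL sL UNIV UNIV br"
    and br_self: "br x x = 0"
    and jacobi: "br x (br y z) + br y (br z x) + br z (br x y) = 0"

definition weight_space ::
  "('f \<Rightarrow> 'l \<Rightarrow> 'l) \<Rightarrow> ('l \<Rightarrow> 'l \<Rightarrow> 'l) \<Rightarrow> ('m \<Rightarrow> 'l) \<Rightarrow> 'm set \<Rightarrow> ('m \<Rightarrow> 'f) \<Rightarrow> 'l set" where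
  "weight_space sL br \<iota> H \<alpha> = {z. \<forall>h\<in>H. br (\<iota> h) z = sL (\<alpha> h) z}"

text \<open>\<open>\<iota>\<close> embeds the split classical Lie algebra as the grading subalgebra.\<close>

locale BC_graded_lie_algebra =
  split_classical X r form e f + lie_algebra_over sL br
  for X r and form :: "'f::field_char_0^'n \<Rightarrow> 'f^'n \<Rightarrow> 'f" and e f
    and sL :: "'f \<Rightarrow> 'l::ab_group_add \<Rightarrow> 'l" and br +
  fixes \<iota> :: "'f^'n^'n \<Rightarrow> 'l"
  assumes rank: "3 \<le> r"
    and emb_linear: "linear_on mat_scale sL (form_algebra form) \<iota>"
    and emb_inj: "inj_on \<iota> (form_algebra form)"
    and emb_hom: "\<lbrakk>x \<in> form_algebra form; y \<in> form_algebra form\<rbrakk> \<Longrightarrow> \<iota> (comm x y) = br (\<iota> x) (\<iota> y)"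
    and grading: "internal_direct_sum (insert (\<lambda>_. 0) (BC_roots r form e f))
      (weight_space sL br \<iota> (cartan r form e f))"
    and zero_weight: "weight_space sL br \<iota> (cartan r form e f) (\<lambda>_. 0) =
      module.span sL {br y z | y z \<alpha>. \<alpha> \<in> BC_roots r form e f \<and>
        y \<in> weight_space sL br \<iota> (cartan r form e f) \<alpha> \<and>
        z \<in> weight_space sL br \<iota> (cartan r form e f) (\<lambda>h. - \<alpha> h)}"

section \<open>The coordinate algebra\<close>

definition sym_elems :: "('a \<Rightarrow> 'a) \<Rightarrow> 'a set" where
  "sym_elems \<eta> = {a. \<eta> a = a}"

definition skew_elems :: "('a::ab_group_add \<Rightarrow> 'a) \<Rightarrow> 'a set" where
  "skew_elems \<eta> = {b. \<eta> b = - b}"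

definition sym_part :: "('f::field \<Rightarrow> 'a::ab_group_add \<Rightarrow> 'a) \<Rightarrow> ('a \<Rightarrow> 'a) \<Rightarrow> 'a \<Rightarrow> 'a" where
  "sym_part sA \<eta> \<alpha> = sA (1 / 2) (\<alpha> + \<eta> \<alpha>)"

definition skew_part :: "('f::field \<Rightarrow> 'a::ab_group_add \<Rightarrow> 'a) \<Rightarrow> ('a \<Rightarrow> 'a) \<Rightarrow> 'a \<Rightarrow> 'a" where
  "skew_part sA \<eta> \<alpha> = sA (1 / 2) (\<alpha> - \<eta> \<alpha>)"

text \<open>The algebra \<open>\<aa>\<close> is the type \<open>'a\<close>, the module \<open>C\<close> is the type \<open>'c\<close>, and
  \<open>\<bb> = \<aa> \<oplus> C\<close> is \<open>'a \<times> 'c\<close>.\<close>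

definition b_mult :: "('a::ab_group_add \<Rightarrow> 'a \<Rightarrow> 'a) \<Rightarrow> ('a \<Rightarrow> 'a) \<Rightarrow> ('a \<Rightarrow> 'c \<Rightarrow> 'c) \<Rightarrow>
    ('c::ab_group_add \<Rightarrow> 'c \<Rightarrow> 'a) \<Rightarrow> 'a \<times> 'c \<Rightarrow> 'a \<times> 'c \<Rightarrow> 'a \<times> 'c" where
  "b_mult mul \<eta> act chi p q =
     (mul (fst p) (fst q) + chi (snd p) (snd q), act (fst p) (snd q) + act (\<eta> (fst q)) (snd p))"

definition a_smult :: "('a \<Rightarrow> 'a \<Rightarrow> 'a) \<Rightarrow> ('a \<Rightarrow> 'c \<Rightarrow> 'c) \<Rightarrow> 'a \<Rightarrow> 'a \<times> 'c \<Rightarrow> 'a \<times> 'c" where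
  "a_smult mul act \<zz> p = (mul \<zz> (fst p), act \<zz> (snd p))"

locale BC_coordinate_algebra =
  fixes X :: classical_type and r :: nat
    and sA :: "'f::field_char_0 \<Rightarrow> 'a::ab_group_add \<Rightarrow> 'a"
    and mul :: "'a \<Rightarrow> 'a \<Rightarrow> 'a" and unit :: 'a and \<eta> :: "'a \<Rightarrow> 'a"
    and sC :: "'f \<Rightarrow> 'c::ab_group_add \<Rightarrow> 'c"
    and act :: "'a \<Rightarrow> 'c \<Rightarrow> 'c" and chi :: "'c \<Rightarrow> 'c \<Rightarrow> 'a"
  assumes vector_space_a: "vector_space sA"
    and mul_bilinear: "bilinear_on sA sA sA UNIV UNIV mul"
    and unit: "mul unit \<alpha> = \<alpha>" "mul \<alpha> unit = \<alpha>"
    and eta_linear: "Vector_Spaces.linear sA sA \<eta>"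
    and eta_anti: "\<eta> (mul \<alpha> \<alpha>') = mul (\<eta> \<alpha>') (\<eta> \<alpha>)"
    and eta_eta: "\<eta> (\<eta> \<alpha>) = \<alpha>"
    and assoc: "\<not> (X = Type_C \<and> r = 3) \<Longrightarrow> associative_algebra mul"
    and alternative: "X = Type_C \<and> r = 3 \<Longrightarrow>
      alternative_algebra mul \<and> sym_elems \<eta> \<subseteq> algebra_nucleus mul"
    and vector_space_c: "vector_space sC"
    and act_bilinear: "bilinear_on sA sC sC UNIV UNIV act"
    and act_unit: "act unit c = c"
    and act_mul: "act (mul \<alpha> \<alpha>') c = act \<alpha> (act \<alpha>' c)"
    and chi_bilinear: "bilinear_on sC sC sA UNIV UNIV chi"
    and chi_linear: "chi (act \<alpha> c) c' = mul \<alpha> (chi c c')"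
    and chi_hermitian: "\<eta> (chi c c') = (if X = Type_C then - chi c' c else chi c' c)"

section \<open>The structure of a \<open>BC\<^sub>r\<close>-graded Lie algebra\<close>

text \<open>The Lie algebra is the type \<open>'l\<close>.  The maps \<open>tA\<close>, \<open>tB\<close>, \<open>tC\<close> are
  \<open>(x, a) \<mapsto> x \<otimes> a\<close>, \<open>(s, b) \<mapsto> s \<otimes> b\<close>, \<open>(v, c) \<mapsto> v \<otimes> c\<close>; the grading subalgebra is
  \<open>\<gg> \<otimes> 1\<close>.  Further, \<open>ang \<beta> \<beta>'\<close> is \<open>\<langle>\<beta>, \<beta>'\<rangle>\<close>, and \<open>der d\<close> is the derivation of \<open>\<bb>\<close> by
  which \<open>d \<in> D\<close> acts.  The normalisations of \<open>\<gamma>\<close> and \<open>\<sigma>\<close> are left open.\<close>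

locale BC_graded_structure =
  BC_graded_lie_algebra X r form e f sL br "\<lambda>x. tA x unit" +
  BC_coordinate_algebra X r sA mul unit \<eta> sC act chi
  for X r and form :: "'f::field_char_0^'n \<Rightarrow> 'f^'n \<Rightarrow> 'f" and e f
    and sL :: "'f \<Rightarrow> 'l::ab_group_add \<Rightarrow> 'l" and br
    and sA :: "'f \<Rightarrow> 'a::ab_group_add \<Rightarrow> 'a" and mul unit \<eta>
    and sC :: "'f \<Rightarrow> 'c::ab_group_add \<Rightarrow> 'c" and act chi
    and tA :: "'f^'n^'n \<Rightarrow> 'a \<Rightarrow> 'l" +
  fixes tB :: "'f^'n^'n \<Rightarrow> 'a \<Rightarrow> 'l"
    and tC :: "'f^'n \<Rightarrow> 'c \<Rightarrow> 'l"
    and D :: "'l set"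
    and ang :: "'a \<times> 'c \<Rightarrow> 'a \<times> 'c \<Rightarrow> 'l"
    and der :: "'l \<Rightarrow> 'a \<times> 'c \<Rightarrow> 'a \<times> 'c"
    and \<gamma> \<sigma> :: "'f^'n \<Rightarrow> 'f^'n \<Rightarrow> 'f^'n^'n"
  assumes tensor_A: "tensor_map mat_scale sA sL (form_algebra form) (sym_elems \<eta>) tA"
    and tensor_B: "tensor_map mat_scale sA sL (form_symmetric form) (skew_elems \<eta>) tB"
    and tensor_C: "tensor_map (*s) sC sL UNIV UNIV tC"
    and D_trivial: "D = {d. \<forall>x\<in>form_algebra form. br (tA x unit) d = 0}"
    and decomposition: "\<forall>z. \<exists>!(p, q, v, d).
      p \<in> tensor_space sL (form_algebra form) (sym_elems \<eta>) tA \<and>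
      q \<in> tensor_space sL (form_symmetric form) (skew_elems \<eta>) tB \<and>
      v \<in> tensor_space sL UNIV UNIV tC \<and> d \<in> D \<and> z = p + q + v + d"
    and ang_bilinear: "bilinear_on (prod_scale sA sC) (prod_scale sA sC) sL UNIV UNIV ang"
    and ang_span: "D = module.span sL {ang \<beta> \<beta>' | \<beta> \<beta>'. True}"
    and ang_AB: "\<lbrakk>a \<in> sym_elems \<eta>; b \<in> skew_elems \<eta>\<rbrakk> \<Longrightarrow> ang (a, 0) (b, 0) = 0 \<and> ang (b, 0) (a, 0) = 0"
    and ang_aC: "ang (\<alpha>, 0) (0, c) = 0 \<and> ang (0, c) (\<alpha>, 0) = 0"
    and der_bilinear: "bilinear_on sL (prod_scale sA sC) (prod_scale sA sC) D UNIV der"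
    and der_bracket: "\<lbrakk>d \<in> D; d' \<in> D\<rbrakk> \<Longrightarrow> der (br d d') \<beta> = der d (der d' \<beta>) - der d' (der d \<beta>)"
    and der_derivation: "d \<in> D \<Longrightarrow> der d (b_mult mul \<eta> act chi \<beta> \<beta>') =
      b_mult mul \<eta> act chi (der d \<beta>) \<beta>' + b_mult mul \<eta> act chi \<beta> (der d \<beta>')"
    and der_A: "\<lbrakk>d \<in> D; a \<in> sym_elems \<eta>\<rbrakk> \<Longrightarrow> der d (a, 0) \<in> sym_elems \<eta> \<times> {0}"
    and der_B: "\<lbrakk>d \<in> D; b \<in> skew_elems \<eta>\<rbrakk> \<Longrightarrow> der d (b, 0) \<in> skew_elems \<eta> \<times> {0}"
    and der_C: "d \<in> D \<Longrightarrow> der d (0, c) \<in> {0} \<times> UNIV"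
    and gamma_bilinear: "bilinear_on (*s) (*s) mat_scale UNIV UNIV \<gamma>"
    and gamma_range: "\<gamma> u v \<in> form_algebra form"
    and gamma_equivariant: "x \<in> form_algebra form \<Longrightarrow> comm x (\<gamma> u v) = \<gamma> (x *v u) v + \<gamma> u (x *v v)"
    and gamma_nonzero: "\<exists>u v. \<gamma> u v \<noteq> 0"
    and sigma_bilinear: "bilinear_on (*s) (*s) mat_scale UNIV UNIV \<sigma>"
    and sigma_range: "\<sigma> u v \<in> form_symmetric form"
    and sigma_equivariant: "x \<in> form_algebra form \<Longrightarrow> comm x (\<sigma> u v) = \<sigma> (x *v u) v + \<sigma> u (x *v v)"
    and sigma_nonzero: "\<exists>u v. \<sigma> u v \<noteq> 0"
    and br_AA: "\<lbrakk>x \<in> form_algebra form; y \<in> form_algebra form; a \<in> sym_elems \<eta>; a' \<in> sym_elems \<eta>\<rbrakk> \<Longrightarrow>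
      br (tA x a) (tA y a') =
        tA (comm x y) (sA (1 / 2) (mul a a' + mul a' a)) +
        tB (circ x y) (sA (1 / 2) (mul a a' - mul a' a)) +
        sL (trace (x ** y)) (ang (a, 0) (a', 0))"
    and br_AB: "\<lbrakk>x \<in> form_algebra form; s \<in> form_symmetric form; a \<in> sym_elems \<eta>; b \<in> skew_elems \<eta>\<rbrakk> \<Longrightarrow>
      br (tA x a) (tB s b) =
        tA (circ x s) (sA (1 / 2) (mul a b - mul b a)) +
        tB (comm x s) (sA (1 / 2) (mul a b + mul b a))"
    and br_BB: "\<lbrakk>s \<in> form_symmetric form; t \<in> form_symmetric form; b \<in> skew_elems \<eta>; b' \<in> skew_elems \<eta>\<rbrakk> \<Longrightarrow>
      br (tB s b) (tB t b') =
        tA (comm s t) (sA (1 / 2) (mul b b' + mul b' b)) +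
        tB (circ s t) (sA (1 / 2) (mul b b' - mul b' b)) +
        sL (trace (s ** t)) (ang (b, 0) (b', 0))"
    and br_AC: "\<lbrakk>x \<in> form_algebra form; a \<in> sym_elems \<eta>\<rbrakk> \<Longrightarrow>
      br (tA x a) (tC u c) = tC (x *v u) (act a c)"
    and br_BC: "\<lbrakk>s \<in> form_symmetric form; b \<in> skew_elems \<eta>\<rbrakk> \<Longrightarrow>
      br (tB s b) (tC u c) = tC (s *v u) (act b c)"
    and br_CC: "br (tC u c) (tC v c') =
        tA (\<gamma> u v) (sym_part sA \<eta> (chi c c')) +
        tB (\<sigma> u v) (skew_part sA \<eta> (chi c c')) +
        sL (form u v) (ang (0, c) (0, c'))"
    and br_DA: "\<lbrakk>d \<in> D; x \<in> form_algebra form; a \<in> sym_elems \<eta>\<rbrakk> \<Longrightarrow>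
      br d (tA x a) = tA x (fst (der d (a, 0)))"
    and br_DB: "\<lbrakk>d \<in> D; s \<in> form_symmetric form; b \<in> skew_elems \<eta>\<rbrakk> \<Longrightarrow>
      br d (tB s b) = tB s (fst (der d (b, 0)))"
    and br_DC: "d \<in> D \<Longrightarrow> br d (tC u c) = tC u (snd (der d (0, c)))"

section \<open>The candidates for the centroid\<close>

definition frak_Z :: "('a::ab_group_add \<Rightarrow> 'a \<Rightarrow> 'a) \<Rightarrow> ('a \<Rightarrow> 'a) \<Rightarrow> ('a \<Rightarrow> 'c \<Rightarrow> 'c) \<Rightarrow>
    ('a \<times> 'c \<Rightarrow> 'a \<times> 'c \<Rightarrow> 'l::ab_group_add) \<Rightarrow> 'a set" where
  "frak_Z mul \<eta> act ang = {\<zz> \<in> algebra_center mul \<inter> sym_elems \<eta>.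
     (\<forall>\<beta> \<beta>'. ang (a_smult mul act \<zz> \<beta>) \<beta>' = ang \<beta> (a_smult mul act \<zz> \<beta>')) \<and>
     (\<forall>(N::nat) \<beta> \<beta>'. (\<Sum>t<N. ang (\<beta> t) (\<beta>' t)) = 0 \<longrightarrow>
        (\<Sum>t<N. ang (a_smult mul act \<zz> (\<beta> t)) (\<beta>' t)) = 0)}"

definition given_by :: "('f::field^'n \<Rightarrow> 'f^'n \<Rightarrow> 'f) \<Rightarrow> ('a::ab_group_add \<Rightarrow> 'a \<Rightarrow> 'a) \<Rightarrow> ('a \<Rightarrow> 'a) \<Rightarrow>
    ('a \<Rightarrow> 'c \<Rightarrow> 'c) \<Rightarrow> ('f^'n^'n \<Rightarrow> 'a \<Rightarrow> 'l) \<Rightarrow> ('f^'n^'n \<Rightarrow> 'a \<Rightarrow> 'l) \<Rightarrow> ('f^'n \<Rightarrow> 'c \<Rightarrow> 'l) \<Rightarrow>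
    ('a \<times> 'c \<Rightarrow> 'a \<times> 'c \<Rightarrow> 'l) \<Rightarrow> 'a \<Rightarrow> ('l \<Rightarrow> 'l) \<Rightarrow> bool" where
  "given_by form mul \<eta> act tA tB tC ang \<zz> \<Psi> \<longleftrightarrow>
     (\<forall>x\<in>form_algebra form. \<forall>a\<in>sym_elems \<eta>. \<Psi> (tA x a) = tA x (mul \<zz> a)) \<and>
     (\<forall>s\<in>form_symmetric form. \<forall>b\<in>skew_elems \<eta>. \<Psi> (tB s b) = tB s (mul \<zz> b)) \<and>
     (\<forall>v c. \<Psi> (tC v c) = tC v (act \<zz> c)) \<and>
     (\<forall>\<beta> \<beta>'. \<Psi> (ang \<beta> \<beta>') = ang (a_smult mul act \<zz> \<beta>) \<beta>' \<and>
        \<Psi> (ang \<beta> \<beta>') = ang \<beta> (a_smult mul act \<zz> \<beta>'))"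

end

theory Submission
  imports Defs
begin

text \<open>For \<open>\<psi>\<close> in the centroid and \<open>x\<close> a root vector with \<open>x\<^sup>2 = 0\<close>, the operator
  \<open>ad(x \<otimes> 1)\<^sup>2\<close> maps \<open>\<gg> \<otimes> A\<close> onto \<open>x \<otimes> A\<close> and kills \<open>V \<otimes> C\<close> and \<open>D\<close>; it also kills
  \<open>\<ss> \<otimes> B\<close> in type C, while in types B and D the image of \<open>\<ss> \<otimes> B\<close> is a sum of copies of the
  three-dimensional module of an \<open>sl\<^sub>2\<close> centralising \<open>x\<close>, hence contributes no invariants.
  Therefore \<open>\<psi>(x \<otimes> 1) = x \<otimes> \<zz>\<close>, and \<open>\<psi>(y \<otimes> 1) = y \<otimes> \<zz>\<close> for all \<open>y\<close> because \<open>\<gg>\<close> is simple.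
  Brackets with \<open>y \<otimes> 1\<close> propagate this to the rest of \<open>L\<close> and force \<open>\<zz>\<close> to be central.
  Conversely, multiplication by \<open>\<zz>\<close> commutes with the brackets between \<open>\<gg> \<otimes> A\<close>,
  \<open>\<ss> \<otimes> B\<close> and \<open>V \<otimes> C\<close> by their formulas, and the brackets with \<open>D\<close> reduce to these by the
  Jacobi identity, without using how \<open>D\<close> acts explicitly.\<close>

section \<open>Dyads and the classical Lie algebras\<close>

text \<open>An argument by Schur's lemma would need \<gg>, \<ss>, V and the trivial module to be
  irreducible and pairwise non-isomorphic. The square of \<open>ad(x \<otimes> 1)\<close> replaces
  it: for a long root vector \<open>x\<close> there is \<open>y\<close> in \<gg> with
  \<open>[x, [x, y]] = x\<close>, and since \<psi> commutes with \<open>ad\<close>, it sends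
  \<open>x \<otimes> 1\<close> into the image of that square, which explicit matrices determine on
  generators. In the converse direction the obstacle is D. The element
  \<open>\<langle>a, a'\<rangle>\<close> is reached through brackets
  \<open>[x \<otimes> a, x \<otimes> a']\<close>, and Jacobi against \<open>y \<otimes> a''\<close>
  brings back the D-component \<open>tr(xy) \<langle>a, a''\<rangle>\<close>, so the argument
  threatens to be circular. Taking \<open>y \<noteq> 0\<close> trace-orthogonal to \<open>x\<close>
  breaks the circle, and one such \<open>y\<close> settles all others, because \<open>d\<close> in D
  acts on \<open>y \<otimes> a''\<close> through the second factor alone. Condition (b) says that
  the prescription for \<Psi> on D is well defined.\<close>

interpretation mat: vector_space mat_scale
  by (rule vector_space_mat_scale)

lemma mat_scale_vector_mult [simp]: "mat_scale k m *v w = k *s (m *v w)"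
  by (simp add: mat_scale_def matrix_vector_mult_def vec_eq_iff sum_distrib_left mult.assoc)

lemma mat_vector_mult [simp]: "(mat k :: 'f::field^'n^'n) *v w = k *s w"
  by (simp add: mat_def matrix_vector_mult_def vec_eq_iff if_distrib if_distribR sum.delta cong: if_cong)

text \<open>The simplifier turns \<open>v + v\<close> into \<open>2 * v\<close>, a componentwise product of vectors.\<close>

lemma numeral_times_vec [simp]: "numeral k * v = numeral k *s (v :: 'f::field^'n)"
  by (simp add: vec_eq_iff numeral_index)

lemma numeral_times_mat [simp]: "numeral k * m = mat_scale (numeral k) (m :: 'f::field^'n^'m)"
  by (simp add: vec_eq_iff numeral_index mat_scale_def)

lemma sum_matrix_vector_mult: "(\<Sum>i\<in>I. m i) *v w = (\<Sum>i\<in>I. (m i :: 'f::field^'n^'k) *v w)"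
  by (induction I rule: infinite_finite_induct) (simp_all add: matrix_vector_mult_add_rdistrib)

lemma matrix_vector_mult_sum: "(m :: 'f::field^'n^'k) *v (\<Sum>i\<in>I. w i) = (\<Sum>i\<in>I. m *v w i)"
  by (induction I rule: infinite_finite_induct) (simp_all add: matrix_vector_right_distrib)

lemma minus_matrix_vector_mult: "(- m) *v w = - ((m :: 'f::field^'n^'k) *v w)"
  using matrix_vector_mult_diff_rdistrib[of 0 m w] by simp

lemma matrix_vector_mult_smult: "(m :: 'f::field^'n^'k) *v (k *s w) = k *s (m *v w)"
  by (simp add: matrix_vector_mult_def vec_eq_iff sum_distrib_left mult_ac)

lemma matrix_vector_mult_uminus: "(m :: 'f::field^'n^'k) *v (- w) = - (m *v w)"
  using matrix_vector_mult_smult[of m "-1" w] by (simp only: vec.scale_minus_left vec.scale_one)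

lemmas mat_vec_simps = matrix_vector_mult_add_rdistrib matrix_vector_mult_diff_rdistrib
  matrix_vector_right_distrib matrix_vector_mult_diff_distrib minus_matrix_vector_mult
  matrix_vector_mult_smult matrix_vector_mult_uminus matrix_vector_mul_assoc[symmetric]

lemma comm_apply: "comm x y *v w = x *v (y *v w) - y *v (x *v w)"
  by (simp add: comm_def mat_vec_simps)

lemma circ_apply:
  "circ (x :: 'f::field^'n^'n) y *v w =
     x *v (y *v w) + y *v (x *v w) - (2 / of_nat CARD('n) * trace (x ** y)) *s w"
  by (simp add: circ_def mat_vec_simps)

lemma comm_add_right: "comm x (y + z) = comm x y + comm x z"
  and comm_diff_right: "comm x (y - z) = comm x y - comm x z"
  and comm_zero_right: "comm x 0 = 0"
  and comm_scale_right: "comm x (mat_scale k y) = mat_scale k (comm x y)"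
  and comm_swap: "comm x y = - comm y x"
  and comm_mat: "comm x (mat k) = 0"
  for x y z :: "'f::field^'n^'n"
  by (simp_all add: matrix_eq comm_apply mat_vec_simps vec.scale_right_diff_distrib)

lemma comm_jacobi: "comm w (comm x y) = comm (comm w x) y + comm x (comm w y)"
  for x y w :: "'f::field^'n^'n"
  by (simp add: matrix_eq comm_apply mat_vec_simps)

lemma circ_commute: "circ x y = circ y x"
  for x y :: "'f::field^'n^'n"
  using trace_mul_sym[of x y] by (simp add: circ_def add.commute)

lemma trace_scale: "trace (mat_scale k m) = k * trace m"
  by (simp add: trace_def mat_scale_def sum_distrib_left)

lemma trace_diff: "trace (m - m' :: 'f::field^'n^'n) = trace m - trace m'"
  by (simp add: trace_def sum_subtractf)

lemma matrix_diff_ldistrib: "x ** (y - z) = x ** y - x ** z"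
  and matrix_diff_rdistrib: "(y - z) ** x = y ** x - z ** x"
  for x y z :: "'f::field^'n^'n"
  by (simp_all add: matrix_eq mat_vec_simps)

lemma mat_scale_half: "mat_scale (1 / 2) (t + t) = (t :: 'f::field_char_0^'n^'m)"
  using mat.scale_left_distrib[of "1 / 2" "1 / 2" t] by (simp only: mat.scale_right_distrib) simp

lemma trace_zero: "trace (0 :: 'f::field^'n^'n) = 0"
  by (simp add: trace_def)

lemma sum_mat: "(\<Sum>i\<in>I. mat (k i) :: 'f::field^'n^'n) = mat (\<Sum>i\<in>I. k i)"
  by (simp add: matrix_eq sum_matrix_vector_mult vec.scale_sum_left)

lemma trace_sum: "trace (\<Sum>i\<in>I. m i) = (\<Sum>i\<in>I. trace (m i :: 'f::field^'n^'n))"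
  by (induction I rule: infinite_finite_induct) (simp_all add: trace_add trace_zero)

lemma trace_mat: "trace (mat k :: 'f::field^'n^'n) = of_nat CARD('n) * k"
  by (simp add: trace_def mat_def)

lemma mat_scale_mult_right: "x ** mat_scale k y = mat_scale k (x ** y)"
  for x y :: "'f::field^'n^'n"
  by (simp add: matrix_eq mat_vec_simps)

lemma matrix_mult_sum_right: "x ** (\<Sum>i\<in>I. y i) = (\<Sum>i\<in>I. x ** (y i :: 'f::field^'n^'n))"
  by (simp add: matrix_eq sum_matrix_vector_mult matrix_vector_mult_sum mat_vec_simps)

lemma trace_comm_zero: "trace (comm x y) = 0"
  for x y :: "'f::field^'n^'n"
  using trace_mul_sym[of x y] by (simp add: comm_def trace_diff)

text \<open>Invariance of the trace form: \<open>ad w\<close> is skew for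
  \<open>tr(xy)\<close>.\<close>

lemma trace_comm_shift: "trace (x ** comm w y) = - trace (comm w x ** y)"
  for x y w :: "'f::field^'n^'n"
proof -
  have "trace (x ** comm w y) = trace ((x ** w) ** y) - trace (x ** (y ** w))"
    unfolding comm_def by (simp add: matrix_diff_ldistrib trace_diff matrix_mul_assoc)
  moreover have "trace (x ** (y ** w)) = trace ((w ** x) ** y)"
    using trace_mul_sym[of "x ** y" w] by (simp add: matrix_mul_assoc)
  moreover have "trace (comm w x ** y) = trace ((w ** x) ** y) - trace ((x ** w) ** y)"
    unfolding comm_def by (simp add: matrix_diff_rdistrib trace_diff)
  ultimately show ?thesis by simp
qed

section \<open>The invariant form, its dyads and their adjoints\<close>

context split_classical
begin

text \<open>The sign of the form; it lets the symmetric types B, D and the skew type C share one set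
  of dyad formulas.\<close>

definition sg :: 'f where
  "sg = (if X = Type_C then - 1 else 1)"

lemma sg_sg [simp]: "sg * sg = 1" "sg * (sg * k) = k" and sg_nonzero [simp]: "sg \<noteq> 0"
  by (simp_all add: sg_def)

lemma form_swap: "form u v = sg * form v u"
  using form_sign[of u v] by (auto simp: sg_def split: if_splits)

lemma form_add_right: "form u (v + v') = form u v + form u v'"
  and form_scale_right: "form u (k *s v) = k * form u v"
  and form_add_left: "form (u + u') v = form u v + form u' v"
  and form_scale_left: "form (k *s u) v = k * form u v"
  using form_bilinear by (simp_all add: bilinear_on_def linear_on_def)

lemma form_zero_left [simp]: "form 0 v = 0" and form_zero_right [simp]: "form v 0 = 0"
  using form_scale_left[of 0 0 v] form_scale_right[of v 0 0] by simp_all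

lemma form_minus_left: "form (- u) v = - form u v"
  and form_minus_right: "form u (- v) = - form u v"
  using form_add_left[of u "- u" v] form_add_right[of u v "- v"]
  by (simp_all add: eq_neg_iff_add_eq_0 add.commute)

lemma form_diff_left: "form (u - u') v = form u v - form u' v"
  and form_diff_right: "form u (v - v') = form u v - form u v'"
  using form_add_left[of u "- u'" v] form_add_right[of u v "- v'"]
  by (simp_all add: form_minus_left form_minus_right)

lemma form_sum_left: "form (\<Sum>i\<in>I. u i) v = (\<Sum>i\<in>I. form (u i) v)"
  and form_sum_right: "form v (\<Sum>i\<in>I. u i) = (\<Sum>i\<in>I. form v (u i))"
  by (induction I rule: infinite_finite_induct; simp add: form_add_left form_add_right)+

lemmas form_simps = form_add_left form_add_right form_diff_left form_diff_right
  form_scale_left form_scale_right form_minus_left form_minus_right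

lemma form_eqI: "(\<And>w. form u w = form v w) \<Longrightarrow> u = v"
  using form_nondegenerate[of "u - v"] by (simp add: form_diff_left)

lemma form_expand: "form v w = (\<Sum>j\<in>UNIV. w $ j * form v (axis j 1))"
  using form_sum_right[of v "\<lambda>j. w $ j *s axis j 1" UNIV]
  by (simp add: basis_expansion form_scale_right)

text \<open>The rank-one operator \<open>w \<mapsto> (v, w) u\<close>, that is, the image of
  \<open>u \<otimes> v\<close> under the identification of V \<otimes> V with End V given by the
  form.\<close>

definition dyad :: "'f^'n \<Rightarrow> 'f^'n \<Rightarrow> 'f^'n^'n" where
  "dyad u v = (\<chi> i j. u $ i * form v (axis j 1))"

lemma dyad_apply [simp]: "dyad u v *v w = form v w *s u"
  unfolding form_expand[of v w]
  by (simp add: dyad_def matrix_vector_mult_def vec_eq_iff sum_distrib_left sum_distrib_right mult_ac)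

lemma trace_dyad: "trace (dyad u v) = form v u"
  unfolding form_expand[of v u] by (simp add: trace_def dyad_def)

lemma mult_dyad: "x ** dyad u v = dyad (x *v u) v"
  by (simp add: matrix_eq mat_vec_simps)

text \<open>The dyad minus its adjoint, since the adjoint of \<open>dyad u v\<close> is
  \<open>sg\<close> times \<open>dyad v u\<close>. It is symmetric in \<open>u\<close> and
  \<open>v\<close> in type C and alternating in types B and D.\<close>

definition skew_dyad :: "'f^'n \<Rightarrow> 'f^'n \<Rightarrow> 'f^'n^'n" where
  "skew_dyad u v = dyad u v - mat_scale sg (dyad v u)"

text \<open>The dyad plus its adjoint. Its trace is \<open>2 * form v u\<close>, so it lies in \<ss>
  only for orthogonal \<open>u\<close> and \<open>v\<close>.\<close>

definition sym_dyad :: "'f^'n \<Rightarrow> 'f^'n \<Rightarrow> 'f^'n^'n" where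
  "sym_dyad u v = dyad u v + mat_scale sg (dyad v u)"

lemma skew_dyad_apply: "skew_dyad u v *v w = form v w *s u - (sg * form u w) *s v"
  and sym_dyad_apply: "sym_dyad u v *v w = form v w *s u + (sg * form u w) *s v"
  by (simp_all add: skew_dyad_def sym_dyad_def mat_vec_simps)

lemma form_algebraD: "x \<in> form_algebra form \<Longrightarrow> form (x *v u) v = - form u (x *v v)"
  and form_symmetricD: "s \<in> form_symmetric form \<Longrightarrow> form (s *v u) v = form u (s *v v)"
  and form_symmetric_trace: "s \<in> form_symmetric form \<Longrightarrow> trace s = 0"
  by (auto simp: form_algebra_def form_symmetric_def)

lemma skew_dyad_in: "skew_dyad u v \<in> form_algebra form"
proof -
  have "form (skew_dyad u v *v w) w' = - form w (skew_dyad u v *v w')" for w w'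
    using form_swap[of w u] form_swap[of w v]
    by (simp add: skew_dyad_apply form_simps algebra_simps)
  then show ?thesis by (simp add: form_algebra_def)
qed

lemma form_sym_dyad: "form (sym_dyad u v *v w) w' = form w (sym_dyad u v *v w')"
  using form_swap[of w u] form_swap[of w v]
  by (simp add: sym_dyad_apply form_simps algebra_simps)

lemma trace_sym_dyad: "trace (sym_dyad u v) = 2 * form v u"
  using form_swap[of u v] by (simp add: sym_dyad_def trace_add trace_scale trace_dyad)

lemma trace_mult_skew_dyad:
  assumes "x \<in> form_algebra form"
  shows "trace (x ** skew_dyad u v) = 2 * form v (x *v u)"
  using form_algebraD[OF assms, of u v] form_swap[of v "x *v u"]
  by (simp add: skew_dyad_def matrix_diff_ldistrib mat_scale_mult_right trace_diff trace_scale
      mult_dyad trace_dyad)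

lemma trace_mult_sym_dyad:
  assumes "s \<in> form_symmetric form"
  shows "trace (s ** sym_dyad u v) = 2 * form v (s *v u)"
  using form_symmetricD[OF assms, of u v] form_swap[of v "s *v u"]
  by (simp add: sym_dyad_def matrix_add_ldistrib mat_scale_mult_right trace_add trace_scale
      mult_dyad trace_dyad)

lemma trace_skew_mult_sym_dyad:
  assumes "x \<in> form_algebra form"
  shows "trace (x ** sym_dyad u v) = 0"
  using form_algebraD[OF assms, of u v] form_swap[of v "x *v u"]
  by (simp add: sym_dyad_def matrix_add_ldistrib mat_scale_mult_right trace_add trace_scale
      mult_dyad trace_dyad)

text \<open>For skew \<open>x\<close> the identification of V \<otimes> V with End V respects the
  action of \<open>x\<close>, so \<open>ad x\<close> differentiates each leg of a dyad.\<close>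

lemma comm_dyad:
  assumes "x \<in> form_algebra form"
  shows "comm x (dyad u v) = dyad (x *v u) v + dyad u (x *v v)"
  using form_algebraD[OF assms]
  by (simp add: matrix_eq comm_apply mat_vec_simps)

lemma comm_skew_dyad:
  assumes "x \<in> form_algebra form"
  shows "comm x (skew_dyad u v) = skew_dyad (x *v u) v + skew_dyad u (x *v v)"
  using assms by (simp add: skew_dyad_def comm_diff_right comm_scale_right comm_dyad mat.scale_right_distrib)

lemma comm_sym_dyad:
  assumes "x \<in> form_algebra form"
  shows "comm x (sym_dyad u v) = sym_dyad (x *v u) v + sym_dyad u (x *v v)"
  using assms by (simp add: sym_dyad_def comm_add_right comm_scale_right comm_dyad mat.scale_right_distrib)

lemma dyad_linear:
  "dyad (u + u') v = dyad u v + dyad u' v" "dyad (k *s u) v = mat_scale k (dyad u v)"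
  "dyad u (v + v') = dyad u v + dyad u v'" "dyad u (k *s v) = mat_scale k (dyad u v)"
  "dyad (u - u') v = dyad u v - dyad u' v" "dyad u (v - v') = dyad u v - dyad u v'"
  "dyad 0 v = 0" "dyad u 0 = 0"
  "dyad (- u) v = - dyad u v" "dyad u (- v) = - dyad u v"
  by (simp_all add: matrix_eq mat_vec_simps form_simps vec.scale_left_distrib
      vec.scale_right_distrib vec.scale_right_diff_distrib vec.scale_left_diff_distrib mult.commute)

lemma skew_dyad_linear:
  "skew_dyad (u + u') v = skew_dyad u v + skew_dyad u' v"
  "skew_dyad (k *s u) v = mat_scale k (skew_dyad u v)"
  "skew_dyad u (v + v') = skew_dyad u v + skew_dyad u v'"
  "skew_dyad u (k *s v) = mat_scale k (skew_dyad u v)"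
  "skew_dyad (u - u') v = skew_dyad u v - skew_dyad u' v"
  "skew_dyad u (v - v') = skew_dyad u v - skew_dyad u v'"
  "skew_dyad 0 v = 0" "skew_dyad u 0 = 0"
  "skew_dyad (- u) v = - skew_dyad u v" "skew_dyad u (- v) = - skew_dyad u v"
  by (simp_all add: skew_dyad_def dyad_linear mat.scale_right_distrib mat.scale_right_diff_distrib
      mult.commute)

lemma skew_dyad_swap: "skew_dyad v u = - mat_scale sg (skew_dyad u v)"
  by (simp add: skew_dyad_def mat.scale_right_diff_distrib)

lemma sym_dyad_linear:
  "sym_dyad (u + u') v = sym_dyad u v + sym_dyad u' v"
  "sym_dyad (k *s u) v = mat_scale k (sym_dyad u v)"
  "sym_dyad u (v + v') = sym_dyad u v + sym_dyad u v'"
  "sym_dyad u (k *s v) = mat_scale k (sym_dyad u v)"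
  "sym_dyad (u - u') v = sym_dyad u v - sym_dyad u' v"
  "sym_dyad u (v - v') = sym_dyad u v - sym_dyad u v'"
  "sym_dyad 0 v = 0" "sym_dyad u 0 = 0"
  "sym_dyad (- u) v = - sym_dyad u v" "sym_dyad u (- v) = - sym_dyad u v"
  by (simp_all add: sym_dyad_def dyad_linear mat.scale_right_distrib mat.scale_right_diff_distrib
      mult.commute)

section \<open>Dual bases and expansions into dyads\<close>

lemma ex_dual: "\<exists>d. \<forall>w. form d w = w $ i"
proof -
  define T where "T u = (\<chi> j. form u (axis j 1))" for u
  have lin: "Vector_Spaces.linear (*s) (*s) T"
    by unfold_locales (simp_all add: T_def vec_eq_iff form_simps)
  have T_inner: "form u w = (\<Sum>j\<in>UNIV. w $ j * T u $ j)" for u w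
    using form_expand[of u w] by (simp add: T_def)
  have "inj T"
    by (rule injI, rule form_eqI) (simp add: T_inner)
  then have "surj T"
    using vec.linear_injective_imp_surjective[OF lin] by simp
  then obtain d where "T d = axis i 1" by (metis surjD)
  then have "form d w = w $ i" for w
    by (simp add: T_inner axis_def if_distrib[of "(*) _"] cong: if_cong)
  then show ?thesis by blast
qed

text \<open>The basis dual to the standard one. It exists because a nondegenerate form embeds V into
  its dual space, and the equal finite dimensions make this embedding onto.\<close>

definition dual :: "'n \<Rightarrow> 'f^'n" where
  "dual i = (SOME d. \<forall>w. form d w = w $ i)"

lemma form_dual [simp]: "form (dual i) w = w $ i"
  unfolding dual_def using someI_ex[OF ex_dual[of i]] by blast

lemma sum_form_dual: "(\<Sum>j\<in>UNIV. form v (axis j 1) *s dual j) = v"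
proof (rule form_eqI)
  fix w
  show "form (\<Sum>j\<in>UNIV. form v (axis j 1) *s dual j) w = form v w"
    by (subst form_expand[of v w]) (simp add: form_sum_left form_scale_left mult.commute)
qed

lemma dyad_expand: "t = (\<Sum>j\<in>UNIV. dyad (t *v axis j 1) (dual j))"
proof -
  have "(\<Sum>j\<in>UNIV. w $ j *s (t *v axis j 1)) = t *v w" for w
    using matrix_vector_mult_sum[of t "\<lambda>j. w $ j *s axis j 1" UNIV]
    by (simp add: basis_expansion matrix_vector_mult_smult)
  then show ?thesis by (simp add: matrix_eq sum_matrix_vector_mult)
qed

text \<open>Exchanging the two legs in the dyad expansion of \<open>t\<close> gives
  \<open>sg\<close> times the adjoint of \<open>t\<close>; the right-hand sum is that adjoint
  applied to \<open>w\<close>.\<close>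

lemma sum_dyad_dual:
  "(\<Sum>j\<in>UNIV. dyad (dual j) (t *v axis j 1)) *v w =
     sg *s (\<Sum>j\<in>UNIV. form w (t *v axis j 1) *s dual j)"
proof -
  have "form (t *v axis j 1) w = sg * form w (t *v axis j 1)" for j
    by (rule form_swap)
  then show ?thesis by (simp add: sum_matrix_vector_mult vec.scale_sum_right)
qed

text \<open>\<open>t\<close> minus its adjoint is \<open>t + t\<close> for skew \<open>t\<close>. In
  particular the skew dyads span \<gg>.\<close>

lemma skew_expand:
  assumes "t \<in> form_algebra form"
  shows "t = mat_scale (1/2) (\<Sum>j\<in>UNIV. skew_dyad (t *v axis j 1) (dual j))"
proof -
  have "(\<Sum>j\<in>UNIV. form w (t *v axis j 1) *s dual j) = - (t *v w)" for w
  proof -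
    have "form w (t *v v) = form (- (t *v w)) v" for v
      using form_algebraD[OF assms, of w v] by (simp add: form_minus_left)
    then show ?thesis using sum_form_dual[of "- (t *v w)"] by simp
  qed
  then have "mat_scale sg (\<Sum>j\<in>UNIV. dyad (dual j) (t *v axis j 1)) = - t"
    by (simp add: matrix_eq sum_dyad_dual minus_matrix_vector_mult)
  moreover have "(\<Sum>j\<in>UNIV. skew_dyad (t *v axis j 1) (dual j)) =
      t - mat_scale sg (\<Sum>j\<in>UNIV. dyad (dual j) (t *v axis j 1))"
    using dyad_expand[of t] by (simp add: skew_dyad_def sum_subtractf mat.scale_sum_right)
  ultimately have "(\<Sum>j\<in>UNIV. skew_dyad (t *v axis j 1) (dual j)) = t + t" by simp
  then show ?thesis by (simp only: mat_scale_half)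
qed

text \<open>Stated for every self-adjoint \<open>t\<close>, so that it also covers the identity,
  whose expansion enters the contraction over dual bases.\<close>

lemma sym_expand:
  assumes "\<And>u v. form (t *v u) v = form u (t *v v)"
  shows "t = mat_scale (1/2) (\<Sum>j\<in>UNIV. sym_dyad (t *v axis j 1) (dual j))"
proof -
  have "(\<Sum>j\<in>UNIV. form w (t *v axis j 1) *s dual j) = t *v w" for w
    using sum_form_dual[of "t *v w"] by (simp add: assms)
  then have "mat_scale sg (\<Sum>j\<in>UNIV. dyad (dual j) (t *v axis j 1)) = t"
    by (simp add: matrix_eq sum_dyad_dual minus_matrix_vector_mult)
  moreover have "(\<Sum>j\<in>UNIV. sym_dyad (t *v axis j 1) (dual j)) =
      t + mat_scale sg (\<Sum>j\<in>UNIV. dyad (dual j) (t *v axis j 1))"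
    using dyad_expand[of t] by (simp add: sym_dyad_def sum.distrib mat.scale_sum_right)
  ultimately have "(\<Sum>j\<in>UNIV. sym_dyad (t *v axis j 1) (dual j)) = t + t" by simp
  then show ?thesis by (simp only: mat_scale_half)
qed

lemma subspace_form_algebra: "mat.subspace (form_algebra form)"
  by (auto simp: mat.subspace_def form_algebra_def mat_vec_simps form_simps)

lemma subspace_form_symmetric: "mat.subspace (form_symmetric form)"
  by (auto simp: mat.subspace_def form_symmetric_def mat_vec_simps form_simps trace_add trace_scale trace_zero)

text \<open>Each symmetric dyad in the expansion of \<open>s\<close> is trace-orthogonal to
  \<open>x\<close>. This removes the scalar correction from \<open>circ x s\<close>, which is why
  that product is skew.\<close>

lemma trace_skew_sym:
  assumes x: "x \<in> form_algebra form" and s: "s \<in> form_symmetric form"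
  shows "trace (x ** s) = 0"
  by (subst sym_expand[of s, OF form_symmetricD[OF s]])
    (simp add: matrix_mult_sum_right mat_scale_mult_right trace_scale trace_sum trace_skew_mult_sym_dyad[OF x])

lemma trace_circ: "trace (circ x y :: 'f^'n^'n) = 0"
  using trace_mul_sym[of x y] by (simp add: circ_def trace_diff trace_add trace_mat)

lemma comm_skew_skew:
  "x \<in> form_algebra form \<Longrightarrow> y \<in> form_algebra form \<Longrightarrow> comm x y \<in> form_algebra form"
  by (auto simp: form_algebra_def comm_apply form_simps)

lemma comm_skew_sym:
  "x \<in> form_algebra form \<Longrightarrow> s \<in> form_symmetric form \<Longrightarrow> comm x s \<in> form_symmetric form"
  by (auto simp: form_algebra_def form_symmetric_def comm_apply form_simps trace_comm_zero)

lemma comm_sym_sym: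
  "s \<in> form_symmetric form \<Longrightarrow> t \<in> form_symmetric form \<Longrightarrow> comm s t \<in> form_algebra form"
  by (auto simp: form_algebra_def form_symmetric_def comm_apply form_simps)

lemma circ_skew_skew:
  "x \<in> form_algebra form \<Longrightarrow> y \<in> form_algebra form \<Longrightarrow> circ x y \<in> form_symmetric form"
  by (auto simp: form_algebra_def form_symmetric_def circ_apply form_simps trace_circ)

lemma circ_sym_sym:
  "s \<in> form_symmetric form \<Longrightarrow> t \<in> form_symmetric form \<Longrightarrow> circ s t \<in> form_symmetric form"
  by (auto simp: form_symmetric_def circ_apply form_simps trace_circ)

lemma circ_skew_sym:
  assumes "x \<in> form_algebra form" "s \<in> form_symmetric form"
  shows "circ x s \<in> form_algebra form"
  using assms trace_skew_sym[OF assms]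
  by (auto simp: form_algebra_def form_symmetric_def circ_apply form_simps)

section \<open>Cartan elements and test matrices from the hyperbolic pairs\<close>

lemma form_hyperbolic:
  assumes "i < r" "j < r"
  shows "form (e i) (e j) = 0" "form (f i) (f j) = 0"
    "form (e i) (f j) = (if i = j then 1 else 0)" "form (f i) (e j) = (if i = j then sg else 0)"
  using hyperbolic[OF assms] hyperbolic[OF assms(2,1)] form_swap[of "f i" "e j"] by auto

lemma hyperbolic_nonzero: "i < r \<Longrightarrow> e i \<noteq> 0" "i < r \<Longrightarrow> f i \<noteq> 0"
  using form_hyperbolic(3)[of i i] by auto

text \<open>A Cartan element with eigenvalue \<open>sg\<close> on \<open>e i\<close> and
  \<open>- sg\<close> on \<open>f i\<close>, zero on the other pairs.\<close>

definition hsk :: "nat \<Rightarrow> 'f^'n^'n" where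
  "hsk i = skew_dyad (e i) (f i)"

text \<open>\<open>sg\<close> times the orthogonal projection onto the plane of \<open>e i\<close>
  and \<open>f i\<close>; differences of two of them are trace free.\<close>

definition hsym :: "nat \<Rightarrow> 'f^'n^'n" where
  "hsym i = sym_dyad (e i) (f i)"

lemma hsk_in: "hsk i \<in> form_algebra form"
  by (simp add: hsk_def skew_dyad_in)

lemma hsk_hsym_apply:
  assumes "i < r" "j < r"
  shows "hsk i *v e j = (if i = j then sg *s e i else 0)"
    "hsk i *v f j = (if i = j then - (sg *s f i) else 0)"
    "hsym i *v e j = (if i = j then sg *s e i else 0)"
    "hsym i *v f j = (if i = j then sg *s f i else 0)"
  using form_hyperbolic[OF assms]
  by (auto simp: hsk_def hsym_def skew_dyad_apply sym_dyad_apply)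

lemma trace_hsym: "i < r \<Longrightarrow> trace (hsym i) = 2 * sg"
  by (simp add: hsym_def trace_sym_dyad form_hyperbolic)

lemma hsym_diff_in:
  assumes "i < r" "j < r"
  shows "hsym i - hsym j \<in> form_symmetric form"
  using form_sym_dyad[of "e i" "f i"] form_sym_dyad[of "e j" "f j"] trace_hsym[OF assms(1)] trace_hsym[OF assms(2)]
  by (simp add: form_symmetric_def mat_vec_simps form_simps trace_diff hsym_def)

lemma trace_hsk: "i < r \<Longrightarrow> j < r \<Longrightarrow> trace (hsk i ** hsk j) = (if i = j then 2 else 0)"
  unfolding hsk_def[of j] by (simp add: trace_mult_skew_dyad hsk_in hsk_hsym_apply form_hyperbolic form_simps)

lemma trace_sym_hsym:
  assumes "s \<in> form_symmetric form"
  shows "trace (s ** (hsym i - hsym j)) = 2 * form (f i) (s *v e i) - 2 * form (f j) (s *v e j)"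
  using trace_mult_sym_dyad[OF assms]
  by (simp add: hsym_def matrix_diff_ldistrib trace_diff)

lemma trace_add_right: "trace (s ** (t + t')) = trace (s ** t) + trace (s ** (t' :: 'f^'n^'n))"
  by (simp add: matrix_add_ldistrib trace_add)

text \<open>\<open>tr(xx) \<noteq> 0\<close> makes \<open>\<langle>a, a'\<rangle>\<close> visible in
  \<open>[x \<otimes> a, x \<otimes> a']\<close>; \<open>tr(xw) = 0\<close> keeps
  \<open>[x \<otimes> a, w \<otimes> a']\<close> free of a D-component;
  \<open>circ x x \<noteq> 0\<close> detects commutators \<open>aa' - a'a\<close>.\<close>

lemma ex_skew_witness:
  assumes "3 \<le> r"
  obtains x w where "x \<in> form_algebra form" "w \<in> form_algebra form" "w \<noteq> 0"
    "trace (x ** x) \<noteq> 0" "trace (x ** w) = 0" "circ x x \<noteq> 0"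
proof
  have r: "0 < r" "1 < r" using assms by auto
  show "hsk 0 \<in> form_algebra form" "hsk 1 \<in> form_algebra form" by (rule hsk_in)+
  show "trace (hsk 0 ** hsk 0) \<noteq> 0" "trace (hsk 0 ** hsk 1) = 0"
    using r by (simp_all add: trace_hsk)
  have "hsk 1 *v e 1 \<noteq> 0"
    using r hyperbolic_nonzero(1)[of 1] by (simp add: hsk_hsym_apply)
  then show "hsk 1 \<noteq> 0" by auto
  \<comment> \<open>\<open>hsk 0\<close> kills \<open>e 1\<close>, so only the scalar correction
    \<open>2/n\<close> times the trace \<open>2\<close> survives.\<close>
  have "circ (hsk 0) (hsk 0) *v e 1 = (- 4 / of_nat CARD('n)) *s e 1"
    using r by (simp add: circ_apply hsk_hsym_apply trace_hsk)
  also have "\<dots> \<noteq> 0"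
    using r hyperbolic_nonzero(1)[of 1] by simp
  finally show "circ (hsk 0) (hsk 0) \<noteq> 0" by auto
qed

text \<open>The counterpart in \<ss> of the witnesses in \<gg>, for brackets of \<ss> \<otimes> B
  with itself; three hyperbolic pairs make room for it.\<close>

lemma ex_sym_witness:
  assumes "3 \<le> r"
  obtains s w where "s \<in> form_symmetric form" "w \<in> form_symmetric form" "w \<noteq> 0"
    "trace (s ** s) \<noteq> 0" "trace (s ** w) = 0"
proof
  have r: "0 < r" "1 < r" "2 < r" using assms by auto
  \<comment> \<open>\<open>?w\<close> is symmetric in the indices 0 and 1 and \<open>?s\<close> is
    antisymmetric, which forces their trace product to vanish.\<close>
  let ?s = "hsym 0 - hsym 1" and ?w = "(hsym 0 - hsym 2) + (hsym 1 - hsym 2)"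
  show s: "?s \<in> form_symmetric form" using r by (intro hsym_diff_in)
  show "?w \<in> form_symmetric form"
    using r by (intro mat.subspace_add[OF subspace_form_symmetric] hsym_diff_in)
  show "trace (?s ** ?s) \<noteq> 0" "trace (?s ** ?w) = 0"
    unfolding trace_add_right trace_sym_hsym[OF s]
    using r by (simp_all add: mat_vec_simps hsk_hsym_apply form_simps form_hyperbolic)
  have "?w *v e 0 = sg *s e 0" unfolding mat_vec_simps using r by (simp add: hsk_hsym_apply)
  then show "?w \<noteq> 0" using r hyperbolic_nonzero(1)[of 0] by auto
qed

text \<open>For such a pair the bracket of \<open>x \<otimes> a\<close> and
  \<open>s \<otimes> b\<close> has only its \<gg>-part, a nonzero matrix tensored with half of
  \<open>ab - ba\<close>. Diagonal matrices commute, and \<open>e 0\<close> shows that the product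
  is nonzero.\<close>

lemma ex_mixed_witness:
  assumes "3 \<le> r"
  obtains x s where "x \<in> form_algebra form" "s \<in> form_symmetric form" "comm x s = 0" "circ x s \<noteq> 0"
proof
  have r: "0 < r" "1 < r" using assms by auto
  show x: "hsk 0 \<in> form_algebra form" by (rule hsk_in)
  show s: "hsym 0 - hsym 1 \<in> form_symmetric form" using r by (intro hsym_diff_in)
  have "comm (hsk 0) (hsym 0) = sym_dyad (sg *s e 0) (f 0) + sym_dyad (e 0) (- (sg *s f 0))"
    unfolding hsym_def using r by (simp add: comm_sym_dyad hsk_in hsk_hsym_apply)
  also have "- (sg *s f 0) = (- sg) *s f 0" by simp
  finally have "comm (hsk 0) (hsym 0) = 0"
    unfolding sym_dyad_linear by simp
  moreover have "comm (hsk 0) (hsym 1) = 0"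
    unfolding hsym_def using r by (simp add: comm_sym_dyad hsk_in hsk_hsym_apply sym_dyad_linear)
  ultimately show "comm (hsk 0) (hsym 0 - hsym 1) = 0" by (simp add: comm_diff_right)
  have "circ (hsk 0) (hsym 0 - hsym 1) *v e 0 = 2 *s e 0"
    using r trace_skew_sym[OF x s] by (simp add: circ_apply hsk_hsym_apply mat_vec_simps)
  also have "\<dots> \<noteq> 0" using r hyperbolic_nonzero(1)[of 0] by simp
  finally show "circ (hsk 0) (hsym 0 - hsym 1) \<noteq> 0" by auto
qed

text \<open>The invariant alternating 3-form on \<gg> is nonzero; this is what forces
  \<open>\<langle>1, a\<rangle> = 0\<close>.\<close>

lemma ex_triple_witness:
  assumes "3 \<le> r"
  obtains w x y where "w \<in> form_algebra form" "x \<in> form_algebra form" "y \<in> form_algebra form"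
    "trace (w ** comm x y) \<noteq> 0"
proof
  have r: "0 < r" "1 < r" using assms by auto
  let ?x = "skew_dyad (e 0) (e 1)" and ?y = "skew_dyad (f 0) (f 1)"
  show "hsk 0 \<in> form_algebra form" by (rule hsk_in)
  show x: "?x \<in> form_algebra form" and "?y \<in> form_algebra form" by (rule skew_dyad_in)+
  \<comment> \<open>\<open>hsk 0\<close> scales \<open>?x\<close> by \<open>sg\<close>, so
    invariance of the trace form reduces the triple product to a multiple of
    \<open>tr(?y ?x)\<close>, the pairing of two opposite root vectors.\<close>
  have "comm (hsk 0) ?x = mat_scale sg ?x"
    using r by (simp add: comm_skew_dyad[OF hsk_in] hsk_hsym_apply skew_dyad_linear)
  then have "comm ?x (hsk 0) = mat_scale (- sg) ?x"
    using comm_swap[of ?x "hsk 0"] by simp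
  then have "trace (hsk 0 ** comm ?x ?y) = - trace (?y ** mat_scale (- sg) ?x)"
    using trace_comm_shift[of "hsk 0" ?x ?y] trace_mul_sym[of "mat_scale (- sg) ?x" ?y] by simp
  also have "\<dots> = sg * (2 * form (e 1) (?y *v e 0))"
    by (simp only: mat_scale_mult_right trace_scale trace_mult_skew_dyad[OF skew_dyad_in] minus_mult_minus minus_mult_left minus_minus)
  also have "\<dots> \<noteq> 0" using r by (simp add: skew_dyad_apply form_simps form_hyperbolic)
  finally show "trace (hsk 0 ** comm ?x ?y) \<noteq> 0" .
qed

section \<open>Generation of V and simplicity of \<gg>\<close>

lemma subspace_vector_induct:
  assumes r: "3 \<le> r" and I: "vec.subspace I" "\<And>x u. x \<in> form_algebra form \<Longrightarrow> x *v u \<in> I"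
  shows "v \<in> I"
proof -
  have "f 0 = (- sg) *s (hsk 0 *v f 0)"
    using r by (simp add: hsk_hsym_apply)
  then have f0: "f 0 \<in> I"
    using I(2)[OF hsk_in] vec.subspace_scale[OF I(1)] by metis
  \<comment> \<open>\<open>skew_dyad v (f 0)\<close> maps \<open>e 0\<close> to
    \<open>sg *s v\<close> up to a multiple of \<open>f 0\<close>, which is already in
    \<open>I\<close>.\<close>
  have "v = sg *s (skew_dyad v (f 0) *v e 0) + form v (e 0) *s f 0"
    using r by (simp add: skew_dyad_apply form_hyperbolic vec.scale_right_diff_distrib)
  then show ?thesis
    using I(2)[OF skew_dyad_in] f0 vec.subspace_scale[OF I(1)] vec.subspace_add[OF I(1)] by metis
qed

text \<open>A long root vector, of weight twice \<open>eps 0\<close> in type C and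
  \<open>eps 0 + eps 1\<close> in types B and D, where \<open>skew_dyad (e 0) (e 0)\<close> would be
  zero. Its legs span an isotropic subspace, so its square is zero.\<close>

definition root :: "'f^'n^'n" where
  "root = (if sg = - 1 then skew_dyad (e 0) (e 0) else skew_dyad (e 0) (e 1))"

lemma sg_cases: "sg = - 1 \<or> sg = 1"
  by (simp add: sg_def)

lemma root_in: "root \<in> form_algebra form"
  by (simp add: root_def skew_dyad_in)

lemma root_nonzero: assumes "3 \<le> r" shows "root \<noteq> 0"
proof -
  have r: "0 < r" "1 < r" using assms by auto
  have "root *v (if sg = - 1 then f 0 else f 1) \<noteq> 0"
    using r hyperbolic_nonzero(1)[of 0] sg_cases
    by (auto simp: root_def skew_dyad_apply form_hyperbolic)
  then show ?thesis by auto
qed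

text \<open>Simplicity of \<gg> in explicit form: the ideal generated by \<open>root\<close>
  contains all skew dyads, hence everything.\<close>

lemma ideal_eq_form_algebra:
  assumes r: "3 \<le> r" and I: "mat.subspace I"
    and ideal: "\<And>x y. x \<in> form_algebra form \<Longrightarrow> y \<in> I \<Longrightarrow> comm x y \<in> I"
    and root: "root \<in> I"
  shows "form_algebra form \<subseteq> I"
proof -
  have r3: "0 < r" "Suc 0 < r" "2 < r" using r by auto
  note add = mat.subspace_add[OF I] and sub = mat.subspace_diff[OF I]
    and scale = mat.subspace_scale[OF I] and neg = mat.subspace_neg[OF I]
  have bracket: "skew_dyad (skew_dyad p q *v u) v + skew_dyad u (skew_dyad p q *v v) \<in> I"
    if "skew_dyad u v \<in> I" for p q u v
    using ideal[OF skew_dyad_in that, of p q] by (simp add: comm_skew_dyad[OF skew_dyad_in])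
  \<comment> \<open>\<open>U\<close> collects the vectors that may stand in the second leg whatever
    the first leg is. It is stable under skew dyads: bracket, then subtract the term that still has
    \<open>v\<close> in its second leg. One basis vector in \<open>U\<close> will therefore
    suffice.\<close>
  define U where "U = {v. \<forall>p. skew_dyad p v \<in> I}"
  have U_sub: "vec.subspace U"
    by (auto simp: U_def vec.subspace_def skew_dyad_linear add scale mat.subspace_0[OF I])
  have U_skew: "form q v *s w - (sg * form w v) *s q \<in> U" if "v \<in> U" for v w q
  proof -
    have "skew_dyad p (skew_dyad w q *v v) \<in> I" for p
      using sub[OF bracket[of p v w q], of "skew_dyad (skew_dyad w q *v p) v"] that
      by (simp add: U_def)
    then show ?thesis by (simp add: U_def skew_dyad_apply)
  qed
  have "\<exists>k<2. e k \<in> U"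
  proof (cases "sg = - 1")
    case True
    note sg = True
    have skew_sym: "skew_dyad v u = skew_dyad u v" for u v
      using skew_dyad_swap[of v u] by (simp add: sg)
    \<comment> \<open>The bracket of \<open>skew_dyad p (f 0)\<close> with the root vector; in type
      C skew dyads are symmetric, so the two summands coincide and may be halved.\<close>
    have *: "skew_dyad (form p (e 0) *s f 0 - p) (e 0) \<in> I" for p
    proof -
      have "skew_dyad p (f 0) *v e 0 = form p (e 0) *s f 0 - p"
        using r3 by (simp add: skew_dyad_apply form_hyperbolic sg)
      moreover have "skew_dyad (e 0) (e 0) \<in> I" using root True by (simp add: root_def)
      ultimately have "skew_dyad (form p (e 0) *s f 0 - p) (e 0) + skew_dyad (form p (e 0) *s f 0 - p) (e 0) \<in> I"
        using bracket[of "e 0" "e 0" p "f 0"] skew_sym[of "e 0" "form p (e 0) *s f 0 - p"] by simp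
      then show ?thesis using scale[of _ "1/2"] mat_scale_half by metis
    qed
    have f0: "skew_dyad (f 0) (e 0) \<in> I"
    proof -
      have "form (f 0) (e 0) *s f 0 - f 0 = (- 2) *s f 0"
        using r3 by (simp add: form_hyperbolic sg vec_eq_iff)
      then have "skew_dyad ((- 2) *s f 0) (e 0) \<in> I" using *[of "f 0"] by (simp only:)
      then have "mat_scale (- 2) (skew_dyad (f 0) (e 0)) \<in> I" by (simp only: skew_dyad_linear)
      then show ?thesis using scale[of _ "- 1 / 2"] by fastforce
    qed
    have "skew_dyad p (e 0) \<in> I" for p
      using sub[OF scale[OF f0, of "form p (e 0)"] *[of p]] by (simp add: skew_dyad_linear)
    then have "e 0 \<in> U" unfolding U_def by blast
    moreover have "(0 :: nat) < 2" by simp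
    ultimately show ?thesis by blast
  next
    case False
    then have sg: "sg = 1" using sg_cases by simp
    have e01: "skew_dyad (e 0) (e 1) \<in> I" using root False by (simp add: root_def)
    \<comment> \<open>Brackets with \<open>skew_dyad p q\<close> that annihilate the second leg
      \<open>v\<close> replace the first leg \<open>u\<close> by \<open>p\<close>, up to a multiple
      of \<open>q\<close>.\<close>
    have step: "skew_dyad p v - mat_scale (form p u) (skew_dyad q v) \<in> I"
      if "skew_dyad u v \<in> I" "form q u = 1" "form q v = 0" "form p v = 0" for p q u v
      using bracket[OF that(1), of p q] that by (simp add: skew_dyad_apply skew_dyad_linear sg)
    \<comment> \<open>Passing from \<open>e 0\<close> to \<open>f 0\<close> in a single step with
      \<open>p = q = f 0\<close> would only give zero; the third hyperbolic pair serves as a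
      stepping stone.\<close>
    have "skew_dyad (e 2) (e 1) - mat_scale (form (e 2) (e 0)) (skew_dyad (f 0) (e 1)) \<in> I"
      by (rule step[OF e01]) (use r3 in \<open>simp_all add: form_hyperbolic sg\<close>)
    then have e21: "skew_dyad (e 2) (e 1) \<in> I" using r3 by (simp add: form_hyperbolic)
    have "skew_dyad (f 0) (e 1) - mat_scale (form (f 0) (e 2)) (skew_dyad (f 2) (e 1)) \<in> I"
      by (rule step[OF e21]) (use r3 in \<open>simp_all add: form_hyperbolic sg\<close>)
    then have f01: "skew_dyad (f 0) (e 1) \<in> I" using r3 by (simp add: form_hyperbolic)
    have perp: "skew_dyad p (e 1) \<in> I" if "form p (e 1) = 0" for p
    proof -
      have "skew_dyad p (e 1) - mat_scale (form p (e 0)) (skew_dyad (f 0) (e 1)) \<in> I"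
        by (rule step[OF e01]) (use r3 that in \<open>simp_all add: form_hyperbolic sg\<close>)
      from add[OF this scale[OF f01, of "form p (e 0)"]] show ?thesis by (simp only: diff_add_cancel)
    qed
    \<comment> \<open>\<open>f 1\<close> is not orthogonal to \<open>e 1\<close>, so
      \<open>step\<close> does not reach it. Two brackets each give it with an extra dyad in
      \<open>e 0\<close> and \<open>f 0\<close>, and these extra terms cancel in the sum.\<close>
    have f11: "skew_dyad (f 1) (e 1) \<in> I"
    proof -
      have "skew_dyad (f 0) (f 1) *v e 0 = - f 1" "skew_dyad (f 0) (f 1) *v e 1 = f 0"
        using r3 by (simp_all add: skew_dyad_apply form_hyperbolic sg)
      with bracket[OF e01, of "f 0" "f 1"]
      have 1: "skew_dyad (- f 1) (e 1) + skew_dyad (e 0) (f 0) \<in> I" by (simp only:)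
      have "skew_dyad (e 0) (f 1) *v f 0 = - f 1" "skew_dyad (e 0) (f 1) *v e 1 = e 0"
        using r3 by (simp_all add: skew_dyad_apply form_hyperbolic sg)
      with bracket[OF f01, of "e 0" "f 1"]
      have 2: "skew_dyad (- f 1) (e 1) + skew_dyad (f 0) (e 0) \<in> I" by (simp only:)
      have "skew_dyad (f 0) (e 0) = - skew_dyad (e 0) (f 0)"
        using skew_dyad_swap[of "f 0" "e 0"] by (simp add: sg)
      then have "(skew_dyad (- f 1) (e 1) + skew_dyad (e 0) (f 0)) +
          (skew_dyad (- f 1) (e 1) + skew_dyad (f 0) (e 0)) = mat_scale (- 2) (skew_dyad (f 1) (e 1))"
        by (simp add: skew_dyad_linear)
      with add[OF 1 2] have "mat_scale (- 2) (skew_dyad (f 1) (e 1)) \<in> I" by (simp only:)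
      from scale[OF this, of "- 1 / 2"] show ?thesis by simp
    qed
    have "skew_dyad p (e 1) \<in> I" for p
    proof -
      have "form (p - form p (e 1) *s f 1) (e 1) = 0"
        using r3 by (simp add: form_simps form_hyperbolic sg)
      from add[OF perp[OF this] scale[OF f11, of "form p (e 1)"]] show ?thesis
        by (simp only: skew_dyad_linear diff_add_cancel)
    qed
    then have "e 1 \<in> U" unfolding U_def by blast
    moreover have "(1 :: nat) < 2" by simp
    ultimately show ?thesis by blast
  qed
  then obtain k where k: "k < 2" "e k \<in> U" by blast
  have kr: "k < r" using k r3 by simp
  \<comment> \<open>As \<open>k < 2\<close>, the pair with index 2 is orthogonal to
    \<open>e k\<close> and \<open>f k\<close>. The skew dyad of \<open>v\<close> and
    \<open>f 2\<close> then carries \<open>e 2\<close> to \<open>sg *s v\<close> modulo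
    \<open>f 2\<close>.\<close>
  have "e 2 \<in> U" "f 2 \<in> U"
    using vec.subspace_scale[OF U_sub U_skew[OF k(2), of "f k" "e 2"], of sg]
      vec.subspace_scale[OF U_sub U_skew[OF k(2), of "f k" "f 2"], of sg] k kr r3
    by (auto simp: form_hyperbolic)
  moreover have "v = sg *s (sg *s v - (sg * form v (e 2)) *s f 2) + form v (e 2) *s f 2" for v
    by (simp add: vec.scale_right_diff_distrib)
  moreover have "sg *s v - (sg * form v (e 2)) *s f 2 \<in> U" for v
    using U_skew[OF calculation(1), of "f 2" v] r3 by (simp add: form_hyperbolic)
  ultimately have "v \<in> U" for v
    using vec.subspace_scale[OF U_sub] vec.subspace_add[OF U_sub] by metis
  then have dyads: "skew_dyad u v \<in> I" for u v by (simp add: U_def)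
  show ?thesis
  proof
    fix t assume "t \<in> form_algebra form"
    from skew_expand[OF this] show "t \<in> I"
      by (rule ssubst) (intro scale mat.subspace_sum[OF I] dyads)
  qed
qed

text \<open>\<open>root\<close> is a multiple of \<open>[hsk 0, root]\<close>, so the part of
  \<open>I\<close> inside \<gg> is an ideal containing \<open>root\<close>. It serves to extend
  formulas proved on commutators to all of \<gg>.\<close>

lemma perfect_induct:
  assumes r: "3 \<le> r" and I: "mat.subspace I"
    and comm: "\<And>x y. x \<in> form_algebra form \<Longrightarrow> y \<in> form_algebra form \<Longrightarrow> comm x y \<in> I"
  shows "form_algebra form \<subseteq> I"
proof -
  have r3: "0 < r" "Suc 0 < r" using r by auto
  have "comm (hsk 0) root = (if sg = - 1 then mat_scale (- 2) root else root)"
    using r3 sg_cases by (auto simp: root_def comm_skew_dyad[OF hsk_in] hsk_hsym_apply skew_dyad_linear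
)
  then have "root = comm (hsk 0) root \<or> root = mat_scale (- 1 / 2) (comm (hsk 0) root)"
    by (auto split: if_splits)
  then have "root \<in> I"
    using comm[OF hsk_in root_in] mat.subspace_scale[OF I] by metis
  then have "form_algebra form \<subseteq> I \<inter> form_algebra form"
    using comm comm_skew_skew root_in
    by (intro ideal_eq_form_algebra[OF r mat.subspace_inter[OF I subspace_form_algebra]]) auto
  then show ?thesis by blast
qed

section \<open>The symmetric module as the span of [\<gg>, \<ss>]\<close>

definition sym_dyad0 :: "'f^'n \<Rightarrow> 'f^'n \<Rightarrow> 'f^'n^'n" where
  "sym_dyad0 u v = sym_dyad u v - mat (2 / of_nat CARD('n) * form v u)"

lemma sym_dyad0_in: "sym_dyad0 u v \<in> form_symmetric form"
  by (simp add: form_symmetric_def sym_dyad0_def mat_vec_simps form_simps form_sym_dyad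
      trace_diff trace_sym_dyad trace_mat)

lemma sym_dyad_sum_left: "sym_dyad (\<Sum>i\<in>A. u i) v = (\<Sum>i\<in>A. sym_dyad (u i) v)"
  by (induction A rule: infinite_finite_induct) (simp_all add: sym_dyad_linear)

text \<open>Contraction over dual bases, which exhibits \<open>\<ss>\<close> as \<open>[\<gg>, \<ss>]\<close>.\<close>

lemma sum_comm_sym_dyad0:
  "(\<Sum>i\<in>UNIV. comm (skew_dyad p (dual i)) (sym_dyad0 (axis i 1) v)) =
     mat_scale (of_nat CARD('n)) (sym_dyad0 p v)"
proof -
  have "comm (skew_dyad p (dual i)) (sym_dyad0 (axis i 1) v) =
      sym_dyad (p - sg *s (form p (axis i 1) *s dual i)) v +
      (sym_dyad (v $ i *s axis i 1) p - mat_scale (sg * form p v) (sym_dyad (axis i 1) (dual i)))" for i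
    unfolding sym_dyad0_def comm_diff_right comm_mat comm_sym_dyad[OF skew_dyad_in] skew_dyad_apply
    by (simp add: sym_dyad_linear)
  then have "(\<Sum>i\<in>UNIV. comm (skew_dyad p (dual i)) (sym_dyad0 (axis i 1) v)) =
      (\<Sum>i\<in>UNIV. sym_dyad (p - sg *s (form p (axis i 1) *s dual i)) v) +
      ((\<Sum>i\<in>UNIV. sym_dyad (v $ i *s axis i 1) p) -
       (\<Sum>i\<in>UNIV. mat_scale (sg * form p v) (sym_dyad (axis i 1) (dual i))))"
    by (simp only: sum.distrib sum_subtractf)
  also have "\<dots> = sym_dyad (\<Sum>i\<in>UNIV. p - sg *s (form p (axis i 1) *s dual i)) v +
      (sym_dyad (\<Sum>i\<in>UNIV. v $ i *s axis i 1) p -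
       mat_scale (sg * form p v) (\<Sum>i\<in>UNIV. sym_dyad (axis i 1) (dual i)))"
    by (simp only: sym_dyad_sum_left mat.scale_sum_right)
  also have "(\<Sum>i\<in>UNIV. p - sg *s (form p (axis i 1) *s dual i)) = of_nat CARD('n) *s p - sg *s p"
    by (simp only: sum_subtractf sum_form_dual vec.scale_sum_right[symmetric] sum_constant)
      (simp add: vec_eq_iff of_nat_index)
  also have "(\<Sum>i\<in>UNIV. v $ i *s axis i 1) = v" by (rule basis_expansion)
  also have "(\<Sum>i\<in>UNIV. sym_dyad (axis i 1) (dual i)) = mat 2"
  proof -
    have "mat_scale 2 (mat 1) = (\<Sum>i\<in>UNIV. sym_dyad (axis i 1) (dual i))"
      by (subst sym_expand[of "mat 1"]) simp_all
    moreover have "mat_scale 2 (mat 1) = (mat 2 :: 'f^'n^'n)" by (simp add: matrix_eq)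
    ultimately show ?thesis by simp
  qed
  also have "sym_dyad v p = mat_scale sg (sym_dyad p v)"
    by (simp add: sym_dyad_def mat.scale_right_distrib add.commute)
  also have "sg * form p v = form v p" using form_swap[of v p] by simp
  \<comment> \<open>The first sum contributes \<open>n - sg\<close> copies of
    \<open>sym_dyad p v\<close> and the swapped dyad the missing \<open>sg\<close>; the term
    \<open>mat 2\<close> becomes \<open>n\<close> times the trace correction.\<close>
  finally show ?thesis
    by (simp add: sym_dyad_linear sym_dyad0_def matrix_eq mat_vec_simps vec_eq_iff algebra_simps)
qed

text \<open>By the contraction, and since \<open>n\<close> is invertible, \<open>I\<close> contains
  every \<open>sym_dyad0 p v\<close>. In the expansion of a trace-free \<open>t\<close> the scalar
  corrections add up to a multiple of \<open>trace t\<close>, so \<open>sym_dyad\<close> may be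
  replaced by \<open>sym_dyad0\<close>.\<close>

lemma symmetric_induct:
  assumes I: "mat.subspace I"
    and comm: "\<And>x s. x \<in> form_algebra form \<Longrightarrow> s \<in> form_symmetric form \<Longrightarrow> comm x s \<in> I"
  shows "form_symmetric form \<subseteq> I"
proof
  fix t assume t: "t \<in> form_symmetric form"
  have dyad0: "sym_dyad0 p v \<in> I" for p v
  proof -
    have "mat_scale (of_nat CARD('n)) (sym_dyad0 p v) \<in> I"
      unfolding sum_comm_sym_dyad0[symmetric]
      by (intro mat.subspace_sum[OF I] comm skew_dyad_in sym_dyad0_in)
    then show ?thesis
      using mat.subspace_scale[OF I, of _ "1 / of_nat CARD('n)"] by fastforce
  qed
  have "(\<Sum>j\<in>UNIV. form (dual j) (t *v axis j 1)) = trace t"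
    by (simp add: trace_def matrix_vector_mult_def axis_def if_distrib[of "(*) _"] cong: if_cong)
  then have "(\<Sum>j\<in>UNIV. mat (2 / of_nat CARD('n) * form (dual j) (t *v axis j 1)) :: 'f^'n^'n) = 0"
    using form_symmetric_trace[OF t]
    by (simp only: sum_mat sum_distrib_left[symmetric]) simp
  then have "(\<Sum>j\<in>UNIV. sym_dyad0 (t *v axis j 1) (dual j)) = (\<Sum>j\<in>UNIV. sym_dyad (t *v axis j 1) (dual j))"
    by (simp add: sym_dyad0_def sum_subtractf)
  then have "t = mat_scale (1/2) (\<Sum>j\<in>UNIV. sym_dyad0 (t *v axis j 1) (dual j))"
    using sym_expand[of t, OF form_symmetricD[OF t]] by simp
  also have "\<dots> \<in> I"
    by (intro mat.subspace_scale[OF I] mat.subspace_sum[OF I] dyad0)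
  finally show "t \<in> I" .
qed

section \<open>The square of the adjoint action of the root vector\<close>

lemma root_square: assumes "3 \<le> r" shows "root *v (root *v w) = 0"
proof -
  have r: "0 < r" "1 < r" using assms by auto
  then show ?thesis by (simp add: root_def skew_dyad_apply mat_vec_simps form_simps form_hyperbolic)
qed

lemma comm_comm_root: assumes "3 \<le> r" shows "comm root (comm root y) = mat_scale (- 2) (root ** y ** root)"
  by (simp add: matrix_eq comm_apply mat_vec_simps root_square[OF assms])

text \<open>\<open>root ** y ** root\<close> depends only on the values \<open>(u, y v)\<close> for
  \<open>u\<close> and \<open>v\<close> among the legs of \<open>root\<close>. In type C there is
  one leg; in types B and D these values are alternating, so one number remains.\<close>

lemma comm_comm_root_skew:
  assumes r: "3 \<le> r" and y: "y \<in> form_algebra form"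
  shows "\<exists>k. comm root (comm root y) = mat_scale k root"
proof (cases "sg = - 1")
  case True
  then have "comm root (comm root y) = mat_scale (- 4 * form (e 0) (y *v e 0)) root"
    unfolding comm_comm_root[OF r]
    by (simp add: root_def matrix_eq mat_vec_simps skew_dyad_apply form_simps)
  then show ?thesis by blast
next
  case False
  then have sg: "sg = 1" using sg_cases by simp
  have y': "form u (y *v v) = - form v (y *v u)" for u v
    using form_algebraD[OF y, of u v] form_swap[of "y *v u" v] by (simp add: sg)
  have "form u (y *v u) = 0" for u
    using y'[of u u] by simp
  then have "comm root (comm root y) = mat_scale (- 2 * form (e 1) (y *v e 0)) root"
    unfolding comm_comm_root[OF r] using False y'[of "e 0" "e 1"]
    by (simp add: root_def matrix_eq mat_vec_simps skew_dyad_apply form_simps sg) (simp add: vec_eq_iff algebra_simps)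
  then show ?thesis by blast
qed

text \<open>Up to the factor \<open>- 1/2\<close>, \<open>y\<close> is the lowering element of an
  \<open>sl\<^sub>2\<close>-triple with raising element \<open>root\<close>.\<close>

lemma ex_comm_comm_root:
  assumes r: "3 \<le> r"
  obtains y where "y \<in> form_algebra form" "comm root (comm root y) = root"
proof -
  have r3: "0 < r" "Suc 0 < r" using r by auto
  \<comment> \<open>Multiples of the opposite root vector, normalised so that \<open>- 2\<close>
    times \<open>root ** ?y ** root\<close> is \<open>root\<close>. In type C both skew dyads are
    twice a dyad, whence the smaller constant.\<close>
  let ?y = "if sg = - 1 then mat_scale (1/8) (skew_dyad (f 0) (f 0)) else mat_scale (1/2) (skew_dyad (f 0) (f 1))"
  have "comm root (comm root ?y) = root"
    unfolding comm_comm_root[OF r] using r3 sg_cases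
    by (simp add: root_def matrix_eq mat_vec_simps skew_dyad_apply form_simps form_hyperbolic)
      (simp add: vec_eq_iff algebra_simps)
  moreover have "?y \<in> form_algebra form"
    using mat.subspace_scale[OF subspace_form_algebra skew_dyad_in] by simp
  ultimately show thesis using that by blast
qed

text \<open>For self-adjoint \<open>s\<close> the bilinear form \<open>(u, s v)\<close> is skew in
  type C, so its only relevant value, at \<open>e 0\<close> and \<open>e 0\<close>, is zero.\<close>

lemma comm_comm_root_sym_C:
  assumes r: "3 \<le> r" and sg: "sg = - 1" and s: "s \<in> form_symmetric form"
  shows "comm root (comm root s) = 0"
proof -
  have "form (e 0) (s *v e 0) = 0"
    using form_symmetricD[OF s, of "e 0" "e 0"] form_swap[of "s *v e 0" "e 0"] sg by simp
  then show ?thesis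
    unfolding comm_comm_root[OF r] using sg
    by (simp add: root_def matrix_eq mat_vec_simps skew_dyad_apply form_simps)
qed

text \<open>In types B and D the form \<open>(u, s v)\<close> is symmetric; its three values on
  \<open>e 0\<close> and \<open>e 1\<close> survive and give an element of the symmetric square of
  that plane.\<close>

lemma comm_comm_root_sym:
  assumes r: "3 \<le> r" and sg: "sg = 1" and s: "s \<in> form_symmetric form"
  shows "\<exists>k k' k''. comm root (comm root s) = mat_scale k (sym_dyad (e 0) (e 0)) +
     mat_scale k' (sym_dyad (e 0) (e 1)) + mat_scale k'' (sym_dyad (e 1) (e 1))"
proof -
  have s': "form (e 0) (s *v e 1) = form (e 1) (s *v e 0)"
    using form_symmetricD[OF s, of "e 0" "e 1"] form_swap[of "s *v e 0" "e 1"] by (simp add: sg)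
  have "comm root (comm root s) = mat_scale (form (e 1) (s *v e 1)) (sym_dyad (e 0) (e 0)) +
     mat_scale (- 2 * form (e 1) (s *v e 0)) (sym_dyad (e 0) (e 1)) +
     mat_scale (form (e 0) (s *v e 0)) (sym_dyad (e 1) (e 1))"
    unfolding comm_comm_root[OF r] using sg s'
    by (simp add: root_def matrix_eq mat_vec_simps skew_dyad_apply sym_dyad_apply form_simps sg)
      (simp add: vec_eq_iff algebra_simps)
  then show ?thesis by blast
qed

end

section \<open>Linear maps out of tensor products and direct sums\<close>

lemma tensor_map_nonzero:
  assumes "vector_space sX" "vector_space sY" "vector_space sZ"
    and t: "tensor_map sX sY sZ X Y t"
    and xy: "x \<in> X" "x \<noteq> 0" "y \<in> Y" "y \<noteq> 0"
  shows "t x y \<noteq> 0"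
proof -
  interpret X: vector_space sX by fact
  interpret Y: vector_space sY by fact
  interpret Z: vector_space sZ by fact
  have "{x} \<subseteq> X \<and> \<not> X.dependent {x} \<and> {y} \<subseteq> Y \<and> \<not> Y.dependent {y}"
    using xy by simp
  then have "\<not> Z.dependent ((\<lambda>(x, y). t x y) ` ({x} \<times> {y}))"
    using t unfolding tensor_map_def by blast
  then show ?thesis by simp
qed

text \<open>\<open>G\<close> realises \<open>id \<otimes> g\<close>. Products of basis vectors are
  independent, so values may be prescribed on them; the formula then spreads by linearity, first in
  \<open>x\<close> and then in \<open>y\<close>.\<close>

lemma tensor_map_lift:
  assumes "vector_space sX" "vector_space sY" "vector_space sZ"
    and X: "module.subspace sX X" and Y: "module.subspace sY Y"
    and t: "tensor_map sX sY sZ X Y t"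
    and g: "linear_on sY sY Y g" "\<And>y. y \<in> Y \<Longrightarrow> g y \<in> Y"
  obtains G where "Vector_Spaces.linear sZ sZ G"
    "\<And>x y. x \<in> X \<Longrightarrow> y \<in> Y \<Longrightarrow> G (t x y) = t x (g y)"
proof -
  interpret X: vector_space sX by fact
  interpret Y: vector_space sY by fact
  interpret Z: vector_space sZ by fact
  interpret ZZ: vector_space_pair sZ sZ by unfold_locales
  have t_right: "t x (y + y') = t x y + t x y'" "t x (sY k y) = sZ k (t x y)"
    if "x \<in> X" "y \<in> Y" "y' \<in> Y" for x y y' k
    using t that by (auto simp: tensor_map_def bilinear_on_def linear_on_def)
  have t_left: "t (x + x') y = t x y + t x' y" "t (sX k x) y = sZ k (t x y)"
    if "x \<in> X" "x' \<in> X" "y \<in> Y" for x x' y k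
    using t that by (auto simp: tensor_map_def bilinear_on_def linear_on_def)
  have g_lin: "g (y + y') = g y + g y'" "g (sY k y) = sY k (g y)"
    if "y \<in> Y" "y' \<in> Y" for y y' k
    using g(1) that by (auto simp: linear_on_def)
  obtain P where P: "P \<subseteq> X" "\<not> X.dependent P" "X \<subseteq> X.span P"
    using X.maximal_independent_subset by blast
  obtain Q where Q: "Q \<subseteq> Y" "\<not> Y.dependent Q" "Y \<subseteq> Y.span Q"
    using Y.maximal_independent_subset by blast
  have "inj_on (\<lambda>(x, y). t x y) (P \<times> Q) \<and> \<not> Z.dependent ((\<lambda>(x, y). t x y) ` (P \<times> Q))"
    using t P Q by (simp add: tensor_map_def)
  then have inj: "inj_on (\<lambda>(x, y). t x y) (P \<times> Q)"
    and indep: "\<not> Z.dependent ((\<lambda>(x, y). t x y) ` (P \<times> Q))" by blast+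
  define inv where "inv = inv_into (P \<times> Q) (\<lambda>(x, y). t x y)"
  obtain G where G: "Vector_Spaces.linear sZ sZ G"
    "\<And>z. z \<in> (\<lambda>(x, y). t x y) ` (P \<times> Q) \<Longrightarrow> G z = (case inv z of (p, q) \<Rightarrow> t p (g q))"
    using ZZ.linear_independent_extend[OF indep, of "\<lambda>z. case inv z of (p, q) \<Rightarrow> t p (g q)"] by blast
  interpret G: Vector_Spaces.linear sZ sZ G by fact
  have PQ: "G (t p q) = t p (g q)" if "p \<in> P" "q \<in> Q" for p q
  proof -
    have "inv (t p q) = (p, q)"
      unfolding inv_def using inv_into_f_f[OF inj, of "(p, q)"] that by simp
    then show ?thesis using G(2)[of "t p q"] that by force
  qed
  have XQ: "G (t x q) = t x (g q)" if "x \<in> X" "q \<in> Q" for x q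
  proof -
    have q: "q \<in> Y" "g q \<in> Y" using that Q g(2) by auto
    have "X.subspace {x \<in> X. G (t x q) = t x (g q)}"
      using X.subspace_0[OF X] X.subspace_add[OF X] X.subspace_scale[OF X] t_left[OF _ _ q(1)]
        t_left[OF _ _ q(2)] t_left(2)[of 0 0 q 0] t_left(2)[of 0 0 "g q" 0] q
      by (auto simp: X.subspace_def G.add G.scale)
    moreover have "P \<subseteq> {x \<in> X. G (t x q) = t x (g q)}" using P PQ that by auto
    ultimately show ?thesis using X.span_minimal P(3) that(1) by blast
  qed
  have "G (t x y) = t x (g y)" if "x \<in> X" "y \<in> Y" for x y
  proof -
    have "Y.subspace {y \<in> Y. G (t x y) = t x (g y)}"
      using Y.subspace_0[OF Y] Y.subspace_add[OF Y] Y.subspace_scale[OF Y] t_right[OF that(1)]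
        t_right(2)[OF that(1), of 0 0 0] g_lin(2)[of 0 0 0] g
      by (auto simp: Y.subspace_def G.add G.scale g_lin)
    moreover have "Q \<subseteq> {y \<in> Y. G (t x y) = t x (g y)}" using Q XQ that by auto
    ultimately show ?thesis using Y.span_minimal Q(3) that(2) by blast
  qed
  with G(1) that show thesis by blast
qed

text \<open>A linear map with prescribed values on a family exists once every relation among the
  \<open>u i\<close> also holds among the \<open>w i\<close>. Define it on a basis chosen from the
  family and compare the expansion of each remaining member. Condition (b) supplies the hypothesis
  for D.\<close>

lemma linear_family_lift:
  fixes u :: "'i \<Rightarrow> 'v::ab_group_add" and w :: "'i \<Rightarrow> 'w::ab_group_add"
  assumes "vector_space s1" "vector_space s2"
    and rel: "\<And>F c. finite F \<Longrightarrow> (\<Sum>i\<in>F. s1 (c i) (u i)) = 0 \<Longrightarrow> (\<Sum>i\<in>F. s2 (c i) (w i)) = 0"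
  obtains G where "Vector_Spaces.linear s1 s2 G" "\<And>i. G (u i) = w i"
proof -
  interpret V: vector_space s1 by fact
  interpret W: vector_space s2 by fact
  interpret VW: vector_space_pair s1 s2 by unfold_locales
  obtain B where B: "B \<subseteq> range u" "\<not> V.dependent B" "range u \<subseteq> V.span B"
    using V.maximal_independent_subset by blast
  define v where "v = inv_into UNIV u"
  have uv: "u (v b) = b" if "b \<in> B" for b
    unfolding v_def using that B(1) by (intro f_inv_into_f) auto
  obtain G where G: "Vector_Spaces.linear s1 s2 G" "\<And>b. b \<in> B \<Longrightarrow> G b = w (v b)"
    using VW.linear_independent_extend[OF B(2), of "\<lambda>b. w (v b)"] by blast
  interpret G: Vector_Spaces.linear s1 s2 G by fact
  have "G (u i) = w i" for i
  proof -
    have "u i \<in> V.span B" using B(3) by blast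
    then obtain F c where F: "finite F" "F \<subseteq> B" "u i = (\<Sum>b\<in>F. s1 (c b) b)"
      unfolding V.span_explicit by blast
    have inj: "inj_on v F" using uv F(2) by (metis inj_onI subsetD)
    define J where "J = v ` F"
    have J: "finite J" using F by (simp add: J_def)
    \<comment> \<open>Coefficients of the relation "expansion of \<open>u i\<close> minus
      \<open>u i\<close>", written with two indicators because \<open>i\<close> may itself lie in
      \<open>J\<close>.\<close>
    let ?c = "\<lambda>j. (if j \<in> J then c (u j) else 0) - (if j = i then 1 else 0)"
    have split1: "(\<Sum>j\<in>insert i J. s1 (?c j) (u j)) = (\<Sum>b\<in>F. s1 (c b) b) - u i"
    proof -
      have "(\<Sum>j\<in>insert i J. s1 (?c j) (u j)) =
          (\<Sum>j\<in>insert i J. if j \<in> J then s1 (c (u j)) (u j) else 0) -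
          (\<Sum>j\<in>insert i J. if j = i then u j else 0)"
        unfolding sum_subtractf[symmetric]
        by (intro sum.cong) (auto simp: V.scale_left_diff_distrib)
      also have "(\<Sum>j\<in>insert i J. if j \<in> J then s1 (c (u j)) (u j) else 0) = (\<Sum>j\<in>J. s1 (c (u j)) (u j))"
        by (rule sum.mono_neutral_cong_right) (use J in auto)
      also have "\<dots> = (\<Sum>b\<in>F. s1 (c b) b)"
        unfolding J_def sum.reindex[OF inj] using uv F(2) by (auto intro!: sum.cong)
      finally show ?thesis using J by (simp add: sum.delta)
    qed
    have split2: "(\<Sum>j\<in>insert i J. s2 (?c j) (w j)) = (\<Sum>b\<in>F. s2 (c b) (w (v b))) - w i"
    proof -
      have "(\<Sum>j\<in>insert i J. s2 (?c j) (w j)) =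
          (\<Sum>j\<in>insert i J. if j \<in> J then s2 (c (u j)) (w j) else 0) -
          (\<Sum>j\<in>insert i J. if j = i then w j else 0)"
        unfolding sum_subtractf[symmetric]
        by (intro sum.cong) (auto simp: W.scale_left_diff_distrib)
      also have "(\<Sum>j\<in>insert i J. if j \<in> J then s2 (c (u j)) (w j) else 0) = (\<Sum>j\<in>J. s2 (c (u j)) (w j))"
        by (rule sum.mono_neutral_cong_right) (use J in auto)
      also have "\<dots> = (\<Sum>b\<in>F. s2 (c b) (w (v b)))"
        unfolding J_def sum.reindex[OF inj] using uv F(2) by (auto intro!: sum.cong)
      finally show ?thesis using J by (simp add: sum.delta)
    qed
    have "(\<Sum>b\<in>F. s2 (c b) (w (v b))) - w i = 0"
      using rel[of "insert i J" ?c] split1 split2 J F(3) by simp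
    moreover have "G (u i) = (\<Sum>b\<in>F. s2 (c b) (w (v b)))"
      unfolding F(3) using F(2) G(2) by (auto simp: G.sum G.scale intro!: sum.cong)
    ultimately show ?thesis by simp
  qed
  with G(1) that show thesis by blast
qed

lemma direct_sum4_lift:
  assumes "vector_space s"
    and sub: "module.subspace s P" "module.subspace s Q" "module.subspace s R" "module.subspace s D"
    and dec: "\<forall>z. \<exists>!(p, q, v, d). p \<in> P \<and> q \<in> Q \<and> v \<in> R \<and> d \<in> D \<and> z = p + q + v + d"
    and lin: "Vector_Spaces.linear s s G1" "Vector_Spaces.linear s s G2"
      "Vector_Spaces.linear s s G3" "Vector_Spaces.linear s s G4"
  obtains \<Psi> where "Vector_Spaces.linear s s \<Psi>" "\<And>p. p \<in> P \<Longrightarrow> \<Psi> p = G1 p"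
    "\<And>q. q \<in> Q \<Longrightarrow> \<Psi> q = G2 q" "\<And>v. v \<in> R \<Longrightarrow> \<Psi> v = G3 v" "\<And>d. d \<in> D \<Longrightarrow> \<Psi> d = G4 d"
proof -
  interpret V: vector_space s by fact
  interpret G1: Vector_Spaces.linear s s G1 by fact
  interpret G2: Vector_Spaces.linear s s G2 by fact
  interpret G3: Vector_Spaces.linear s s G3 by fact
  interpret G4: Vector_Spaces.linear s s G4 by fact
  define K where "K z = (\<lambda>(p, q, v, d). p \<in> P \<and> q \<in> Q \<and> v \<in> R \<and> d \<in> D \<and> z = p + q + v + d)" for z
  have K: "\<exists>!x. K z x" for z using dec by (simp add: K_def case_prod_unfold)
  define \<Psi> where "\<Psi> z = (case THE x. K z x of (p, q, v, d) \<Rightarrow> G1 p + G2 q + G3 v + G4 d)" for z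
  have \<Psi>: "\<Psi> (p + q + v + d) = G1 p + G2 q + G3 v + G4 d"
    if "p \<in> P" "q \<in> Q" "v \<in> R" "d \<in> D" for p q v d
  proof -
    have "K (p + q + v + d) (p, q, v, d)" using that by (simp add: K_def)
    then have "(THE x. K (p + q + v + d) x) = (p, q, v, d)" using K by blast
    then show ?thesis by (simp add: \<Psi>_def)
  qed
  have ex: "\<exists>p\<in>P. \<exists>q\<in>Q. \<exists>v\<in>R. \<exists>d\<in>D. z = p + q + v + d" for z
  proof -
    obtain x where "K z x" using K by blast
    then show ?thesis by (auto simp: K_def split: prod.splits)
  qed
  have "Vector_Spaces.linear s s \<Psi>"
  proof
    fix z z'
    obtain p q v d where z: "p \<in> P" "q \<in> Q" "v \<in> R" "d \<in> D" "z = p + q + v + d" using ex by blast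
    obtain p' q' v' d' where z': "p' \<in> P" "q' \<in> Q" "v' \<in> R" "d' \<in> D" "z' = p' + q' + v' + d'"
      using ex by blast
    have zz: "z + z' = (p + p') + (q + q') + (v + v') + (d + d')" using z z' by simp
    have "\<Psi> (z + z') = G1 (p + p') + G2 (q + q') + G3 (v + v') + G4 (d + d')"
      unfolding zz by (intro \<Psi> V.subspace_add sub z z')
    then show "\<Psi> (z + z') = \<Psi> z + \<Psi> z'"
      unfolding z(5) z'(5) \<Psi>[OF z(1-4)] \<Psi>[OF z'(1-4)]
      by (simp add: G1.add G2.add G3.add G4.add)
    fix k
    have "s k z = s k p + s k q + s k v + s k d" using z by (simp add: V.scale_right_distrib)
    then show "\<Psi> (s k z) = s k (\<Psi> z)"
      using \<Psi>[of "s k p" "s k q" "s k v" "s k d"] \<Psi>[OF z(1-4)] z sub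
      by (simp add: V.subspace_scale G1.scale G2.scale G3.scale G4.scale V.scale_right_distrib)
  qed
  moreover have "\<Psi> p = G1 p" if "p \<in> P" for p
    using \<Psi>[of p 0 0 0] that sub by (simp add: V.subspace_0)
  moreover have "\<Psi> q = G2 q" if "q \<in> Q" for q
    using \<Psi>[of 0 q 0 0] that sub by (simp add: V.subspace_0)
  moreover have "\<Psi> v = G3 v" if "v \<in> R" for v
    using \<Psi>[of 0 0 v 0] that sub by (simp add: V.subspace_0)
  moreover have "\<Psi> d = G4 d" if "d \<in> D" for d
    using \<Psi>[of 0 0 0 d] that sub by (simp add: V.subspace_0)
  ultimately show thesis using that by blast
qed

section \<open>Linear maps compatible with individual brackets\<close>

context lie_algebra_over
begin

lemma br_add_left: "br (x + x') y = br x y + br x' y"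
  and br_add_right: "br x (y + y') = br x y + br x y'"
  and br_scale_left: "br (sL k x) y = sL k (br x y)"
  and br_scale_right: "br x (sL k y) = sL k (br x y)"
  using br_bilinear by (simp_all add: bilinear_on_def linear_on_def)

lemma br_zero_left [simp]: "br 0 y = 0" and br_zero_right [simp]: "br x 0 = 0"
  using br_scale_left[of 0 0 y] br_scale_right[of x 0 0] by simp_all

lemma br_minus_left: "br (- x) y = - br x y" and br_minus_right: "br x (- y) = - br x y"
  using br_scale_left[of "- 1" x y] br_scale_right[of x "- 1" y] by simp_all

lemma br_diff_left: "br (x - x') y = br x y - br x' y"
  and br_diff_right: "br x (y - y') = br x y - br x y'"
  using br_add_left[of x "- x'" y] br_add_right[of x y "- y'"]
  by (simp_all add: br_minus_left br_minus_right)

lemmas br_simps = br_add_left br_add_right br_diff_left br_diff_right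
  br_scale_left br_scale_right br_minus_left br_minus_right

lemma br_swap: "br x y = - br y x"
proof -
  have "br x y + br y x = 0"
    using br_self[of "x + y"] unfolding br_add_left br_add_right by (simp add: br_self add.commute)
  then show ?thesis by (simp add: eq_neg_iff_add_eq_0)
qed

lemma br_derivation: "br x (br y z) = br (br x y) z + br y (br x z)"
proof -
  have "br x (br y z) = - br y (br z x) - br z (br x y)"
    using jacobi[of x y z] by (simp add: eq_neg_iff_add_eq_0 algebra_simps)
  also have "br z x = - br x z" by (rule br_swap)
  also have "br z (br x y) = - br (br x y) z" by (rule br_swap)
  finally show ?thesis by (simp add: br_simps)
qed

text \<open>The centroid condition at a single pair. Keeping both equations makes the relation
  symmetric and linear in each argument, so spanning sets suffice.\<close>

definition central_at :: "('l \<Rightarrow> 'l) \<Rightarrow> 'l \<Rightarrow> 'l \<Rightarrow> bool" where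
  "central_at \<Psi> x y \<longleftrightarrow> \<Psi> (br x y) = br x (\<Psi> y) \<and> \<Psi> (br x y) = br (\<Psi> x) y"

context
  fixes \<Psi> assumes lin: "Vector_Spaces.linear sL sL \<Psi>"
begin

interpretation \<Psi>: Vector_Spaces.linear sL sL \<Psi> by (rule lin)

lemma central_at_sym: "central_at \<Psi> x y \<Longrightarrow> central_at \<Psi> y x"
  unfolding central_at_def br_swap[of y x] br_swap[of y "\<Psi> x"] br_swap[of "\<Psi> y" x] \<Psi>.neg
  by metis

lemma subspace_central_at: "subspace {y. central_at \<Psi> x y}"
  by (auto simp: subspace_def central_at_def br_simps \<Psi>.add \<Psi>.scale scale_right_distrib)

lemma central_at_span:
  assumes "\<And>x y. x \<in> M \<Longrightarrow> y \<in> N \<Longrightarrow> central_at \<Psi> x y" "x \<in> span M" "y \<in> span N"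
  shows "central_at \<Psi> x y"
proof -
  have N: "central_at \<Psi> x y" if "x \<in> M" "y \<in> span N" for x y
    using span_minimal[OF _ subspace_central_at, of N x] assms(1) that by blast
  have "M \<subseteq> {x. central_at \<Psi> y x}" using N assms(3) central_at_sym by blast
  then show ?thesis
    using span_minimal[OF _ subspace_central_at, of M y] assms(2) central_at_sym by blast
qed

text \<open>Expand \<open>[[x, y], w]\<close> by Jacobi and push \<Psi> inwards in two ways: onto
  \<open>w\<close> in both terms, or onto \<open>x\<close> in both terms.\<close>

lemma central_at_jacobi:
  assumes "central_at \<Psi> x y" "central_at \<Psi> y w" "central_at \<Psi> x w"
    "central_at \<Psi> x (br y w)" "central_at \<Psi> y (br x w)"
  shows "central_at \<Psi> (br x y) w"
proof -
  have jac: "br (br a b) c = br a (br b c) - br b (br a c)" for a b c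
    using br_derivation[of a b c] by simp
  have "\<Psi> (br (br x y) w) = br x (br y (\<Psi> w)) - br y (br x (\<Psi> w))"
    unfolding jac \<Psi>.diff using assms unfolding central_at_def by metis
  moreover have "\<Psi> (br (br x y) w) = br (\<Psi> x) (br y w) - br y (br (\<Psi> x) w)"
    unfolding jac \<Psi>.diff using assms unfolding central_at_def by metis
  ultimately show ?thesis
    using assms(1) unfolding central_at_def jac[symmetric] by metis
qed

end

lemma centroid_iff: "\<psi> \<in> centroid sL br \<longleftrightarrow> Vector_Spaces.linear sL sL \<psi> \<and> (\<forall>x y. central_at \<psi> x y)"
  by (simp add: centroid_def central_at_def)

end

section \<open>Central symmetric elements of the coordinate algebra\<close>

context BC_coordinate_algebra
begin

sublocale VA: vector_space sA by (rule vector_space_a)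
sublocale VC: vector_space sC by (rule vector_space_c)

lemma mul_add_left: "mul (a + a') b = mul a b + mul a' b"
  and mul_add_right: "mul b (a + a') = mul b a + mul b a'"
  and mul_scale_left: "mul (sA k a) b = sA k (mul a b)"
  and mul_scale_right: "mul b (sA k a) = sA k (mul b a)"
  using mul_bilinear by (simp_all add: bilinear_on_def linear_on_def)

lemma mul_minus_left: "mul (- a) b = - mul a b" and mul_minus_right: "mul b (- a) = - mul b a"
  using mul_scale_left[of "- 1" a b] mul_scale_right[of b "- 1" a] by simp_all

lemma mul_diff_right: "mul b (a - a') = mul b a - mul b a'"
  using mul_add_right[of b a "- a'"] by (simp add: mul_minus_right)

lemma mul_zero [simp]: "mul 0 b = 0" "mul b 0 = 0"
  using mul_scale_left[of 0 0 b] mul_scale_right[of b 0 0] by simp_all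

lemma act_add_right: "act a (c + c') = act a c + act a c'"
  and act_scale_left: "act (sA k a) c = sC k (act a c)"
  and act_scale_right: "act a (sC k c) = sC k (act a c)"
  using act_bilinear by (simp_all add: bilinear_on_def linear_on_def)

lemma act_zero [simp]: "act 0 c = 0" "act a 0 = 0"
  using act_scale_left[of 0 0 c] act_scale_right[of a 0 0] by simp_all

sublocale eta: Vector_Spaces.linear sA sA \<eta> by (rule eta_linear)

lemma eta_unit [simp]: "\<eta> unit = unit"
  using eta_anti[of unit "\<eta> unit"] by (simp add: unit eta_eta)

lemma subspace_sym: "VA.subspace (sym_elems \<eta>)" and subspace_skew: "VA.subspace (skew_elems \<eta>)"
  by (auto simp: VA.subspace_def sym_elems_def skew_elems_def eta.add eta.scale)

lemma unit_sym [simp]: "unit \<in> sym_elems \<eta>"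
  by (simp add: sym_elems_def)

lemma sym_part_in: "sym_part sA \<eta> \<alpha> \<in> sym_elems \<eta>"
  and skew_part_in: "skew_part sA \<eta> \<alpha> \<in> skew_elems \<eta>"
  by (simp_all add: sym_part_def skew_part_def sym_elems_def skew_elems_def eta.add eta.diff eta.scale
      eta_eta add.commute flip: VA.scale_minus_right)

lemma VA_half: "sA (1 / 2) (\<alpha> + \<alpha>) = \<alpha>"
  using VA.scale_left_distrib[of "1 / 2" "1 / 2" \<alpha>] by (simp only: VA.scale_right_distrib) simp

lemma sym_skew_decomp: "sym_part sA \<eta> \<alpha> + skew_part sA \<eta> \<alpha> = \<alpha>"
  using VA_half[of \<alpha>] by (simp add: sym_part_def skew_part_def VA.scale_right_distrib VA.scale_right_diff_distrib)

lemma jordan_in: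
  "a \<in> sym_elems \<eta> \<Longrightarrow> a' \<in> sym_elems \<eta> \<Longrightarrow> sA k (mul a a' + mul a' a) \<in> sym_elems \<eta>"
  "b \<in> skew_elems \<eta> \<Longrightarrow> b' \<in> skew_elems \<eta> \<Longrightarrow> sA k (mul b b' + mul b' b) \<in> sym_elems \<eta>"
  "a \<in> sym_elems \<eta> \<Longrightarrow> b \<in> skew_elems \<eta> \<Longrightarrow> sA k (mul a b + mul b a) \<in> skew_elems \<eta>"
  by (simp_all add: sym_elems_def skew_elems_def eta.scale eta.add eta_anti mul_minus_left mul_minus_right
      add.commute flip: VA.scale_minus_right)

lemma commutator_in:
  "a \<in> sym_elems \<eta> \<Longrightarrow> a' \<in> sym_elems \<eta> \<Longrightarrow> sA k (mul a a' - mul a' a) \<in> skew_elems \<eta>"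
  "b \<in> skew_elems \<eta> \<Longrightarrow> b' \<in> skew_elems \<eta> \<Longrightarrow> sA k (mul b b' - mul b' b) \<in> skew_elems \<eta>"
  "a \<in> sym_elems \<eta> \<Longrightarrow> b \<in> skew_elems \<eta> \<Longrightarrow> sA k (mul a b - mul b a) \<in> sym_elems \<eta>"
  by (simp_all add: sym_elems_def skew_elems_def eta.scale eta.diff eta_anti mul_minus_left mul_minus_right
      flip: VA.scale_minus_right)

lemma centerD:
  assumes "z \<in> algebra_center mul"
  shows "mul z a = mul a z" "mul (mul a b) z = mul a (mul b z)" "mul (mul a z) b = mul a (mul z b)"
    "mul (mul z a) b = mul z (mul a b)"
  using assms by (auto simp: algebra_center_def associator_def)

lemma center_slide:
  assumes "z \<in> algebra_center mul"
  shows "mul (mul z a) b = mul z (mul a b)" "mul a (mul z b) = mul z (mul a b)"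
  using centerD[OF assms] by metis+

lemma center_sym:
  assumes "z \<in> algebra_center mul" "z \<in> sym_elems \<eta>"
  shows "\<eta> (mul z a) = mul z (\<eta> a)"
  using assms centerD(1)[OF assms(1)] by (simp add: eta_anti sym_elems_def)

lemma center_mult_sym:
  assumes "z \<in> algebra_center mul" "z \<in> sym_elems \<eta>"
  shows "a \<in> sym_elems \<eta> \<Longrightarrow> mul z a \<in> sym_elems \<eta>"
    "b \<in> skew_elems \<eta> \<Longrightarrow> mul z b \<in> skew_elems \<eta>"
  using center_sym[OF assms] by (simp_all add: sym_elems_def skew_elems_def mul_minus_right)

lemma act_center:
  assumes "z \<in> algebra_center mul"
  shows "act a (act z c) = act z (act a c)"
  using centerD(1)[OF assms, of a] by (simp flip: act_mul)

text \<open>The hermitian or skew-hermitian symmetry carries linearity over to the second variable;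
  there \<open>z\<close> appears without \<eta> because it is symmetric.\<close>

lemma chi_center:
  assumes z: "z \<in> algebra_center mul" "z \<in> sym_elems \<eta>"
  shows "chi c (act z c') = mul z (chi c c')"
proof -
  have chi_eta: "chi c c' = (if X = Type_C then - \<eta> (chi c' c) else \<eta> (chi c' c))" for c c'
    using chi_hermitian[of c' c] by auto
  show ?thesis
    using chi_eta[of c "act z c'"] chi_eta[of c c']
    by (simp add: chi_linear center_sym[OF z] mul_minus_right split: if_splits)
qed

lemma sym_part_center:
  assumes z: "z \<in> algebra_center mul" "z \<in> sym_elems \<eta>"
  shows "sym_part sA \<eta> (mul z \<alpha>) = mul z (sym_part sA \<eta> \<alpha>)"
    "skew_part sA \<eta> (mul z \<alpha>) = mul z (skew_part sA \<eta> \<alpha>)"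
  by (simp_all add: sym_part_def skew_part_def center_sym[OF z] mul_scale_right mul_add_right mul_diff_right)

end

section \<open>The action of central symmetric elements\<close>

context BC_graded_structure
begin

abbreviation \<gg> where "\<gg> \<equiv> form_algebra form"
abbreviation \<ss> where "\<ss> \<equiv> form_symmetric form"
abbreviation \<A> where "\<A> \<equiv> sym_elems \<eta>"
abbreviation \<B> where "\<B> \<equiv> skew_elems \<eta>"

lemma tA_add_right: "x \<in> \<gg> \<Longrightarrow> a \<in> \<A> \<Longrightarrow> a' \<in> \<A> \<Longrightarrow> tA x (a + a') = tA x a + tA x a'"
  and tA_scale_right: "x \<in> \<gg> \<Longrightarrow> a \<in> \<A> \<Longrightarrow> tA x (sA k a) = sL k (tA x a)"
  and tA_add_left: "x \<in> \<gg> \<Longrightarrow> x' \<in> \<gg> \<Longrightarrow> a \<in> \<A> \<Longrightarrow> tA (x + x') a = tA x a + tA x' a"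
  and tA_scale_left: "x \<in> \<gg> \<Longrightarrow> a \<in> \<A> \<Longrightarrow> tA (mat_scale k x) a = sL k (tA x a)"
  using tensor_A by (auto simp: tensor_map_def bilinear_on_def linear_on_def)

lemma tB_add_right: "s \<in> \<ss> \<Longrightarrow> b \<in> \<B> \<Longrightarrow> b' \<in> \<B> \<Longrightarrow> tB s (b + b') = tB s b + tB s b'"
  and tB_scale_right: "s \<in> \<ss> \<Longrightarrow> b \<in> \<B> \<Longrightarrow> tB s (sA k b) = sL k (tB s b)"
  and tB_add_left: "s \<in> \<ss> \<Longrightarrow> s' \<in> \<ss> \<Longrightarrow> b \<in> \<B> \<Longrightarrow> tB (s + s') b = tB s b + tB s' b"
  and tB_scale_left: "s \<in> \<ss> \<Longrightarrow> b \<in> \<B> \<Longrightarrow> tB (mat_scale k s) b = sL k (tB s b)"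
  using tensor_B by (auto simp: tensor_map_def bilinear_on_def linear_on_def)

lemma tC_add_right: "tC v (c + c') = tC v c + tC v c'"
  and tC_scale_right: "tC v (sC k c) = sL k (tC v c)"
  and tC_add_left: "tC (v + v') c = tC v c + tC v' c"
  and tC_scale_left: "tC (k *s v) c = sL k (tC v c)"
  using tensor_C by (auto simp: tensor_map_def bilinear_on_def linear_on_def)

lemma zero_mem [simp]: "0 \<in> \<gg>" "0 \<in> \<ss>" "0 \<in> \<A>" "0 \<in> \<B>"
  using mat.subspace_0[OF subspace_form_algebra] mat.subspace_0[OF subspace_form_symmetric]
    VA.subspace_0[OF subspace_sym] VA.subspace_0[OF subspace_skew] by auto

lemma tensor_zero [simp]:
  "a \<in> \<A> \<Longrightarrow> tA 0 a = 0" "x \<in> \<gg> \<Longrightarrow> tA x 0 = 0"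
  "b \<in> \<B> \<Longrightarrow> tB 0 b = 0" "s \<in> \<ss> \<Longrightarrow> tB s 0 = 0" "tC 0 c = 0" "tC v 0 = 0"
  using tA_scale_left[of 0 a 0] tA_scale_right[of x 0 0] tB_scale_left[of 0 b 0]
    tB_scale_right[of s 0 0] tC_scale_left[of 0 0 c] tC_scale_right[of v 0 0] by simp_all

text \<open>This is how identities in the coordinate algebra are read off from a single nonzero
  matrix.\<close>

lemma tA_inj:
  assumes "x \<in> \<gg>" "x \<noteq> 0" "a \<in> \<A>" "a' \<in> \<A>" "tA x a = tA x a'"
  shows "a = a'"
proof (rule ccontr)
  assume "a \<noteq> a'"
  moreover have "a - a' \<in> \<A>" using VA.subspace_diff[OF subspace_sym] assms by blast
  ultimately have "tA x (a - a') \<noteq> 0"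
    using tensor_map_nonzero[OF vector_space_mat_scale vector_space_a vector_space_axioms tensor_A, of x] assms by simp
  moreover have "tA x ((a - a') + a') = tA x (a - a') + tA x a'"
    using assms \<open>a - a' \<in> \<A>\<close> by (intro tA_add_right) auto
  ultimately show False using assms(5) by simp
qed

lemma tB_inj:
  assumes "s \<in> \<ss>" "s \<noteq> 0" "b \<in> \<B>" "b' \<in> \<B>" "tB s b = tB s b'"
  shows "b = b'"
proof (rule ccontr)
  assume "b \<noteq> b'"
  moreover have "b - b' \<in> \<B>" using VA.subspace_diff[OF subspace_skew] assms by blast
  ultimately have "tB s (b - b') \<noteq> 0"
    using tensor_map_nonzero[OF vector_space_mat_scale vector_space_a vector_space_axioms tensor_B, of s] assms by simp
  moreover have "tB s ((b - b') + b') = tB s (b - b') + tB s b'"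
    using assms \<open>b - b' \<in> \<B>\<close> by (intro tB_add_right) auto
  ultimately show False using assms(5) by simp
qed

lemma tC_inj:
  assumes "v \<noteq> 0" "tC v c = tC v c'"
  shows "c = c'"
proof (rule ccontr)
  assume "c \<noteq> c'"
  then have "tC v (c - c') \<noteq> 0"
    using tensor_map_nonzero[OF vec.vector_space_axioms vector_space_c vector_space_axioms tensor_C, of v] assms by simp
  moreover have "tC v ((c - c') + c') = tC v (c - c') + tC v c'" by (rule tC_add_right)
  ultimately show False using assms(2) by simp
qed

lemma ang_add_left: "ang (\<beta> + \<beta>'') \<beta>' = ang \<beta> \<beta>' + ang \<beta>'' \<beta>'"
  and ang_add_right: "ang \<beta>' (\<beta> + \<beta>'') = ang \<beta>' \<beta> + ang \<beta>' \<beta>''"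
  and ang_scale_left: "ang (prod_scale sA sC k \<beta>) \<beta>' = sL k (ang \<beta> \<beta>')"
  using ang_bilinear unfolding bilinear_on_def linear_on_def by blast+

text \<open>A, B and C are mutually orthogonal for \<open>ang\<close>, so every statement about D
  reduces to three diagonal cases.\<close>

lemma ang_decomp:
  "ang (\<alpha>, c) (\<alpha>', c') =
     ang (sym_part sA \<eta> \<alpha>, 0) (sym_part sA \<eta> \<alpha>', 0) +
     ang (skew_part sA \<eta> \<alpha>, 0) (skew_part sA \<eta> \<alpha>', 0) + ang (0, c) (0, c')"
proof -
  have split: "(\<alpha>, c) = (sym_part sA \<eta> \<alpha>, 0) + (skew_part sA \<eta> \<alpha>, 0) + (0, c)" for \<alpha> and c :: 'c
    by (simp add: sym_skew_decomp)
  show ?thesis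
    unfolding split[of \<alpha> c] split[of \<alpha>' c'] ang_add_left ang_add_right
    using ang_AB[OF sym_part_in skew_part_in] ang_aC by simp
qed

lemma ang_in [simp]: "ang \<beta> \<beta>' \<in> D"
  unfolding ang_span by (rule span_base) blast

lemma subspace_D: "subspace D"
  unfolding ang_span by (rule subspace_span)

lemma br_unit_D: "x \<in> \<gg> \<Longrightarrow> d \<in> D \<Longrightarrow> br (tA x unit) d = 0"
  using D_trivial by blast

lemma der_in:
  "d \<in> D \<Longrightarrow> a \<in> \<A> \<Longrightarrow> fst (der d (a, 0)) \<in> \<A>"
  "d \<in> D \<Longrightarrow> b \<in> \<B> \<Longrightarrow> fst (der d (b, 0)) \<in> \<B>"
  using der_A der_B by fastforce+

abbreviation TA where "TA \<equiv> tensor_space sL \<gg> \<A> tA"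
abbreviation TB where "TB \<equiv> tensor_space sL \<ss> \<B> tB"
abbreviation TC where "TC \<equiv> tensor_space sL UNIV UNIV tC"

lemma subspace_tensor: "subspace (tensor_space sL X' Y' t)"
  unfolding tensor_space_def by (rule subspace_span)

lemma tensor_mem: "x \<in> X' \<Longrightarrow> y \<in> Y' \<Longrightarrow> t x y \<in> tensor_space sL X' Y' t"
  unfolding tensor_space_def by (rule span_base) blast

text \<open>Pure tensors of the three kinds; their span \<open>M\<close> is the complement of D in
  the decomposition of L.\<close>

definition gens :: "'l set" where
  "gens = {tA x a | x a. x \<in> \<gg> \<and> a \<in> \<A>} \<union> {tB s b | s b. s \<in> \<ss> \<and> b \<in> \<B>} \<union> {tC v c | v c. True}"

abbreviation M where "M \<equiv> span gens"

lemma M_mem [simp]: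
  "x \<in> \<gg> \<Longrightarrow> a \<in> \<A> \<Longrightarrow> tA x a \<in> M" "s \<in> \<ss> \<Longrightarrow> b \<in> \<B> \<Longrightarrow> tB s b \<in> M" "tC v c \<in> M"
  by (rule span_base; auto simp: gens_def)+

lemma gens_cases:
  assumes "z \<in> gens"
  obtains (A) x a where "x \<in> \<gg>" "a \<in> \<A>" "z = tA x a"
    | (B) s b where "s \<in> \<ss>" "b \<in> \<B>" "z = tB s b"
    | (C) v c where "z = tC v c"
  using assms by (auto simp: gens_def)

lemma decomp_ex: "\<exists>p\<in>TA. \<exists>q\<in>TB. \<exists>v\<in>TC. \<exists>d\<in>D. z = p + q + v + d"
  using decomposition[rule_format, of z] by (auto simp: case_prod_unfold)

lemma span_all: "span (gens \<union> {ang \<beta> \<beta>' | \<beta> \<beta>'. True}) = UNIV"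
proof -
  let ?U = "gens \<union> {ang \<beta> \<beta>' | \<beta> \<beta>'. True}"
  have "TA \<subseteq> span ?U" "TB \<subseteq> span ?U" "TC \<subseteq> span ?U" "D \<subseteq> span ?U"
    unfolding tensor_space_def ang_span gens_def by (rule span_mono; blast)+
  then have "z \<in> span ?U" for z
    using decomp_ex[of z] by (auto intro!: span_add)
  then show ?thesis by blast
qed

definition action :: "'a \<Rightarrow> ('l \<Rightarrow> 'l) \<Rightarrow> bool" where
  "action \<zz> \<Psi> \<longleftrightarrow> given_by form mul \<eta> act tA tB tC ang \<zz> \<Psi>"

lemma actionD:
  assumes "action \<zz> \<Psi>"
  shows "x \<in> \<gg> \<Longrightarrow> a \<in> \<A> \<Longrightarrow> \<Psi> (tA x a) = tA x (mul \<zz> a)"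
    "s \<in> \<ss> \<Longrightarrow> b \<in> \<B> \<Longrightarrow> \<Psi> (tB s b) = tB s (mul \<zz> b)"
    "\<Psi> (tC v c) = tC v (act \<zz> c)"
    "\<Psi> (ang (\<alpha>, c) (\<alpha>', c')) = ang (mul \<zz> \<alpha>, act \<zz> c) (\<alpha>', c')"
    "\<Psi> (ang (\<alpha>, c) (\<alpha>', c')) = ang (\<alpha>, c) (mul \<zz> \<alpha>', act \<zz> c')"
proof -
  have "\<Psi> (ang \<beta> \<beta>') = ang (a_smult mul act \<zz> \<beta>) \<beta>'" "\<Psi> (ang \<beta> \<beta>') = ang \<beta> (a_smult mul act \<zz> \<beta>')" for \<beta> \<beta>'
    using assms unfolding action_def given_by_def by blast+
  from this[of "(\<alpha>, c)" "(\<alpha>', c')"]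
  show "\<Psi> (ang (\<alpha>, c) (\<alpha>', c')) = ang (mul \<zz> \<alpha>, act \<zz> c) (\<alpha>', c')"
    "\<Psi> (ang (\<alpha>, c) (\<alpha>', c')) = ang (\<alpha>, c) (mul \<zz> \<alpha>', act \<zz> c')"
    by (simp_all add: a_smult_def)
qed (use assms in \<open>auto simp: action_def given_by_def\<close>)

lemma action_unique:
  assumes "Vector_Spaces.linear sL sL \<Psi>" "Vector_Spaces.linear sL sL \<Psi>'" "action \<zz> \<Psi>" "action \<zz> \<Psi>'"
  shows "\<Psi> = \<Psi>'"
proof
  interpret LL: vector_space_pair sL sL by unfold_locales
  fix z
  have "z \<in> span (gens \<union> {ang \<beta> \<beta>' | \<beta> \<beta>'. True})" unfolding span_all by simp
  then show "\<Psi> z = \<Psi>' z"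
  proof (rule LL.linear_eq_on[OF assms(1,2)])
    fix y assume "y \<in> gens \<union> {ang \<beta> \<beta>' | \<beta> \<beta>'. True}"
    then show "\<Psi> y = \<Psi>' y"
      using actionD[OF assms(3)] actionD[OF assms(4)] by (auto simp: gens_def)
  qed
qed

lemma frak_ZD:
  assumes "\<zz> \<in> frak_Z mul \<eta> act ang"
  shows "\<zz> \<in> algebra_center mul" "\<zz> \<in> \<A>"
    "ang (a_smult mul act \<zz> \<beta>) \<beta>' = ang \<beta> (a_smult mul act \<zz> \<beta>')"
    "(\<Sum>t<(N :: nat). ang (\<gamma>1 t) (\<gamma>2 t)) = 0 \<Longrightarrow> (\<Sum>t<N. ang (a_smult mul act \<zz> (\<gamma>1 t)) (\<gamma>2 t)) = 0"
  using assms unfolding frak_Z_def by blast+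

text \<open>Three lifts of the form \<open>id \<otimes> g\<close> and one map on D, provided by
  condition (b), are glued along the direct sum. Condition (a) gives the second formula on
  D.\<close>

lemma action_exists:
  assumes \<zz>: "\<zz> \<in> frak_Z mul \<eta> act ang"
  obtains \<Psi> where "Vector_Spaces.linear sL sL \<Psi>" "action \<zz> \<Psi>"
proof -
  note c = frak_ZD(1,2)[OF \<zz>]
  have L: "vector_space sL" by (rule vector_space_axioms)
  obtain G1 where G1: "Vector_Spaces.linear sL sL G1"
    "\<And>x a. x \<in> \<gg> \<Longrightarrow> a \<in> \<A> \<Longrightarrow> G1 (tA x a) = tA x (mul \<zz> a)"
    by (rule tensor_map_lift[OF vector_space_mat_scale vector_space_a L subspace_form_algebra subspace_sym tensor_A, of "mul \<zz>"])
      (auto simp: linear_on_def mul_add_right mul_scale_right center_mult_sym[OF c])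
  obtain G2 where G2: "Vector_Spaces.linear sL sL G2"
    "\<And>s b. s \<in> \<ss> \<Longrightarrow> b \<in> \<B> \<Longrightarrow> G2 (tB s b) = tB s (mul \<zz> b)"
    by (rule tensor_map_lift[OF vector_space_mat_scale vector_space_a L subspace_form_symmetric subspace_skew tensor_B, of "mul \<zz>"])
      (auto simp: linear_on_def mul_add_right mul_scale_right center_mult_sym[OF c])
  obtain G3 where G3: "Vector_Spaces.linear sL sL G3" "\<And>v c. G3 (tC v c) = tC v (act \<zz> c)"
    by (rule tensor_map_lift[OF vec.vector_space_axioms vector_space_c L vec.subspace_UNIV VC.subspace_UNIV tensor_C, of "act \<zz>"])
      (auto simp: linear_on_def act_add_right act_scale_right)
  obtain G4 where G4: "Vector_Spaces.linear sL sL G4"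
    "\<And>i. G4 (ang (fst i) (snd i)) = ang (a_smult mul act \<zz> (fst i)) (snd i)"
  proof (rule linear_family_lift[OF L L, of "\<lambda>i. ang (fst i) (snd i)"
        "\<lambda>i. ang (a_smult mul act \<zz> (fst i)) (snd i)"])
    fix F :: "(('a \<times> 'c) \<times> ('a \<times> 'c)) set" and k
    assume F: "finite F" and 0: "(\<Sum>i\<in>F. sL (k i) (ang (fst i) (snd i))) = 0"
    \<comment> \<open>Condition (b) speaks of sums over \<open>t < N\<close> without coefficients,
      so \<open>F\<close> is enumerated and the scalars are absorbed into the first arguments of
      \<open>ang\<close>.\<close>
    obtain h where h: "bij_betw h {0..<card F} F" using ex_bij_betw_nat_finite[OF F] by blast
    have re: "(\<Sum>i\<in>F. g i) = (\<Sum>t<card F. g (h t))" for g :: "_ \<Rightarrow> 'l"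
      using sum.reindex_bij_betw[OF h, of g] by (simp add: atLeast0LessThan)
    have sc: "a_smult mul act \<zz> (prod_scale sA sC l \<beta>) = prod_scale sA sC l (a_smult mul act \<zz> \<beta>)" for l \<beta>
      by (simp add: a_smult_def prod_scale_def mul_scale_right act_scale_right)
    have "(\<Sum>t<card F. ang (prod_scale sA sC (k (h t)) (fst (h t))) (snd (h t))) = 0"
      using 0 unfolding re by (simp add: ang_scale_left)
    from frak_ZD(4)[OF \<zz> this]
    show "(\<Sum>i\<in>F. sL (k i) (ang (a_smult mul act \<zz> (fst i)) (snd i))) = 0"
      unfolding re by (simp add: ang_scale_left sc)
  qed blast
  obtain \<Psi> where \<Psi>: "Vector_Spaces.linear sL sL \<Psi>" "\<And>p. p \<in> TA \<Longrightarrow> \<Psi> p = G1 p"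
    "\<And>q. q \<in> TB \<Longrightarrow> \<Psi> q = G2 q" "\<And>v. v \<in> TC \<Longrightarrow> \<Psi> v = G3 v" "\<And>d. d \<in> D \<Longrightarrow> \<Psi> d = G4 d"
    using direct_sum4_lift[OF L subspace_tensor subspace_tensor subspace_tensor subspace_D decomposition
        G1(1) G2(1) G3(1) G4(1)] by blast
  have "x \<in> \<gg> \<Longrightarrow> a \<in> \<A> \<Longrightarrow> tA x a \<in> TA" "s \<in> \<ss> \<Longrightarrow> b \<in> \<B> \<Longrightarrow> tB s b \<in> TB" "tC v c \<in> TC"
    for x a s b v c by (rule tensor_mem; simp)+
  then have "action \<zz> \<Psi>"
    unfolding action_def given_by_def
    using \<Psi> G1(2) G2(2) G3(2) G4(2)[of "(_, _)"] frak_ZD(3)[OF \<zz>, symmetric] ang_in by simp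
  with \<Psi>(1) that show thesis by blast
qed

section \<open>The action of a central symmetric element lies in the centroid\<close>

context
  fixes \<zz> \<Psi>
  assumes \<zz>: "\<zz> \<in> algebra_center mul" "\<zz> \<in> \<A>"
    and lin: "Vector_Spaces.linear sL sL \<Psi>" and action: "action \<zz> \<Psi>"
begin

interpretation \<Psi>: Vector_Spaces.linear sL sL \<Psi> by (rule lin)

lemmas \<Psi>_simps = \<Psi>.add \<Psi>.scale actionD(1-3)[OF action]
lemmas \<zz>_simps = mul_scale_right mul_add_right mul_diff_right center_slide[OF \<zz>(1)]
lemmas mem = comm_skew_skew comm_skew_sym comm_sym_sym circ_skew_skew circ_skew_sym circ_sym_sym
  jordan_in commutator_in center_mult_sym[OF \<zz>] sym_part_in skew_part_in gamma_range sigma_range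

lemma central_AA:
  assumes "x \<in> \<gg>" "a \<in> \<A>" "y \<in> \<gg>" "a' \<in> \<A>"
  shows "central_at \<Psi> (tA x a) (tA y a')"
  using assms actionD(4,5)[OF action, of a 0 a' 0]
  by (simp add: central_at_def br_AA \<Psi>_simps mem \<zz>_simps)

lemma central_AB:
  assumes "x \<in> \<gg>" "a \<in> \<A>" "s \<in> \<ss>" "b \<in> \<B>"
  shows "central_at \<Psi> (tA x a) (tB s b)"
  using assms by (simp add: central_at_def br_AB \<Psi>_simps mem \<zz>_simps)

lemma central_BB:
  assumes "s \<in> \<ss>" "b \<in> \<B>" "t \<in> \<ss>" "b' \<in> \<B>"
  shows "central_at \<Psi> (tB s b) (tB t b')"
  using assms actionD(4,5)[OF action, of b 0 b' 0]
  by (simp add: central_at_def br_BB \<Psi>_simps mem \<zz>_simps)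

lemma central_AC: "x \<in> \<gg> \<Longrightarrow> a \<in> \<A> \<Longrightarrow> central_at \<Psi> (tA x a) (tC v c)"
  by (simp add: central_at_def br_AC \<Psi>_simps mem act_mul act_center[OF \<zz>(1)])

lemma central_BC: "s \<in> \<ss> \<Longrightarrow> b \<in> \<B> \<Longrightarrow> central_at \<Psi> (tB s b) (tC v c)"
  by (simp add: central_at_def br_BC \<Psi>_simps mem act_mul act_center[OF \<zz>(1)])

lemma central_CC: "central_at \<Psi> (tC u c) (tC v c')"
  using actionD(4,5)[OF action, of 0 c 0 c']
  by (simp add: central_at_def br_CC \<Psi>_simps mem chi_linear chi_center[OF \<zz>] sym_part_center[OF \<zz>])

lemma central_M:
  assumes "m \<in> M" "m' \<in> M"
  shows "central_at \<Psi> m m'"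
proof (rule central_at_span[OF lin _ assms])
  note c = central_AA central_AB central_BB central_AC central_BC central_CC
  show "central_at \<Psi> x y" if "x \<in> gens" "y \<in> gens" for x y
    by (rule gens_cases[OF that(1)]; rule gens_cases[OF that(2)])
      (simp_all add: c c[THEN central_at_sym[OF lin]])
qed

text \<open>An element \<open>d\<close> of \<open>D\<close> is reached as the \<open>D\<close>-component of a bracket \<open>[x, y]\<close>.  The Jacobi
  identity moves the problem away from \<open>D\<close> as soon as \<open>[x, w]\<close> and \<open>[y, w]\<close> have no
  \<open>D\<close>-component.\<close>

lemma central_step:
  assumes w: "\<And>m. m \<in> M \<Longrightarrow> central_at \<Psi> m w"
    and M: "x \<in> M" "y \<in> M" "m \<in> M" "br x w \<in> M" "br y w \<in> M"
    and d: "br x y = m + sL k d" "k \<noteq> 0"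
  shows "central_at \<Psi> d w"
proof -
  have "central_at \<Psi> (br x y) w"
    using M w central_M by (intro central_at_jacobi[OF lin]) auto
  then have "br x y - m \<in> {u. central_at \<Psi> w u}"
    using w[OF M(3)] by (intro subspace_diff[OF subspace_central_at[OF lin]]) (auto intro: central_at_sym[OF lin])
  then have "sL (1 / k) (br x y - m) \<in> {u. central_at \<Psi> w u}"
    by (rule subspace_scale[OF subspace_central_at[OF lin]])
  then show ?thesis using d by (auto intro: central_at_sym[OF lin])
qed

text \<open>Brackets of generators of different kinds, and of generators with D, have no
  D-component. These are the side conditions of \<open>central_step\<close>.\<close>

lemma br_M [simp]:
  "x \<in> \<gg> \<Longrightarrow> a \<in> \<A> \<Longrightarrow> s \<in> \<ss> \<Longrightarrow> b \<in> \<B> \<Longrightarrow> br (tA x a) (tB s b) \<in> M"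
  "x \<in> \<gg> \<Longrightarrow> a \<in> \<A> \<Longrightarrow> s \<in> \<ss> \<Longrightarrow> b \<in> \<B> \<Longrightarrow> br (tB s b) (tA x a) \<in> M"
  "x \<in> \<gg> \<Longrightarrow> a \<in> \<A> \<Longrightarrow> br (tA x a) (tC v c) \<in> M"
  "x \<in> \<gg> \<Longrightarrow> a \<in> \<A> \<Longrightarrow> br (tC v c) (tA x a) \<in> M"
  "s \<in> \<ss> \<Longrightarrow> b \<in> \<B> \<Longrightarrow> br (tB s b) (tC v c) \<in> M"
  "s \<in> \<ss> \<Longrightarrow> b \<in> \<B> \<Longrightarrow> br (tC v c) (tB s b) \<in> M"
  "d \<in> D \<Longrightarrow> x \<in> \<gg> \<Longrightarrow> a \<in> \<A> \<Longrightarrow> br (tA x a) d \<in> M"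
  "d \<in> D \<Longrightarrow> s \<in> \<ss> \<Longrightarrow> b \<in> \<B> \<Longrightarrow> br (tB s b) d \<in> M"
  "d \<in> D \<Longrightarrow> br (tC v c) d \<in> M"
proof -
  have sw: "br y x \<in> M \<Longrightarrow> br x y \<in> M" for x y
    using span_neg br_swap[of x y] by metis
  show 1: "x \<in> \<gg> \<Longrightarrow> a \<in> \<A> \<Longrightarrow> s \<in> \<ss> \<Longrightarrow> b \<in> \<B> \<Longrightarrow> br (tA x a) (tB s b) \<in> M"
    by (simp add: br_AB span_add mem)
  then show "x \<in> \<gg> \<Longrightarrow> a \<in> \<A> \<Longrightarrow> s \<in> \<ss> \<Longrightarrow> b \<in> \<B> \<Longrightarrow> br (tB s b) (tA x a) \<in> M" by (rule sw)
  show "x \<in> \<gg> \<Longrightarrow> a \<in> \<A> \<Longrightarrow> br (tA x a) (tC v c) \<in> M" by (simp add: br_AC)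
  then show "x \<in> \<gg> \<Longrightarrow> a \<in> \<A> \<Longrightarrow> br (tC v c) (tA x a) \<in> M" by (rule sw)
  show "s \<in> \<ss> \<Longrightarrow> b \<in> \<B> \<Longrightarrow> br (tB s b) (tC v c) \<in> M" by (simp add: br_BC)
  then show "s \<in> \<ss> \<Longrightarrow> b \<in> \<B> \<Longrightarrow> br (tC v c) (tB s b) \<in> M" by (rule sw)
  show "d \<in> D \<Longrightarrow> x \<in> \<gg> \<Longrightarrow> a \<in> \<A> \<Longrightarrow> br (tA x a) d \<in> M"
    by (rule sw) (simp add: br_DA der_in)
  show "d \<in> D \<Longrightarrow> s \<in> \<ss> \<Longrightarrow> b \<in> \<B> \<Longrightarrow> br (tB s b) d \<in> M"
    by (rule sw) (simp add: br_DB der_in)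
  show "d \<in> D \<Longrightarrow> br (tC v c) d \<in> M"
    by (rule sw) (simp add: br_DC)
qed

lemma \<Psi>_D: "d \<in> D \<Longrightarrow> \<Psi> d \<in> D"
proof -
  have "subspace {d. \<Psi> d \<in> D}"
    using subspace_D by (auto simp: subspace_def \<Psi>.add \<Psi>.scale)
  moreover have "{ang \<beta> \<beta>' | \<beta> \<beta>'. True} \<subseteq> {d. \<Psi> d \<in> D}"
    using actionD(4)[OF action] by auto
  ultimately show "d \<in> D \<Longrightarrow> \<Psi> d \<in> D"
    using span_minimal ang_span by blast
qed

text \<open>As \<open>d\<close> acts on the second factor only, the condition at \<open>d\<close>
  and \<open>w \<otimes> a\<close> amounts to two equations in the coordinates that do not involve
  \<open>w\<close>. A nonzero \<open>w0\<close> yields them by injectivity, and they then serve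
  every \<open>w\<close>.\<close>

lemma central_D_transfer:
  assumes d: "d \<in> D"
  shows "central_at \<Psi> d (tA w0 a) \<Longrightarrow> w0 \<in> \<gg> \<Longrightarrow> w0 \<noteq> 0 \<Longrightarrow> a \<in> \<A> \<Longrightarrow> w \<in> \<gg> \<Longrightarrow> central_at \<Psi> d (tA w a)"
    and "central_at \<Psi> d (tB s0 b) \<Longrightarrow> s0 \<in> \<ss> \<Longrightarrow> s0 \<noteq> 0 \<Longrightarrow> b \<in> \<B> \<Longrightarrow> s \<in> \<ss> \<Longrightarrow> central_at \<Psi> d (tB s b)"
    and "central_at \<Psi> d (tC v0 c) \<Longrightarrow> v0 \<noteq> 0 \<Longrightarrow> central_at \<Psi> d (tC v c)"
proof -
  note d' = d \<Psi>_D[OF d]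
  assume A: "central_at \<Psi> d (tA w0 a)" "w0 \<in> \<gg>" "w0 \<noteq> 0" "a \<in> \<A>" "w \<in> \<gg>"
  then have "mul \<zz> (fst (der d (a, 0))) = fst (der d (mul \<zz> a, 0))"
    "mul \<zz> (fst (der d (a, 0))) = fst (der (\<Psi> d) (a, 0))"
    using d' by (auto simp: central_at_def br_DA \<Psi>_simps mem der_in intro!: tA_inj[of w0])
  then show "central_at \<Psi> d (tA w a)"
    using d' A by (auto simp: central_at_def br_DA \<Psi>_simps mem der_in)
next
  note d' = d \<Psi>_D[OF d]
  assume B: "central_at \<Psi> d (tB s0 b)" "s0 \<in> \<ss>" "s0 \<noteq> 0" "b \<in> \<B>" "s \<in> \<ss>"
  then have "mul \<zz> (fst (der d (b, 0))) = fst (der d (mul \<zz> b, 0))"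
    "mul \<zz> (fst (der d (b, 0))) = fst (der (\<Psi> d) (b, 0))"
    using d' by (auto simp: central_at_def br_DB \<Psi>_simps mem der_in intro!: tB_inj[of s0])
  then show "central_at \<Psi> d (tB s b)"
    using d' B by (auto simp: central_at_def br_DB \<Psi>_simps mem der_in)
next
  note d' = d \<Psi>_D[OF d]
  assume C: "central_at \<Psi> d (tC v0 c)" "v0 \<noteq> 0"
  then have "act \<zz> (snd (der d (0, c))) = snd (der d (0, act \<zz> c))"
    "act \<zz> (snd (der d (0, c))) = snd (der (\<Psi> d) (0, c))"
    using d' by (auto simp: central_at_def br_DC \<Psi>_simps intro!: tC_inj[of v0])
  then show "central_at \<Psi> d (tC v c)"
    using d' C by (auto simp: central_at_def br_DC \<Psi>_simps)
qed

text \<open>The element is the D-component of \<open>[x \<otimes> a, x \<otimes> a']\<close> up to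
  \<open>tr(xx)\<close>. Only test elements from \<gg> \<otimes> A could reproduce a D-component;
  there \<open>w0\<close>, orthogonal to \<open>x\<close>, is used first and the result is
  transferred.\<close>

lemma central_ang_A:
  assumes a: "a \<in> \<A>" "a' \<in> \<A>"
  shows "w \<in> gens \<Longrightarrow> central_at \<Psi> (ang (a, 0) (a', 0)) w"
    and "w \<in> D \<Longrightarrow> (\<And>m. m \<in> M \<Longrightarrow> central_at \<Psi> m w) \<Longrightarrow> central_at \<Psi> (ang (a, 0) (a', 0)) w"
proof -
  obtain x w0 where x: "x \<in> \<gg>" "w0 \<in> \<gg>" "w0 \<noteq> 0" "trace (x ** x) \<noteq> 0" "trace (x ** w0) = 0"
    using ex_skew_witness[OF rank] by metis
  have step: "central_at \<Psi> (ang (a, 0) (a', 0)) w"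
    if "\<And>m. m \<in> M \<Longrightarrow> central_at \<Psi> m w" "br (tA x a) w \<in> M" "br (tA x a') w \<in> M" for w
    by (rule central_step[OF that(1) _ _ _ that(2,3) br_AA])
      (use x a in \<open>simp_all add: span_add mem\<close>)
  show "w \<in> D \<Longrightarrow> (\<And>m. m \<in> M \<Longrightarrow> central_at \<Psi> m w) \<Longrightarrow> central_at \<Psi> (ang (a, 0) (a', 0)) w"
    using a x by (intro step) auto
  assume "w \<in> gens"
  then show "central_at \<Psi> (ang (a, 0) (a', 0)) w"
  proof (cases rule: gens_cases)
    case (A y a'')
    have "central_at \<Psi> (ang (a, 0) (a', 0)) (tA w0 a'')"
      using x a A by (intro step central_M) (auto simp: br_AA span_add mem)
    then show ?thesis using A x central_D_transfer(1)[OF ang_in] by blast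
  qed (simp, rule step; use a x in \<open>simp add: central_M\<close>)+
qed

lemma central_ang_B:
  assumes b: "b \<in> \<B>" "b' \<in> \<B>"
  shows "w \<in> gens \<Longrightarrow> central_at \<Psi> (ang (b, 0) (b', 0)) w"
    and "w \<in> D \<Longrightarrow> (\<And>m. m \<in> M \<Longrightarrow> central_at \<Psi> m w) \<Longrightarrow> central_at \<Psi> (ang (b, 0) (b', 0)) w"
proof -
  obtain s w0 where s: "s \<in> \<ss>" "w0 \<in> \<ss>" "w0 \<noteq> 0" "trace (s ** s) \<noteq> 0" "trace (s ** w0) = 0"
    using ex_sym_witness[OF rank] by metis
  have step: "central_at \<Psi> (ang (b, 0) (b', 0)) w"
    if "\<And>m. m \<in> M \<Longrightarrow> central_at \<Psi> m w" "br (tB s b) w \<in> M" "br (tB s b') w \<in> M" for w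
    by (rule central_step[OF that(1) _ _ _ that(2,3) br_BB])
      (use s b in \<open>simp_all add: span_add mem\<close>)
  show "w \<in> D \<Longrightarrow> (\<And>m. m \<in> M \<Longrightarrow> central_at \<Psi> m w) \<Longrightarrow> central_at \<Psi> (ang (b, 0) (b', 0)) w"
    using b s by (intro step) auto
  assume "w \<in> gens"
  then show "central_at \<Psi> (ang (b, 0) (b', 0)) w"
  proof (cases rule: gens_cases)
    case (B t b'')
    have "central_at \<Psi> (ang (b, 0) (b', 0)) (tB w0 b'')"
      using s b B by (intro step central_M) (auto simp: br_BB span_add mem)
    then show ?thesis using B s central_D_transfer(2)[OF ang_in] by blast
  qed (simp, rule step; use b s in \<open>simp add: central_M\<close>)+
qed

text \<open>The vectors \<open>e 0\<close> and \<open>f 0\<close> pair to 1, and \<open>e 1\<close>,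
  orthogonal to both, takes the part of the trace-orthogonal test matrix.\<close>

lemma central_ang_C:
  shows "w \<in> gens \<Longrightarrow> central_at \<Psi> (ang (0, c) (0, c')) w"
    and "w \<in> D \<Longrightarrow> (\<And>m. m \<in> M \<Longrightarrow> central_at \<Psi> m w) \<Longrightarrow> central_at \<Psi> (ang (0, c) (0, c')) w"
proof -
  have r: "0 < r" "Suc 0 < r" using rank by auto
  have step: "central_at \<Psi> (ang (0, c) (0, c')) w"
    if "\<And>m. m \<in> M \<Longrightarrow> central_at \<Psi> m w" "br (tC (e 0) c) w \<in> M" "br (tC (f 0) c') w \<in> M" for w
    by (rule central_step[OF that(1) _ _ _ that(2,3) br_CC])
      (use r in \<open>simp_all add: span_add mem form_hyperbolic\<close>)
  show "w \<in> D \<Longrightarrow> (\<And>m. m \<in> M \<Longrightarrow> central_at \<Psi> m w) \<Longrightarrow> central_at \<Psi> (ang (0, c) (0, c')) w"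
    by (intro step) auto
  assume "w \<in> gens"
  then show "central_at \<Psi> (ang (0, c) (0, c')) w"
  proof (cases rule: gens_cases)
    case (C v c'')
    have "central_at \<Psi> (ang (0, c) (0, c')) (tC (e 1) c'')"
      using r by (intro step central_M) (auto simp: br_CC span_add mem form_hyperbolic)
    then show ?thesis using C r hyperbolic_nonzero(1)[of 1] central_D_transfer(3)[OF ang_in] by auto
  qed (simp, rule step; simp add: central_M)+
qed

lemma central_ang:
  assumes "\<And>a a'. a \<in> \<A> \<Longrightarrow> a' \<in> \<A> \<Longrightarrow> central_at \<Psi> (ang (a, 0) (a', 0)) w"
    "\<And>b b'. b \<in> \<B> \<Longrightarrow> b' \<in> \<B> \<Longrightarrow> central_at \<Psi> (ang (b, 0) (b', 0)) w"
    "\<And>c c'. central_at \<Psi> (ang (0, c) (0, c')) w" "d \<in> D"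
  shows "central_at \<Psi> d w"
proof -
  have sub: "subspace {d. central_at \<Psi> w d}" by (rule subspace_central_at[OF lin])
  have "ang (\<alpha>, c) (\<alpha>', c') \<in> {d. central_at \<Psi> w d}" for \<alpha> c \<alpha>' c'
    unfolding ang_decomp[of \<alpha> c]
    using assms(1-3) sym_part_in skew_part_in
    by (intro subspace_add[OF sub]) (auto intro: central_at_sym[OF lin])
  then have "{ang \<beta> \<beta>' | \<beta> \<beta>'. True} \<subseteq> {d. central_at \<Psi> w d}" by auto
  then have "D \<subseteq> {d. central_at \<Psi> w d}"
    unfolding ang_span by (rule span_minimal[OF _ sub])
  then show ?thesis using assms(4) central_at_sym[OF lin] by blast
qed

theorem action_in_centroid: "\<Psi> \<in> centroid sL br"
proof -
  have DG: "central_at \<Psi> d w" if "d \<in> D" "w \<in> gens" for d w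
    using central_ang[OF central_ang_A(1) central_ang_B(1) central_ang_C(1) that(1)] that(2) by blast
  have MD: "central_at \<Psi> m d" if "d \<in> D" "m \<in> M" for d m
    using central_at_span[OF lin, of "{d}" gens d m] DG that span_base[of d "{d}"] central_at_sym[OF lin]
    by blast
  \<comment> \<open>The step for two elements of D needs the second to be compatible with all of
    \<open>M\<close>, hence comes after \<open>MD\<close>.\<close>
  have DD: "central_at \<Psi> d w" if "d \<in> D" "w \<in> D" for d w
    by (rule central_ang[OF _ _ _ that(1)])
      (use that(2) MD in \<open>blast intro: central_ang_A(2) central_ang_B(2) central_ang_C(2)\<close>)+
  let ?U = "gens \<union> {ang \<beta> \<beta>' | \<beta> \<beta>'. True}"
  have "central_at \<Psi> x y" if "x \<in> ?U" "y \<in> ?U" for x y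
    using that DG DD central_M[OF span_base span_base] central_at_sym[OF lin] ang_in by blast
  then have "central_at \<Psi> x y" for x y
    using central_at_span[OF lin, of ?U ?U] unfolding span_all by blast
  then show ?thesis by (simp add: centroid_iff lin)
qed

end

end

section \<open>Elements of the centroid\<close>

context BC_graded_structure
begin

text \<open>Apply \<open>ad(w \<otimes> 1)\<close> to \<open>[x \<otimes> 1, y \<otimes> a]\<close>
  and compare D-components: it kills D, and by invariance the two trace terms on the other side
  cancel, leaving \<open>tr(w[x, y]) \<langle>1, a\<rangle> = 0\<close>.\<close>

lemma ang_unit:
  assumes a: "a \<in> \<A>"
  shows "ang (unit, 0) (a, 0) = 0"
proof -
  let ?d = "ang (unit, 0) (a, 0)"
  obtain w x y where w: "w \<in> \<gg>" "x \<in> \<gg>" "y \<in> \<gg>" "trace (w ** comm x y) \<noteq> 0"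
    using ex_triple_witness[OF rank] by metis
  have br1: "br (tA x unit) (tA y a) = tA (comm x y) a + sL (trace (x ** y)) ?d"
    if "x \<in> \<gg>" "y \<in> \<gg>" for x y
    using br_AA[OF that unit_sym a] circ_skew_skew[OF that] by (simp only: unit VA_half) simp
  have "br (tA w unit) (br (tA x unit) (tA y a)) =
      br (tA (comm w x) unit) (tA y a) + br (tA x unit) (br (tA w unit) (tA y a))"
    unfolding emb_hom[OF w(1,2)] by (rule br_derivation)
  then have "tA (comm w (comm x y)) a + sL (trace (w ** comm x y)) ?d =
      (tA (comm (comm w x) y) a + sL (trace (comm w x ** y)) ?d) +
      (tA (comm x (comm w y)) a + sL (trace (x ** comm w y)) ?d)"
    using w a by (simp add: br1 br_add_right br_scale_right br_unit_D comm_skew_skew)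
  moreover have "tA (comm w (comm x y)) a = tA (comm (comm w x) y) a + tA (comm x (comm w y)) a"
    using w a by (simp add: comm_jacobi[of w x y] tA_add_left comm_skew_skew)
  moreover have "sL (trace (comm w x ** y)) ?d + sL (trace (x ** comm w y)) ?d = 0"
    by (simp add: trace_comm_shift[of x w y])
  ultimately have "sL (trace (w ** comm x y)) ?d = 0" by (simp add: algebra_simps)
  then show ?thesis using w(4) by simp
qed

lemma br_unit_A: "x \<in> \<gg> \<Longrightarrow> y \<in> \<gg> \<Longrightarrow> a \<in> \<A> \<Longrightarrow> br (tA x unit) (tA y a) = tA (comm x y) a"
  using br_AA[of x y unit a] circ_skew_skew[of x y] by (simp only: unit_sym unit VA_half) (simp add: ang_unit)

lemma br_unit_B: "x \<in> \<gg> \<Longrightarrow> s \<in> \<ss> \<Longrightarrow> b \<in> \<B> \<Longrightarrow> br (tA x unit) (tB s b) = tB (comm x s) b"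
  using br_AB[of x s unit b] circ_skew_sym[of x s] by (simp only: unit_sym unit VA_half) simp

lemma br_unit_C: "x \<in> \<gg> \<Longrightarrow> br (tA x unit) (tC u c) = tC (x *v u) c"
  by (simp add: br_AC act_unit)

abbreviation ad2 :: "'l \<Rightarrow> 'l" where
  "ad2 z \<equiv> br (tA root unit) (br (tA root unit) z)"

lemma ad2_range_C:
  assumes sg: "sg = - 1"
  shows "\<exists>a\<in>\<A>. ad2 z = tA root a"
proof -
  define W where "W = {tA root a | a. a \<in> \<A>}"
  have W: "subspace W"
    unfolding subspace_def W_def
    using tensor_zero(2)[OF root_in] tA_add_right[OF root_in, symmetric] tA_scale_right[OF root_in, symmetric]
      VA.subspace_add[OF subspace_sym] VA.subspace_scale[OF subspace_sym] zero_mem(3)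
    by (auto simp del: tensor_zero)
  have sub: "subspace {z. ad2 z \<in> W}"
    using W by (auto simp: subspace_def br_simps)
  have "y \<in> {z. ad2 z \<in> W}" if "y \<in> gens" for y
    using that
  proof (cases rule: gens_cases)
    case (A x a)
    obtain k where "comm root (comm root x) = mat_scale k root"
      using comm_comm_root_skew[OF rank A(1)] by blast
    then have "ad2 y = tA root (sA k a)"
      using A root_in by (simp add: br_unit_A comm_skew_skew tA_scale_left tA_scale_right)
    then show ?thesis using A VA.subspace_scale[OF subspace_sym] by (auto simp: W_def)
  next
    case (B s b)
    then have "ad2 y = 0"
      using comm_comm_root_sym_C[OF rank sg B(1)] root_in by (simp add: br_unit_B comm_skew_sym)
    then show ?thesis using subspace_0[OF W] by simp
  next
    case (C v c)
    then have "ad2 y = 0" using root_in by (simp add: br_unit_C root_square[OF rank])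
    then show ?thesis using subspace_0[OF W] by simp
  qed
  moreover have "ang \<beta> \<beta>' \<in> {z. ad2 z \<in> W}" for \<beta> \<beta>'
    using subspace_0[OF W] by (simp add: br_unit_D root_in)
  ultimately have "span (gens \<union> {ang \<beta> \<beta>' | \<beta> \<beta>'. True}) \<subseteq> {z. ad2 z \<in> W}"
    by (intro span_minimal[OF _ sub]) blast
  then show ?thesis unfolding span_all by (auto simp: W_def)
qed

abbreviation ee :: "nat \<Rightarrow> nat \<Rightarrow> 'f^'n^'n" where
  "ee i j \<equiv> sym_dyad (e i) (e j)"

lemma ee_in: "i < r \<Longrightarrow> j < r \<Longrightarrow> ee i j \<in> \<ss>"
  by (simp add: form_symmetric_def form_sym_dyad trace_sym_dyad form_hyperbolic)

lemma ad2_range_BD: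
  assumes sg: "sg = 1"
  shows "\<exists>a\<in>\<A>. \<exists>b\<in>\<B>. \<exists>b'\<in>\<B>. \<exists>b''\<in>\<B>.
    ad2 z = tA root a + tB (ee 0 0) b + tB (ee 0 1) b' + tB (ee 1 1) b''"
proof -
  have r: "0 < r" "1 < r" using rank by auto
  note ee = ee_in[OF r(1) r(1)] ee_in[OF r] ee_in[OF r(2) r(2)]
  define t where "t a b b' b'' = tA root a + tB (ee 0 0) b + tB (ee 0 1) b' + tB (ee 1 1) b''" for a b b' b''
  define W where "W = {t a b b' b'' | a b b' b''. a \<in> \<A> \<and> b \<in> \<B> \<and> b' \<in> \<B> \<and> b'' \<in> \<B>}"
  have t_add: "t a b b' b'' + t a1 b1 b1' b1'' = t (a + a1) (b + b1) (b' + b1') (b'' + b1'')"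
    and t_scale: "sL k (t a b b' b'') = t (sA k a) (sA k b) (sA k b') (sA k b'')"
    if "a \<in> \<A>" "b \<in> \<B>" "b' \<in> \<B>" "b'' \<in> \<B>" "a1 \<in> \<A>" "b1 \<in> \<B>" "b1' \<in> \<B>" "b1'' \<in> \<B>"
    for a b b' b'' a1 b1 b1' b1'' k
    using that ee root_in
    by (simp_all add: t_def tA_add_right tB_add_right tA_scale_right tB_scale_right scale_right_distrib)
  have t_zero: "t 0 0 0 0 = 0" using ee root_in by (simp add: t_def)
  note closed = VA.subspace_add[OF subspace_sym] VA.subspace_scale[OF subspace_sym]
    VA.subspace_add[OF subspace_skew] VA.subspace_scale[OF subspace_skew]
  have tW: "t a b b' b'' \<in> W" if "a \<in> \<A>" "b \<in> \<B>" "b' \<in> \<B>" "b'' \<in> \<B>" for a b b' b''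
    using that unfolding W_def by blast
  have W: "subspace W"
  proof (rule subspaceI)
    show "0 \<in> W" using tW[of 0 0 0 0] t_zero by simp
  next
    fix x y assume "x \<in> W" "y \<in> W"
    then show "x + y \<in> W" unfolding W_def using t_add closed by (clarsimp, metis)
  next
    fix k x assume "x \<in> W"
    then show "sL k x \<in> W"
      unfolding W_def using t_scale[of _ _ _ _ 0 0 0 0 k] closed by (clarsimp, metis zero_mem)
  qed
  have sub: "subspace {z. ad2 z \<in> W}"
    using W by (auto simp: subspace_def br_simps)
  have "y \<in> {z. ad2 z \<in> W}" if "y \<in> gens" for y
    using that
  proof (cases rule: gens_cases)
    case (A x a)
    obtain k where "comm root (comm root x) = mat_scale k root"
      using comm_comm_root_skew[OF rank A(1)] by blast
    then have "ad2 y = t (sA k a) 0 0 0"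
      using A root_in ee by (simp add: t_def br_unit_A comm_skew_skew tA_scale_left tA_scale_right)
    then show ?thesis using A closed tW by auto
  next
    case (B s b)
    obtain k k' k'' where "comm root (comm root s) =
        mat_scale k (ee 0 0) + mat_scale k' (ee 0 1) + mat_scale k'' (ee 1 1)"
      using comm_comm_root_sym[OF rank sg B(1)] by blast
    then have "ad2 y = t 0 (sA k b) (sA k' b) (sA k'' b)"
      using B root_in ee mat.subspace_scale[OF subspace_form_symmetric] mat.subspace_add[OF subspace_form_symmetric]
      by (simp add: t_def br_unit_B comm_skew_sym tB_add_left tB_scale_left tB_scale_right)
    then show ?thesis using B closed tW by auto
  next
    case (C v c)
    then have "ad2 y = 0" using root_in by (simp add: br_unit_C root_square[OF rank])
    then show ?thesis using subspace_0[OF W] by simp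
  qed
  moreover have "ang \<beta> \<beta>' \<in> {z. ad2 z \<in> W}" for \<beta> \<beta>'
    using subspace_0[OF W] by (simp add: br_unit_D root_in)
  ultimately have "span (gens \<union> {ang \<beta> \<beta>' | \<beta> \<beta>'. True}) \<subseteq> {z. ad2 z \<in> W}"
    by (intro span_minimal[OF _ sub]) blast
  then have "ad2 z \<in> W" unfolding span_all by blast
  then show ?thesis unfolding W_def t_def by blast
qed

text \<open>Separates the two error terms, in \<ss> \<otimes> B and in D, that arise when \<psi> is
  applied to brackets in \<gg> \<otimes> A.\<close>

lemma tensor_TB_D_zero:
  assumes "q \<in> TB" "d \<in> D" "q + d = 0"
  shows "q = 0"
proof -
  have unique: "y = y'" if "\<exists>!y. P y" "P y" "P y'" for P :: "'l \<times> 'l \<times> 'l \<times> 'l \<Rightarrow> bool" and y y'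
    using that by blast
  have zero: "0 \<in> TA" "0 \<in> TB" "0 \<in> TC" "0 \<in> D"
    by (rule subspace_0[OF subspace_tensor] subspace_0[OF subspace_D])+
  define P where "P = (\<lambda>(p, q, v, d). p \<in> TA \<and> q \<in> TB \<and> v \<in> TC \<and> d \<in> D \<and> 0 = p + q + v + d)"
  have ex1: "\<exists>!y. P y" unfolding P_def by (rule spec[OF decomposition])
  have "(0 :: 'l, q, 0 :: 'l, d) = (0, 0, 0, 0)"
    by (rule unique[OF ex1]) (use assms zero in \<open>simp_all add: P_def\<close>)
  then show ?thesis by simp
qed

section \<open>Reading off the central element from a member of the centroid\<close>

context
  fixes \<psi> assumes \<psi>: "\<psi> \<in> centroid sL br"
begin

lemma \<psi>_linear: "Vector_Spaces.linear sL sL \<psi>"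
  using \<psi> by (simp add: centroid_def)

interpretation \<psi>: Vector_Spaces.linear sL sL \<psi> by (rule \<psi>_linear)

lemma \<psi>_br: "\<psi> (br x y) = br x (\<psi> y)" "\<psi> (br x y) = br (\<psi> x) y"
  using \<psi> unfolding centroid_def by blast+

lemma centroid_root: "\<exists>\<zz>\<in>\<A>. \<psi> (tA root unit) = tA root \<zz>"
proof -
  obtain y where y: "y \<in> \<gg>" "comm root (comm root y) = root"
    using ex_comm_comm_root[OF rank] by blast
  have "ad2 (tA y unit) = tA root unit"
    using y root_in by (simp add: br_unit_A comm_skew_skew)
  then have root: "\<psi> (tA root unit) = ad2 (\<psi> (tA y unit))"
    using \<psi>_br(1) by metis
  show ?thesis
  proof (cases "sg = - 1")
    case True
    then show ?thesis using ad2_range_C unfolding root by blast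
  next
    case False
    then have sg: "sg = 1" using sg_cases by simp
    have r: "0 < r" "1 < r" using rank by auto
    note ee = ee_in[OF r(1) r(1)] ee_in[OF r] ee_in[OF r(2) r(2)]
    obtain a b b' b'' where ab: "a \<in> \<A>" "b \<in> \<B>" "b' \<in> \<B>" "b'' \<in> \<B>"
      "\<psi> (tA root unit) = tA root a + tB (ee 0 0) b + tB (ee 0 1) b' + tB (ee 1 1) b''"
      using ad2_range_BD[OF sg, of "\<psi> (tA y unit)"] unfolding root by blast
    \<comment> \<open>Raising and lowering operators on the plane of \<open>e 0\<close> and
      \<open>e 1\<close>. They annihilate \<open>root\<close>, the exterior product of the two
      vectors, and therefore also \<psi> of \<open>root \<otimes> 1\<close>.\<close>
    let ?E = "skew_dyad (e 0) (f 1)" and ?F = "skew_dyad (e 1) (f 0)"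
    have E_in: "?E \<in> \<gg>" and F_in: "?F \<in> \<gg>" by (rule skew_dyad_in)+
    have E: "?E *v e 0 = 0" "?E *v e 1 = e 0" and F: "?F *v e 0 = e 1" "?F *v e 1 = 0"
      using r by (simp_all add: skew_dyad_apply form_hyperbolic sg)
    have ee_sym: "ee 1 0 = ee 0 1" by (simp add: sym_dyad_def sg add.commute)
    have root': "root = skew_dyad (e 0) (e 1)" using False by (simp add: root_def)
    have sk: "skew_dyad u u = 0" for u by (simp add: skew_dyad_def sg)
    have commE: "comm ?E root = 0" "comm ?E (ee 0 0) = 0" "comm ?E (ee 0 1) = ee 0 0"
      "comm ?E (ee 1 1) = mat_scale 2 (ee 0 1)"
      unfolding comm_sym_dyad[OF E_in] root' comm_skew_dyad[OF E_in] E ee_sym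
      by (simp_all add: skew_dyad_linear sym_dyad_linear sk)
    have commF: "comm ?F root = 0" "comm ?F (ee 0 0) = mat_scale 2 (ee 0 1)"
      unfolding comm_sym_dyad[OF F_in] root' comm_skew_dyad[OF F_in] F ee_sym
      by (simp_all add: skew_dyad_linear sym_dyad_linear sk)
    have ann: "br (tA x unit) (\<psi> (tA root unit)) = 0" if "x \<in> \<gg>" "comm x root = 0" for x
      using that root_in by (simp add: br_unit_A flip: \<psi>_br(1))
    have nz: "ee 0 0 \<noteq> 0" "ee 0 1 \<noteq> 0"
    proof -
      have "ee 0 0 *v f 0 = 2 *s e 0" "ee 0 1 *v f 1 = e 0"
        using r by (simp_all add: sym_dyad_apply form_hyperbolic sg)
      then show "ee 0 0 \<noteq> 0" "ee 0 1 \<noteq> 0" using hyperbolic_nonzero(1)[OF r(1)] by auto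
    qed
    \<comment> \<open>\<open>?E\<close> sends the three symmetric products to 0,
      \<open>ee 0 0\<close> and \<open>2 (ee 0 1)\<close>; applying it once more isolates
      \<open>b''\<close>.\<close>
    have E1: "tB (ee 0 0) b' + sL 2 (tB (ee 0 1) b'') = 0"
      using ann[OF E_in commE(1)] ab ee E_in root_in
      by (simp add: br_add_right br_unit_A br_unit_B commE tB_scale_left del: One_nat_def)
    then have "br (tA ?E unit) (tB (ee 0 0) b' + sL 2 (tB (ee 0 1) b'')) = 0" by simp
    then have "tB (ee 0 0) b'' = tB (ee 0 0) 0"
      using ab ee E_in by (simp add: br_add_right br_scale_right br_unit_B commE del: One_nat_def)
    then have b'': "b'' = 0" using tB_inj[OF ee(1) nz(1) ab(4) zero_mem(4)] by blast
    then have "tB (ee 0 0) b' = tB (ee 0 0) 0" using E1 ee by simp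
    then have b': "b' = 0" using tB_inj[OF ee(1) nz(1) ab(3) zero_mem(4)] by blast
    \<comment> \<open>The coefficient \<open>b\<close> belongs to the highest vector, invisible to
      \<open>?E\<close>, so \<open>?F\<close> is used.\<close>
    have "sL 2 (tB (ee 0 1) b) = 0"
      using ann[OF F_in commF(1)] ab ee F_in root_in
      by (simp add: br_add_right br_unit_A br_unit_B commF tB_scale_left b' b'' del: One_nat_def)
    then have "tB (ee 0 1) b = tB (ee 0 1) 0" using ee by simp
    then have "b = 0" using tB_inj[OF ee(2) nz(2) ab(2) zero_mem(4)] by simp
    then show ?thesis using ab b' b'' ee by auto
  qed
qed

text \<open>The \<open>x\<close> for which the formula holds form an ideal of \<gg>, because \<psi>
  commutes with \<open>ad(x \<otimes> 1)\<close>, and this ideal contains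
  \<open>root\<close>.\<close>

lemma centroid_unit: "\<exists>\<zz>\<in>\<A>. \<forall>x\<in>\<gg>. \<psi> (tA x unit) = tA x \<zz>"
proof -
  obtain \<zz> where \<zz>: "\<zz> \<in> \<A>" "\<psi> (tA root unit) = tA root \<zz>" using centroid_root by blast
  define I where "I = {x \<in> \<gg>. \<psi> (tA x unit) = tA x \<zz>}"
  have "mat.subspace I"
    using \<zz>(1) mat.subspace_add[OF subspace_form_algebra] mat.subspace_scale[OF subspace_form_algebra]
    by (auto simp: I_def mat.subspace_def tA_add_left tA_scale_left \<psi>.add \<psi>.scale)
  moreover have "comm x y \<in> I" if "x \<in> \<gg>" "y \<in> I" for x y
  proof -
    have y: "y \<in> \<gg>" "\<psi> (tA y unit) = tA y \<zz>" using that by (auto simp: I_def)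
    have "\<psi> (tA (comm x y) unit) = br (tA x unit) (\<psi> (tA y unit))"
      using \<psi>_br(1)[of "tA x unit" "tA y unit"] that y by (simp add: br_unit_A)
    also have "\<dots> = tA (comm x y) \<zz>" using that y \<zz> by (simp add: br_unit_A)
    finally show ?thesis using that y comm_skew_skew by (simp add: I_def)
  qed
  moreover have "root \<in> I" using root_in \<zz>(2) by (simp add: I_def)
  ultimately have "\<gg> \<subseteq> I" by (rule ideal_eq_form_algebra[OF rank])
  then show ?thesis using \<zz>(1) unfolding I_def by blast
qed

context
  fixes \<zz> assumes \<zz>_sym: "\<zz> \<in> \<A>" and \<psi>_unit: "\<And>x. x \<in> \<gg> \<Longrightarrow> \<psi> (tA x unit) = tA x \<zz>"
begin

text \<open>Move \<psi> onto the first factor of \<open>[x \<otimes> 1, y \<otimes> a]\<close>.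
  Under exchange of \<open>x\<close> and \<open>y\<close> the result must change sign, while
  \<open>circ\<close> and the trace are symmetric; so their contribution equals its own
  negative.\<close>

lemma centroid_bracket:
  assumes "x \<in> \<gg>" "y \<in> \<gg>" "a \<in> \<A>"
  shows "tB (circ x y) (sA (1 / 2) (mul \<zz> a - mul a \<zz>)) + sL (trace (x ** y)) (ang (\<zz>, 0) (a, 0)) = 0"
    "\<psi> (tA (comm x y) a) = tA (comm x y) (sA (1 / 2) (mul \<zz> a + mul a \<zz>))"
proof -
  let ?J = "sA (1 / 2) (mul \<zz> a + mul a \<zz>)"
  let ?R = "tB (circ x y) (sA (1 / 2) (mul \<zz> a - mul a \<zz>)) + sL (trace (x ** y)) (ang (\<zz>, 0) (a, 0))"
  have *: "\<psi> (tA (comm x y) a) = tA (comm x y) ?J +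
      (tB (circ x y) (sA (1 / 2) (mul \<zz> a - mul a \<zz>)) + sL (trace (x ** y)) (ang (\<zz>, 0) (a, 0)))"
    if "x \<in> \<gg>" "y \<in> \<gg>" for x y
  proof -
    have "\<psi> (tA (comm x y) a) = \<psi> (br (tA x unit) (tA y a))"
      using that assms(3) by (simp add: br_unit_A)
    also have "\<dots> = br (tA x \<zz>) (tA y a)" using \<psi>_br(2) \<psi>_unit that by simp
    also have "\<dots> = tA (comm x y) ?J +
      (tB (circ x y) (sA (1 / 2) (mul \<zz> a - mul a \<zz>)) + sL (trace (x ** y)) (ang (\<zz>, 0) (a, 0)))"
      using br_AA[OF that \<zz>_sym assms(3)] by (simp only: add.assoc)
    finally show ?thesis .
  qed
  have J: "?J \<in> \<A>" using jordan_in(1)[OF \<zz>_sym assms(3)] .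
  have cxy: "comm x y \<in> \<gg>" using assms comm_skew_skew by blast
  have neg: "tA (comm y x) a' = - tA (comm x y) a'" if "a' \<in> \<A>" for a'
    using tA_scale_left[OF cxy that, of "- 1"] comm_swap[of y x] by simp
  have "- \<psi> (tA (comm x y) a) = - tA (comm x y) ?J + ?R"
    using *[OF assms(2,1)] neg[OF assms(3)] neg[OF J] circ_commute[of y x] trace_mul_sym[of y x]
    by (simp add: \<psi>.neg)
  moreover have "R + R = 0" if "- u = - j + R" "u = j + R" for u j R :: 'l
  proof -
    have "j + - u = R" by (subst that(1)) simp
    then have "- R = R" using that(2) by simp
    then show ?thesis by (metis left_minus)
  qed
  ultimately have "?R + ?R = 0" using *[OF assms(1,2)] by blast
  then have "sL 2 ?R = 0" using scale_left_distrib[of 1 1 ?R] by simp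
  then show R: "?R = 0" by (simp only: scale_eq_0_iff) simp
  show "\<psi> (tA (comm x y) a) = tA (comm x y) ?J" using *[OF assms(1,2)] R by simp
qed

lemma half_diff_zero: "sA (1 / 2) (\<alpha> - \<alpha>') = 0 \<Longrightarrow> \<alpha> = \<alpha>'"
  by simp

text \<open>Take \<open>y = x\<close> with \<open>circ x x \<noteq> 0\<close> in the vanishing error
  term; directness of the decomposition isolates the commutator.\<close>

lemma centroid_commute_A:
  assumes "a \<in> \<A>"
  shows "mul \<zz> a = mul a \<zz>"
proof -
  obtain x where x: "x \<in> \<gg>" "circ x x \<noteq> 0" using ex_skew_witness[OF rank] by metis
  have K: "sA (1 / 2) (mul \<zz> a - mul a \<zz>) \<in> \<B>" using commutator_in(1)[OF \<zz>_sym assms] .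
  have "tB (circ x x) (sA (1 / 2) (mul \<zz> a - mul a \<zz>)) = tB (circ x x) 0"
    using tensor_TB_D_zero[OF tensor_mem[OF circ_skew_skew[OF x(1) x(1)] K] subspace_scale[OF subspace_D ang_in]
        centroid_bracket(1)[OF x(1) x(1) assms]] circ_skew_skew[OF x(1) x(1)] by simp
  then have "sA (1 / 2) (mul \<zz> a - mul a \<zz>) = 0"
    using tB_inj[OF circ_skew_skew[OF x(1) x(1)] x(2) K zero_mem(4)] by blast
  then show ?thesis by (rule half_diff_zero)
qed

lemma centroid_A:
  assumes "x \<in> \<gg>" "a \<in> \<A>"
  shows "\<psi> (tA x a) = tA x (mul \<zz> a)"
proof -
  have J: "sA (1 / 2) (mul \<zz> a + mul a \<zz>) = mul \<zz> a"
    unfolding centroid_commute_A[OF assms(2), symmetric] by (rule VA_half)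
  then have za: "mul \<zz> a \<in> \<A>" using jordan_in(1)[OF \<zz>_sym assms(2)] by metis
  define I where "I = {x \<in> \<gg>. \<psi> (tA x a) = tA x (mul \<zz> a)}"
  have "mat.subspace I"
    using assms(2) za mat.subspace_add[OF subspace_form_algebra] mat.subspace_scale[OF subspace_form_algebra]
    by (auto simp: I_def mat.subspace_def tA_add_left tA_scale_left \<psi>.add \<psi>.scale)
  moreover have "comm x y \<in> I" if "x \<in> \<gg>" "y \<in> \<gg>" for x y
    using centroid_bracket(2)[OF that assms(2)] that comm_skew_skew unfolding J by (simp add: I_def)
  ultimately have "\<gg> \<subseteq> I" by (rule perfect_induct[OF rank])
  then show ?thesis using assms(1) unfolding I_def by blast
qed

lemma centroid_bracket_B:
  assumes "x \<in> \<gg>" "s \<in> \<ss>" "b \<in> \<B>"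
  shows "\<psi> (tB (comm x s) b) = tA (circ x s) (sA (1 / 2) (mul \<zz> b - mul b \<zz>)) +
     tB (comm x s) (sA (1 / 2) (mul \<zz> b + mul b \<zz>))"
proof -
  have "\<psi> (tB (comm x s) b) = \<psi> (br (tA x unit) (tB s b))"
    using assms by (simp add: br_unit_B)
  also have "\<dots> = br (tA x \<zz>) (tB s b)" using \<psi>_br(2) \<psi>_unit assms by simp
  finally show ?thesis using br_AB[OF assms(1,2) \<zz>_sym assms(3)] by simp
qed

text \<open>For commuting \<open>x\<close> and \<open>s\<close> the left-hand side of
  \<open>centroid_bracket_B\<close> vanishes, and only the commutator term on
  \<open>circ x s \<noteq> 0\<close> is left.\<close>

lemma centroid_commute_B:
  assumes "b \<in> \<B>"
  shows "mul \<zz> b = mul b \<zz>"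
proof -
  obtain x s where x: "x \<in> \<gg>" "s \<in> \<ss>" "comm x s = 0" "circ x s \<noteq> 0"
    using ex_mixed_witness[OF rank] by metis
  have K: "sA (1 / 2) (mul \<zz> b - mul b \<zz>) \<in> \<A>" using commutator_in(3)[OF \<zz>_sym assms] .
  have J: "sA (1 / 2) (mul \<zz> b + mul b \<zz>) \<in> \<B>" using jordan_in(3)[OF \<zz>_sym assms] .
  have "tA (circ x s) (sA (1 / 2) (mul \<zz> b - mul b \<zz>)) = tA (circ x s) 0"
    using centroid_bracket_B[OF x(1,2) assms] circ_skew_sym[OF x(1,2)] assms x(3) tensor_zero(3)[OF J]
    by simp
  then have "sA (1 / 2) (mul \<zz> b - mul b \<zz>) = 0"
    using tA_inj[OF circ_skew_sym[OF x(1,2)] x(4) K zero_mem(3)] by blast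
  then show ?thesis by (rule half_diff_zero)
qed

lemma centroid_B:
  assumes "s \<in> \<ss>" "b \<in> \<B>"
  shows "\<psi> (tB s b) = tB s (mul \<zz> b)"
proof -
  have J: "sA (1 / 2) (mul \<zz> b + mul b \<zz>) = mul \<zz> b"
    unfolding centroid_commute_B[OF assms(2), symmetric] by (rule VA_half)
  then have zb: "mul \<zz> b \<in> \<B>" using jordan_in(3)[OF \<zz>_sym assms(2)] by metis
  define I where "I = {x \<in> \<ss>. \<psi> (tB x b) = tB x (mul \<zz> b)}"
  have "mat.subspace I"
    using assms(2) zb mat.subspace_add[OF subspace_form_symmetric] mat.subspace_scale[OF subspace_form_symmetric]
    by (auto simp: I_def mat.subspace_def tB_add_left tB_scale_left \<psi>.add \<psi>.scale)
  moreover have "comm x s \<in> I" if "x \<in> \<gg>" "s \<in> \<ss>" for x s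
    using centroid_bracket_B[OF that assms(2)] centroid_commute_B[OF assms(2)] that
      comm_skew_sym circ_skew_sym J by (simp add: I_def)
  ultimately have "\<ss> \<subseteq> I" by (rule symmetric_induct)
  then show ?thesis using assms(1) unfolding I_def by blast
qed

lemma centroid_C: "\<psi> (tC v c) = tC v (act \<zz> c)"
proof -
  have "vec.subspace {v. \<psi> (tC v c) = tC v (act \<zz> c)}"
    by (auto simp: vec.subspace_def tC_add_left tC_scale_left \<psi>.add \<psi>.scale)
  moreover have "x *v u \<in> {v. \<psi> (tC v c) = tC v (act \<zz> c)}" if "x \<in> \<gg>" for x u
  proof -
    have "\<psi> (tC (x *v u) c) = \<psi> (br (tA x unit) (tC u c))"
      using that by (simp add: br_unit_C)
    also have "\<dots> = br (tA x \<zz>) (tC u c)" using \<psi>_br(2) \<psi>_unit that by simp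
    finally show ?thesis using that \<zz>_sym by (simp add: br_AC)
  qed
  ultimately show ?thesis using subspace_vector_induct[OF rank] by blast
qed

text \<open>Commutativity has been proved on A and B; the associators vanish since the algebra is
  associative or, for \<open>C\<^sub>3\<close>, since A lies in the nucleus.\<close>

lemma centroid_center: "\<zz> \<in> algebra_center mul"
proof -
  have "mul \<zz> \<alpha> = mul \<alpha> \<zz>" for \<alpha>
  proof -
    have "mul \<zz> (sym_part sA \<eta> \<alpha> + skew_part sA \<eta> \<alpha>) = mul (sym_part sA \<eta> \<alpha> + skew_part sA \<eta> \<alpha>) \<zz>"
      by (simp only: mul_add_left mul_add_right centroid_commute_A[OF sym_part_in] centroid_commute_B[OF skew_part_in])
    then show ?thesis by (simp only: sym_skew_decomp)
  qed
  moreover have "\<zz> \<in> algebra_nucleus mul"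
  proof (cases "X = Type_C \<and> r = 3")
    case True
    then show ?thesis using alternative \<zz>_sym by blast
  next
    case False
    then show ?thesis using assoc by (simp add: associative_algebra_def algebra_nucleus_def)
  qed
  ultimately show ?thesis by (simp add: algebra_center_def algebra_nucleus_def)
qed

text \<open>Both ways of moving \<psi> into \<open>[x \<otimes> a, x \<otimes> a']\<close> agree
  outside D by the formulas already known; what remains compares the D-components, scaled by the
  nonzero \<open>tr(xx)\<close>. The cases B and C are analogous.\<close>

lemma centroid_ang:
  "\<psi> (ang \<beta> \<beta>') = ang (a_smult mul act \<zz> \<beta>) \<beta>'" "\<psi> (ang \<beta> \<beta>') = ang \<beta> (a_smult mul act \<zz> \<beta>')"
proof -
  note c = centroid_center \<zz>_sym
  note simps = \<psi>.add \<psi>.scale centroid_A centroid_B centroid_C mul_scale_right mul_add_right mul_diff_right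
    center_slide[OF c(1)] comm_skew_skew comm_sym_sym circ_skew_skew circ_sym_sym
    jordan_in commutator_in center_mult_sym[OF c] sym_part_in skew_part_in gamma_range sigma_range
    chi_linear chi_center[OF c] sym_part_center[OF c]
  have A: "\<psi> (ang (a, 0) (a', 0)) = ang (mul \<zz> a, 0) (a', 0)"
    "\<psi> (ang (a, 0) (a', 0)) = ang (a, 0) (mul \<zz> a', 0)" if "a \<in> \<A>" "a' \<in> \<A>" for a a'
  proof -
    obtain x where x: "x \<in> \<gg>" "trace (x ** x) \<noteq> 0" using ex_skew_witness[OF rank] by metis
    show "\<psi> (ang (a, 0) (a', 0)) = ang (mul \<zz> a, 0) (a', 0)"
      "\<psi> (ang (a, 0) (a', 0)) = ang (a, 0) (mul \<zz> a', 0)"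
      using \<psi>_br[of "tA x a" "tA x a'"] x that by (simp_all add: br_AA simps)
  qed
  have B: "\<psi> (ang (b, 0) (b', 0)) = ang (mul \<zz> b, 0) (b', 0)"
    "\<psi> (ang (b, 0) (b', 0)) = ang (b, 0) (mul \<zz> b', 0)" if "b \<in> \<B>" "b' \<in> \<B>" for b b'
  proof -
    obtain s where s: "s \<in> \<ss>" "trace (s ** s) \<noteq> 0" using ex_sym_witness[OF rank] by metis
    show "\<psi> (ang (b, 0) (b', 0)) = ang (mul \<zz> b, 0) (b', 0)"
      "\<psi> (ang (b, 0) (b', 0)) = ang (b, 0) (mul \<zz> b', 0)"
      using \<psi>_br[of "tB s b" "tB s b'"] s that by (simp_all add: br_BB simps)
  qed
  have C: "\<psi> (ang (0, c) (0, c')) = ang (0, act \<zz> c) (0, c')"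
    "\<psi> (ang (0, c) (0, c')) = ang (0, c) (0, act \<zz> c')" for c c'
  proof -
    have "0 < r" using rank by simp
    then show "\<psi> (ang (0, c) (0, c')) = ang (0, act \<zz> c) (0, c')"
      "\<psi> (ang (0, c) (0, c')) = ang (0, c) (0, act \<zz> c')"
      using \<psi>_br[of "tC (e 0) c" "tC (f 0) c'"] by (simp_all add: br_CC simps form_hyperbolic)
  qed
  obtain \<alpha> c \<alpha>' c' where \<beta>: "\<beta> = (\<alpha>, c)" "\<beta>' = (\<alpha>', c')" by (cases \<beta>, cases \<beta>')
  show "\<psi> (ang \<beta> \<beta>') = ang (a_smult mul act \<zz> \<beta>) \<beta>'"
    unfolding \<beta> a_smult_def fst_conv snd_conv
      ang_decomp[of \<alpha>] ang_decomp[of "mul \<zz> \<alpha>"] sym_part_center[OF c(1) \<zz>_sym]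
    by (simp add: \<psi>.add A(1) B(1) C(1) sym_part_in skew_part_in)
  show "\<psi> (ang \<beta> \<beta>') = ang \<beta> (a_smult mul act \<zz> \<beta>')"
    unfolding \<beta> a_smult_def fst_conv snd_conv ang_decomp[of \<alpha>] sym_part_center[OF c(1) \<zz>_sym]
    by (simp add: \<psi>.add A(2) B(2) C(2) sym_part_in skew_part_in)
qed

lemma centroid_frak_Z: "\<zz> \<in> frak_Z mul \<eta> act ang"
proof -
  have "(\<Sum>t<N. ang (a_smult mul act \<zz> (\<beta> t)) (\<beta>' t)) = 0" if "(\<Sum>t<N. ang (\<beta> t) (\<beta>' t)) = 0"
    for N :: nat and \<beta> \<beta>'
  proof -
    have "\<psi> (\<Sum>t<N. ang (\<beta> t) (\<beta>' t)) = 0" using that by simp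
    then show ?thesis by (simp add: \<psi>.sum centroid_ang(1))
  qed
  moreover have "ang (a_smult mul act \<zz> \<beta>) \<beta>' = ang \<beta> (a_smult mul act \<zz> \<beta>')" for \<beta> \<beta>'
    using centroid_ang by metis
  ultimately show ?thesis
    unfolding frak_Z_def using centroid_center \<zz>_sym by blast
qed

lemma centroid_action: "action \<zz> \<psi>"
  unfolding action_def given_by_def using centroid_A centroid_B centroid_C centroid_ang by blast

end

text \<open>A single nonzero \<open>x\<close> determines \<zz>. Consequently, membership in
  \<open>frak_Z\<close> never has to be checked by hand for an element coming from the
  centroid.\<close>

lemma centroid_read_off:
  assumes "x \<in> \<gg>" "x \<noteq> 0" "\<zz> \<in> \<A>" "\<psi> (tA x unit) = tA x \<zz>"
  shows "\<zz> \<in> frak_Z mul \<eta> act ang" "action \<zz> \<psi>"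
proof -
  obtain \<zz>' where \<zz>': "\<zz>' \<in> \<A>" "\<And>x. x \<in> \<gg> \<Longrightarrow> \<psi> (tA x unit) = tA x \<zz>'"
    using centroid_unit by blast
  then have "\<zz>' = \<zz>" using tA_inj[OF assms(1,2) \<zz>'(1) assms(3)] assms by simp
  then show "\<zz> \<in> frak_Z mul \<eta> act ang" "action \<zz> \<psi>"
    using centroid_frak_Z[OF \<zz>'] centroid_action[OF \<zz>'] by auto
qed

lemma centroid_has_action: "\<exists>\<zz>\<in>frak_Z mul \<eta> act ang. action \<zz> \<psi>"
  using centroid_unit centroid_frak_Z centroid_action by blast

end

section \<open>The isomorphism of algebras\<close>

theorem centroid_iso:
  "\<exists>\<Phi>. algebra_iso (frak_Z mul \<eta> act ang) (+) sA mul
       (centroid sL br) (\<lambda>\<phi> \<psi> z. \<phi> z + \<psi> z) (\<lambda>k \<phi> z. sL k (\<phi> z)) (\<circ>) \<Phi> \<and>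
     (\<forall>\<zz>\<in>frak_Z mul \<eta> act ang. given_by form mul \<eta> act tA tB tC ang \<zz> (\<Phi> \<zz>))"
proof -
  let ?Z = "frak_Z mul \<eta> act ang"
  \<comment> \<open>The choice is harmless: the prescribed values determine a linear map, as tensors
    and angle brackets span L.\<close>
  define \<Phi> where "\<Phi> \<zz> = (SOME \<Psi>. Vector_Spaces.linear sL sL \<Psi> \<and> action \<zz> \<Psi>)" for \<zz>
  have \<Phi>: "Vector_Spaces.linear sL sL (\<Phi> \<zz>)" "action \<zz> (\<Phi> \<zz>)" if "\<zz> \<in> ?Z" for \<zz>
    using someI_ex[of "\<lambda>\<Psi>. Vector_Spaces.linear sL sL \<Psi> \<and> action \<zz> \<Psi>"] action_exists[OF that]
    unfolding \<Phi>_def by metis+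
  have cent: "\<Phi> \<zz> \<in> centroid sL br" if "\<zz> \<in> ?Z" for \<zz>
    using action_in_centroid[OF frak_ZD(1,2)[OF that] \<Phi>[OF that]] .
  have lin: "Vector_Spaces.linear sL sL \<psi>" if "\<psi> \<in> centroid sL br" for \<psi>
    using that by (simp add: centroid_def)
  have eq: "\<psi> = \<Phi> \<zz>" if "\<psi> \<in> centroid sL br" "\<zz> \<in> ?Z" "action \<zz> \<psi>" for \<psi> \<zz>
    using action_unique[OF lin[OF that(1)] \<Phi>(1)[OF that(2)] that(3) \<Phi>(2)[OF that(2)]] .
  have root: "root \<in> \<gg>" "root \<noteq> 0" using root_in root_nonzero[OF rank] by auto
  have at_root: "\<Phi> \<zz> (tA root unit) = tA root \<zz>" if "\<zz> \<in> ?Z" for \<zz>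
    using actionD(1)[OF \<Phi>(2)[OF that] root(1) unit_sym] by (simp add: unit)
  \<comment> \<open>Closure of \<open>frak_Z\<close> and the homomorphism laws come together: sums,
    multiples and composites of centroid elements are again in the centroid, and their value at
    \<open>root \<otimes> 1\<close> names the corresponding element.\<close>
  have hom: "w \<in> ?Z \<and> \<Phi> w = \<psi>"
    if "\<psi> \<in> centroid sL br" "\<psi> (tA root unit) = tA root w" "w \<in> \<A>" for \<psi> w
    using centroid_read_off[OF that(1) root that(3,2)] eq[OF that(1)] by metis
  have inj: "inj_on \<Phi> ?Z"
    by (rule inj_onI) (metis at_root frak_ZD(2) root tA_inj)
  have surj: "\<Phi> ` ?Z = centroid sL br"
    using cent eq centroid_has_action by (auto simp: image_iff) metis
  have add: "\<zz> + \<zz>' \<in> ?Z \<and> \<Phi> (\<zz> + \<zz>') = (\<lambda>z. \<Phi> \<zz> z + \<Phi> \<zz>' z)" if "\<zz> \<in> ?Z" "\<zz>' \<in> ?Z" for \<zz> \<zz>'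
  proof (rule hom)
    note c = cent[OF that(1)] cent[OF that(2)]
    interpret f: Vector_Spaces.linear sL sL "\<Phi> \<zz>" by (rule lin[OF c(1)])
    interpret g: Vector_Spaces.linear sL sL "\<Phi> \<zz>'" by (rule lin[OF c(2)])
    have "Vector_Spaces.linear sL sL (\<lambda>z. \<Phi> \<zz> z + \<Phi> \<zz>' z)"
      by unfold_locales (simp_all add: f.add g.add f.scale g.scale scale_right_distrib)
    moreover have "\<Phi> \<zz> (br x y) + \<Phi> \<zz>' (br x y) = br x (\<Phi> \<zz> y + \<Phi> \<zz>' y)"
      "\<Phi> \<zz> (br x y) + \<Phi> \<zz>' (br x y) = br (\<Phi> \<zz> x + \<Phi> \<zz>' x) y" for x y
      unfolding br_add_left br_add_right using \<psi>_br[OF c(1)] \<psi>_br[OF c(2)] by metis+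
    ultimately show "(\<lambda>z. \<Phi> \<zz> z + \<Phi> \<zz>' z) \<in> centroid sL br"
      unfolding centroid_def by blast
    show "\<Phi> \<zz> (tA root unit) + \<Phi> \<zz>' (tA root unit) = tA root (\<zz> + \<zz>')"
      using that root by (simp add: at_root tA_add_right frak_ZD(2))
    show "\<zz> + \<zz>' \<in> \<A>" using that by (intro VA.subspace_add[OF subspace_sym] frak_ZD(2))
  qed
  have scale: "sA k \<zz> \<in> ?Z \<and> \<Phi> (sA k \<zz>) = (\<lambda>z. sL k (\<Phi> \<zz> z))" if "\<zz> \<in> ?Z" for \<zz> k
  proof (rule hom)
    note c = cent[OF that]
    interpret f: Vector_Spaces.linear sL sL "\<Phi> \<zz>" by (rule lin[OF c])
    have "Vector_Spaces.linear sL sL (\<lambda>z. sL k (\<Phi> \<zz> z))"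
      by unfold_locales (simp_all add: f.add f.scale scale_right_distrib mult.commute)
    moreover have "sL k (\<Phi> \<zz> (br x y)) = br x (sL k (\<Phi> \<zz> y))"
      "sL k (\<Phi> \<zz> (br x y)) = br (sL k (\<Phi> \<zz> x)) y" for x y
      unfolding br_scale_left br_scale_right using \<psi>_br[OF c] by metis+
    ultimately show "(\<lambda>z. sL k (\<Phi> \<zz> z)) \<in> centroid sL br"
      unfolding centroid_def by blast
    show "sL k (\<Phi> \<zz> (tA root unit)) = tA root (sA k \<zz>)"
      using that root by (simp add: at_root tA_scale_right frak_ZD(2))
    show "sA k \<zz> \<in> \<A>" using that by (intro VA.subspace_scale[OF subspace_sym] frak_ZD(2))
  qed
  have mult: "mul \<zz> \<zz>' \<in> ?Z \<and> \<Phi> (mul \<zz> \<zz>') = \<Phi> \<zz> \<circ> \<Phi> \<zz>'" if "\<zz> \<in> ?Z" "\<zz>' \<in> ?Z" for \<zz> \<zz>'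
  proof (rule hom)
    note c = cent[OF that(1)] cent[OF that(2)]
    interpret f: Vector_Spaces.linear sL sL "\<Phi> \<zz>" by (rule lin[OF c(1)])
    interpret g: Vector_Spaces.linear sL sL "\<Phi> \<zz>'" by (rule lin[OF c(2)])
    have "Vector_Spaces.linear sL sL (\<Phi> \<zz> \<circ> \<Phi> \<zz>')"
      by unfold_locales (simp_all add: f.add g.add f.scale g.scale)
    moreover have "\<Phi> \<zz> (\<Phi> \<zz>' (br x y)) = br x (\<Phi> \<zz> (\<Phi> \<zz>' y))"
      "\<Phi> \<zz> (\<Phi> \<zz>' (br x y)) = br (\<Phi> \<zz> (\<Phi> \<zz>' x)) y" for x y
      using \<psi>_br[OF c(1)] \<psi>_br[OF c(2)] by metis+
    ultimately show "\<Phi> \<zz> \<circ> \<Phi> \<zz>' \<in> centroid sL br"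
      by (simp add: centroid_def)
    show "(\<Phi> \<zz> \<circ> \<Phi> \<zz>') (tA root unit) = tA root (mul \<zz> \<zz>')"
      using actionD(1)[OF \<Phi>(2)[OF that(1)] root(1)] frak_ZD(2)[OF that(2)] at_root[OF that(2)] by simp
    show "mul \<zz> \<zz>' \<in> \<A>" using center_mult_sym(1) frak_ZD(1,2) that by metis
  qed
  have "algebra_iso ?Z (+) sA mul (centroid sL br) (\<lambda>\<phi> \<psi> z. \<phi> z + \<psi> z) (\<lambda>k \<phi> z. sL k (\<phi> z)) (\<circ>) \<Phi>"
    unfolding algebra_iso_def bij_betw_def using inj surj add scale mult by simp
  moreover have "\<forall>\<zz>\<in>?Z. given_by form mul \<eta> act tA tB tC ang \<zz> (\<Phi> \<zz>)"
    using \<Phi>(2) unfolding action_def by simp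
  ultimately show ?thesis by blast
qed

end

theorem theorem5p18:
  fixes form :: "'f::field_char_0^'n \<Rightarrow> 'f^'n \<Rightarrow> 'f"
    and sL :: "'f \<Rightarrow> 'l::ab_group_add \<Rightarrow> 'l"
    and sA :: "'f \<Rightarrow> 'a::ab_group_add \<Rightarrow> 'a"
    and sC :: "'f \<Rightarrow> 'c::ab_group_add \<Rightarrow> 'c"
  assumes "BC_graded_structure X r form e f sL br sA mul unit \<eta> sC act chi tA tB tC D ang der \<gamma> \<sigma>"
  shows "(\<exists>\<Phi>. algebra_iso
             (frak_Z mul \<eta> act ang) (+) sA mul
             (centroid sL br) (\<lambda>\<phi> \<psi> z. \<phi> z + \<psi> z) (\<lambda>k \<phi> z. sL k (\<phi> z)) (\<circ>) \<Phi> \<and>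
           (\<forall>\<zz>\<in>frak_Z mul \<eta> act ang. given_by form mul \<eta> act tA tB tC ang \<zz> (\<Phi> \<zz>))) \<and>
         (\<forall>\<zz>\<in>frak_Z mul \<eta> act ang. \<forall>\<Psi>. Vector_Spaces.linear sL sL \<Psi> \<and>
           given_by form mul \<eta> act tA tB tC ang \<zz> \<Psi> \<longrightarrow> \<Psi> \<in> centroid sL br) \<and>
         (\<forall>\<psi>\<in>centroid sL br. \<exists>\<zz>\<in>frak_Z mul \<eta> act ang.
           given_by form mul \<eta> act tA tB tC ang \<zz> \<psi>)"
proof -
  interpret BC_graded_structure X r form e f sL br sA mul unit \<eta> sC act chi tA tB tC D ang der \<gamma> \<sigma>
    by (rule assms)
  show ?thesis
    using centroid_iso action_in_centroid[OF frak_ZD(1,2)] centroid_has_action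
    unfolding action_def by blast
qed

end
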